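(* Let $(M,\mathcal{G},W)$ be a generalized Lagrange-Weyl manifold and let $H$ be a nonlinear connection on $TM$. Then there exists a unique d-connection $\nabla$ on $TM$ (with respect to $H$) which is compatible with $(M,\mathcal{G},W)$, horizontal and h-symmetric.
   Context: Let $M$ be a smooth $n$-dimensional real manifold with tangent bundle $\pi:TM\to M$. A chart $(x^i)$ of $M$ induces a chart $(x^i,y^i)$ of $TM$. A d-tensor field of type $(r,s)$ on $TM$ is a smooth object on $TM$ given in each induced chart by components depending on $(x,y)$, which under a change of charts on $M$ transform exactly like the components of an $(r,s)$-tensor field on $M$. Summation over repeated indices is understood. **Generalized Lagrange metric (GL-metric).** A d-tensor field $g=(g_{ij}(x,y))$ of type $(0,2)$ on $TM$ such that (i) $g_{ij}=g_{ji}$; (ii) $\det(g_{ij})\neq 0$; (iii) the quadratic form $\xi\mapsto g_{ij}(x,y)\xi^i\xi^j$, $\xi\in\mathbb{R}^n$, has constant signature. **Conformal structure.** Two GL-metrics $g,\overline g$ are conformally equivalent if there is $f\in C^\infty(M)$ with $\overline g=e^{2f}g$ (functions on $M$ are regarded as functions on $TM$ via $\pi$). A conformal structure $\mathcal{G}$ is an equivalence class of GL-metrics for this relation. **Generalized Lagrange-Weyl manifold.** A triple $(M,\mathcal{G},W)$, where $\mathcal{G}$ is a conformal structure and $W:\mathcal{G}\to\Omega^1(M)$ is a map (into the smooth 1-forms on $M$) such that, for all $g,\overline g\in\mathcal{G}$ with $\overline g=e^{2f}g$, $f\in C^\infty(M)$, one has $W(\overline g)=W(g)+2\,df$. **Nonlinear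 connection.** The vertical distribution is $V(TM)=\ker\pi_*$, with local basis $\left(\frac{\partial}{\partial y^i}\right)$. A nonlinear connection is a smooth distribution $H$ on $TM$ with $TTM=H\oplus V(TM)$. It has an adapted local basis $\frac{\delta}{\delta x^i}=\frac{\partial}{\partial x^i}-N_i^j(x,y)\frac{\partial}{\partial y^j}$. The horizontal lift of $X=X^i(x)\frac{\partial}{\partial x^i}\in\mathcal{X}(M)$ is $X^h=X^i\frac{\delta}{\delta x^i}$. **d-connection (with respect to $H$).** A linear connection $\nabla$ on the manifold $TM$ for which, in every induced chart, there are functions $F^i_{jk}(x,y)$, $C^i_{jk}(x,y)$ with $$\nabla_{\frac{\delta}{\delta x^j}}\frac{\delta}{\delta x^k}=F^i_{jk}\frac{\delta}{\delta x^i},\quad \nabla_{\frac{\delta}{\delta x^j}}\frac{\partial}{\partial y^k}=F^i_{jk}\frac{\partial}{\partial y^i},\quad \nabla_{\frac{\partial}{\partial y^j}}\frac{\delta}{\delta x^k}=C^i_{jk}\frac{\delta}{\delta x^i},\quad \nabla_{\frac{\partial}{\partial y^j}}\frac{\partial}{\partial y^k}=C^i_{jk}\frac{\partial}{\partial y^i}.$$ For a d-tensor field $g=(g_{jk})$ of type $(0,2)$, $\nabla_{X^h}g$ is the d-tensor field with components $X^i g_{jk|i}$, where $$g_{jk|i}=\frac{\delta g_{jk}}{\delta x^i}-g_{ak}F^a_{ij}-g_{ja}F^a_{ik}.$$ A d-connection is **horizontal** if all $C^i_{jk}=0$, and **h-symmetric** if $F^i_{jk}=F^i_{kj}$ for all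 $i,j,k$. It is **compatible** with $(M,\mathcal{G},W)$ if there exists $g\in\mathcal{G}$ such that $\nabla_{X^h}g=W(g)(X)\cdot g$ for every $X\in\mathcal{X}(M)$ (the function $W(g)(X)$ on $M$ being regarded as a function on $TM$ via $\pi$). *)

theory Defs
  imports "HOL-Analysis.Analysis" "HOL-Library.Function_Algebras"
begin

section \<open>Functions as a real vector space\<close>

text \<open>The pointwise real vector space structure on function types; addition and zero come from
  \<^theory>\<open>HOL-Library.Function_Algebras\<close>.\<close>

instantiation "fun" :: (type, real_vector) real_vector
begin

definition scaleR_fun :: "real \<Rightarrow> ('a \<Rightarrow> 'b) \<Rightarrow> 'a \<Rightarrow> 'b"
  where "scaleR_fun r f = (\<lambda>x. r *\<^sub>R f x)"

instance
  by standard (simp_all add: scaleR_fun_def fun_eq_iff scaleR_add_right scaleR_add_left)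

end

section \<open>Smooth manifolds\<close>

primrec Ck_on :: "nat \<Rightarrow> 'e::real_normed_vector set \<Rightarrow> ('e \<Rightarrow> 'b::real_normed_vector) \<Rightarrow> bool"
  where
    "Ck_on 0 S f \<longleftrightarrow> continuous_on S f"
  | "Ck_on (Suc k) S f \<longleftrightarrow>
       f differentiable_on S \<and> (\<forall>v. Ck_on k S (\<lambda>x. frechet_derivative f (at x) v))"

text \<open>Only used for open \<^term>\<open>S\<close>.\<close>

definition smooth_on :: "'e::real_normed_vector set \<Rightarrow> ('e \<Rightarrow> 'b::real_normed_vector) \<Rightarrow> bool"
  where "smooth_on S f \<longleftrightarrow> (\<forall>k. Ck_on k S f)"

text \<open>A chart is a domain together with a coordinate map; the values of the coordinate map
  outside the domain are irrelevant.\<close>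

type_synonym ('a, 'e) chart = "'a set \<times> ('a \<Rightarrow> 'e)"

abbreviation cdom :: "('a, 'e) chart \<Rightarrow> 'a set"
  where "cdom c \<equiv> fst c"

abbreviation cmap :: "('a, 'e) chart \<Rightarrow> 'a \<Rightarrow> 'e"
  where "cmap c \<equiv> snd c"

definition cinv :: "('a, 'e) chart \<Rightarrow> 'e \<Rightarrow> 'a"
  where "cinv c = inv_into (cdom c) (cmap c)"

text \<open>The coordinate change from \<^term>\<open>c\<close> to \<^term>\<open>d\<close>.\<close>

definition transition :: "('a, 'e) chart \<Rightarrow> ('a, 'e) chart \<Rightarrow> 'e \<Rightarrow> 'e"
  where "transition c d = cmap d \<circ> cinv c"

text \<open>A manifold is presented by an atlas on a set, and the topology is the one that makes all
  charts homeomorphisms onto open sets.  The atlas need not be maximal; the chart-wise notions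
  below all refer to the charts of the given atlas, which may be taken to be a maximal one.\<close>

definition points :: "('a, 'e) chart set \<Rightarrow> 'a set"
  where "points A = (\<Union>c\<in>A. cdom c)"

definition smooth_atlas :: "('a, 'e::euclidean_space) chart set \<Rightarrow> bool"
  where "smooth_atlas A \<longleftrightarrow>
    (\<forall>c\<in>A. inj_on (cmap c) (cdom c) \<and> open (cmap c ` cdom c)) \<and>
    (\<forall>c\<in>A. \<forall>d\<in>A. open (cmap c ` (cdom c \<inter> cdom d)) \<and>
                  smooth_on (cmap c ` (cdom c \<inter> cdom d)) (transition c d))"

definition atlas_topology :: "('a, 'e::euclidean_space) chart set \<Rightarrow> 'a topology"
  where "atlas_topology A =
    topology (\<lambda>W. W \<subseteq> points A \<and> (\<forall>c\<in>A. open (cmap c ` (W \<inter> cdom c))))"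

definition smooth_manifold :: "('a, 'e::euclidean_space) chart set \<Rightarrow> bool"
  where "smooth_manifold A \<longleftrightarrow>
    smooth_atlas A \<and> Hausdorff_space (atlas_topology A) \<and> second_countable (atlas_topology A)"

lemma openin_atlas_topology:
  assumes "smooth_atlas A"
  shows "openin (atlas_topology A) W \<longleftrightarrow>
    W \<subseteq> points A \<and> (\<forall>c\<in>A. open (cmap c ` (W \<inter> cdom c)))"
proof -
  let ?P = "\<lambda>W. W \<subseteq> points A \<and> (\<forall>c\<in>A. open (cmap c ` (W \<inter> cdom c)))"
  have "istopology ?P"
    unfolding istopology_def
  proof (intro conjI allI impI)
    fix S T assume S: "?P S" and T: "?P T"
    have "cmap c ` (S \<inter> T \<inter> cdom c) = cmap c ` (S \<inter> cdom c) \<inter> cmap c ` (T \<inter> cdom c)"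
      if "c \<in> A" for c
    proof -
      have "inj_on (cmap c) (cdom c)"
        using assms that by (auto simp: smooth_atlas_def)
      then have "cmap c ` ((S \<inter> cdom c) \<inter> (T \<inter> cdom c)) =
          cmap c ` (S \<inter> cdom c) \<inter> cmap c ` (T \<inter> cdom c)"
        by (intro inj_on_image_Int) auto
      moreover have "S \<inter> T \<inter> cdom c = (S \<inter> cdom c) \<inter> (T \<inter> cdom c)"
        by auto
      ultimately show ?thesis by simp
    qed
    then show "S \<inter> T \<subseteq> points A" "\<forall>c\<in>A. open (cmap c ` (S \<inter> T \<inter> cdom c))"
      using S T by (auto intro: open_Int)
  next
    fix K assume K: "\<forall>S\<in>K. ?P S"
    have "cmap c ` (\<Union>K \<inter> cdom c) = (\<Union>S\<in>K. cmap c ` (S \<inter> cdom c))" for c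
      by auto
    then have "open (cmap c ` (\<Union>K \<inter> cdom c))" if "c \<in> A" for c
      by (metis (no_types, lifting) K open_UN that)
    then show "\<Union>K \<subseteq> points A" "\<forall>c\<in>A. open (cmap c ` (\<Union>K \<inter> cdom c))"
      using K by blast+
  qed
  then show ?thesis
    by (simp add: atlas_topology_def topology_inverse')
qed

definition smooth_funs :: "('a, 'e::euclidean_space) chart set \<Rightarrow> ('a \<Rightarrow> real) set"
  where "smooth_funs A = {f. \<forall>c\<in>A. smooth_on (cmap c ` cdom c) (f \<circ> cinv c)}"

section \<open>Tangent vectors, vector fields and 1-forms\<close>

text \<open>A tangent vector is the family of its components in all charts around the base point,
  subject to the transformation law; the components for all other charts are 0.\<close>

type_synonym ('a, 'e) tvec = "('a, 'e) chart \<Rightarrow> 'e"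

definition tangent_space :: "('a, 'e::euclidean_space) chart set \<Rightarrow> 'a \<Rightarrow> ('a, 'e) tvec set"
  where "tangent_space A p = {v.
    (\<forall>c. c \<notin> A \<or> p \<notin> cdom c \<longrightarrow> v c = 0) \<and>
    (\<forall>c\<in>A. \<forall>d\<in>A. p \<in> cdom c \<inter> cdom d \<longrightarrow>
        v d = frechet_derivative (transition c d) (at (cmap c p)) (v c))}"

text \<open>The tangent vector at \<^term>\<open>p\<close> with components \<^term>\<open>u\<close> in the chart \<^term>\<open>c\<close>.\<close>

definition coord_vec ::
    "('a, 'e::euclidean_space) chart set \<Rightarrow> ('a, 'e) chart \<Rightarrow> 'a \<Rightarrow> 'e \<Rightarrow> ('a, 'e) tvec"
  where "coord_vec A c p u = (\<lambda>d. if d \<in> A \<and> p \<in> cdom d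
    then frechet_derivative (transition c d) (at (cmap c p)) u else 0)"

definition chart_at :: "('a, 'e) chart set \<Rightarrow> 'a \<Rightarrow> ('a, 'e) chart"
  where "chart_at A p = (SOME c. c \<in> A \<and> p \<in> cdom c)"

text \<open>The derivative of a function (defined and smooth near \<^term>\<open>p\<close>) along a tangent vector at
  \<^term>\<open>p\<close>; it does not depend on the chart used to compute it.  As a function of the vector it is
  the differential of \<^term>\<open>f\<close> at \<^term>\<open>p\<close>.\<close>

definition dderiv ::
    "('a, 'e::euclidean_space) chart set \<Rightarrow> ('a \<Rightarrow> real) \<Rightarrow> 'a \<Rightarrow> ('a, 'e) tvec \<Rightarrow> real"
  where "dderiv A f p v =
    (let c = chart_at A p in frechet_derivative (f \<circ> cinv c) (at (cmap c p)) (v c))"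

definition tangent_map ::
    "('a, 'e::euclidean_space) chart set \<Rightarrow> ('b, 'f::euclidean_space) chart set \<Rightarrow> ('a \<Rightarrow> 'b) \<Rightarrow>
      'a \<Rightarrow> ('a, 'e) tvec \<Rightarrow> ('b, 'f) tvec"
  where "tangent_map A B f p v = (let c = chart_at A p in
    (\<lambda>d. if d \<in> B \<and> f p \<in> cdom d
      then frechet_derivative (cmap d \<circ> f \<circ> cinv c) (at (cmap c p)) (v c) else 0))"

definition smooth_vf_on ::
    "('a, 'e::euclidean_space) chart set \<Rightarrow> 'a set \<Rightarrow> ('a \<Rightarrow> ('a, 'e) tvec) \<Rightarrow> bool"
  where "smooth_vf_on A U X \<longleftrightarrow>
    (\<forall>p\<in>U. X p \<in> tangent_space A p) \<and>
    (\<forall>c\<in>A. smooth_on (cmap c ` (U \<inter> cdom c)) (\<lambda>x. X (cinv c x) c))"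

text \<open>Global smooth vector fields are extended by 0 off the manifold, so that equality of
  functions is equality of vector fields.\<close>

definition vector_fields :: "('a, 'e::euclidean_space) chart set \<Rightarrow> ('a \<Rightarrow> ('a, 'e) tvec) set"
  where "vector_fields A = {X. smooth_vf_on A (points A) X \<and> (\<forall>p. p \<notin> points A \<longrightarrow> X p = 0)}"

definition one_forms ::
    "('a, 'e::euclidean_space) chart set \<Rightarrow> ('a \<Rightarrow> ('a, 'e) tvec \<Rightarrow> real) set"
  where "one_forms A = {\<omega>.
    (\<forall>p\<in>points A. \<forall>v\<in>tangent_space A p. \<forall>w\<in>tangent_space A p. \<forall>r s.
        \<omega> p (r *\<^sub>R v + s *\<^sub>R w) = r * \<omega> p v + s * \<omega> p w) \<and>
    (\<forall>c\<in>A. \<forall>u. smooth_on (cmap c ` cdom c) (\<lambda>x. \<omega> (cinv c x) (coord_vec A c (cinv c x) u)))}"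

text \<open>Smooth distributions of rank \<^term>\<open>k\<close>.\<close>

definition smooth_distribution ::
    "('a, 'e::euclidean_space) chart set \<Rightarrow> nat \<Rightarrow> ('a \<Rightarrow> ('a, 'e) tvec set) \<Rightarrow> bool"
  where "smooth_distribution A k H \<longleftrightarrow>
    (\<forall>p\<in>points A. \<exists>U X. openin (atlas_topology A) U \<and> p \<in> U \<and>
      (\<forall>i<k. smooth_vf_on A U (X i)) \<and>
      (\<forall>q\<in>U. H q = span ((\<lambda>i. X i q) ` {..<k}) \<and> dim (H q) = k))"

section \<open>Linear connections\<close>

text \<open>\<^term>\<open>D X Y\<close> stands for \<open>\<nabla>\<^sub>X Y\<close>.  The operators are extensional, so that equality of functions
  is equality of connections.\<close>

definition linear_connection ::
    "('a, 'e::euclidean_space) chart set \<Rightarrow>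
      (('a \<Rightarrow> ('a, 'e) tvec) \<Rightarrow> ('a \<Rightarrow> ('a, 'e) tvec) \<Rightarrow> ('a \<Rightarrow> ('a, 'e) tvec)) \<Rightarrow> bool"
  where "linear_connection A D \<longleftrightarrow>
    D \<in> vector_fields A \<rightarrow>\<^sub>E (vector_fields A \<rightarrow>\<^sub>E vector_fields A) \<and>
    (\<forall>X\<in>vector_fields A. \<forall>X'\<in>vector_fields A. \<forall>Y\<in>vector_fields A. D (X + X') Y = D X Y + D X' Y) \<and>
    (\<forall>X\<in>vector_fields A. \<forall>Y\<in>vector_fields A. \<forall>Y'\<in>vector_fields A. D X (Y + Y') = D X Y + D X Y') \<and>
    (\<forall>f\<in>smooth_funs A. \<forall>X\<in>vector_fields A. \<forall>Y\<in>vector_fields A.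
        D (\<lambda>p. f p *\<^sub>R X p) Y = (\<lambda>p. f p *\<^sub>R D X Y p)) \<and>
    (\<forall>f\<in>smooth_funs A. \<forall>X\<in>vector_fields A. \<forall>Y\<in>vector_fields A.
        D X (\<lambda>p. f p *\<^sub>R Y p) = (\<lambda>p. dderiv A f p (X p) *\<^sub>R Y p + f p *\<^sub>R D X Y p))"

text \<open>A linear connection is a local operator, hence acts on vector fields that are only defined
  near a point: extend their germs at \<^term>\<open>p\<close> to global vector fields; the value at \<^term>\<open>p\<close>
  does not depend on the extensions.\<close>

definition local_conn ::
    "('a, 'e::euclidean_space) chart set \<Rightarrow>
      (('a \<Rightarrow> ('a, 'e) tvec) \<Rightarrow> ('a \<Rightarrow> ('a, 'e) tvec) \<Rightarrow> ('a \<Rightarrow> ('a, 'e) tvec)) \<Rightarrow>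
      ('a \<Rightarrow> ('a, 'e) tvec) \<Rightarrow> ('a \<Rightarrow> ('a, 'e) tvec) \<Rightarrow> 'a \<Rightarrow> ('a, 'e) tvec"
  where "local_conn A D X Y p = (THE w. \<exists>X'\<in>vector_fields A. \<exists>Y'\<in>vector_fields A. \<exists>U.
    openin (atlas_topology A) U \<and> p \<in> U \<and> (\<forall>q\<in>U. X' q = X q \<and> Y' q = Y q) \<and> w = D X' Y' p)"

section \<open>The tangent bundle and nonlinear connections\<close>

text \<open>Points of the tangent bundle are pairs of a base point and a tangent vector there; the bundle
  projection is \<^term>\<open>fst\<close>.  The induced chart has coordinates \<open>(x, y)\<close>.\<close>

type_synonym ('a, 'e) tpoint = "'a \<times> ('a, 'e) tvec"

definition induced_chart ::
    "('a, 'e::euclidean_space) chart set \<Rightarrow> ('a, 'e) chart \<Rightarrow> (('a, 'e) tpoint, 'e \<times> 'e) chart"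
  where "induced_chart A c = (SIGMA p : cdom c. tangent_space A p, \<lambda>(p, v). (cmap c p, v c))"

definition TM :: "('a, 'e::euclidean_space) chart set \<Rightarrow> (('a, 'e) tpoint, 'e \<times> 'e) chart set"
  where "TM A = induced_chart A ` A"

definition vertical ::
    "('a, 'e::euclidean_space) chart set \<Rightarrow> ('a, 'e) tpoint \<Rightarrow> (('a, 'e) tpoint, 'e \<times> 'e) tvec set"
  where "vertical A z = {w \<in> tangent_space (TM A) z. tangent_map (TM A) A fst z w = 0}"

definition nonlinear_connection ::
    "('a, 'e::euclidean_space) chart set \<Rightarrow>
      (('a, 'e) tpoint \<Rightarrow> (('a, 'e) tpoint, 'e \<times> 'e) tvec set) \<Rightarrow> bool"
  where "nonlinear_connection A H \<longleftrightarrow>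
    (\<exists>k. smooth_distribution (TM A) k H) \<and>
    (\<forall>z\<in>points (TM A). H z \<inter> vertical A z = {0} \<and>
        {h + v |h v. h \<in> H z \<and> v \<in> vertical A z} = tangent_space (TM A) z)"

type_synonym ('a, 'n) tm_field =
  "('a, real^'n) tpoint \<Rightarrow> (('a, real^'n) tpoint, (real^'n) \<times> (real^'n)) tvec"

type_synonym ('a, 'n) tm_distribution =
  "('a, real^'n) tpoint \<Rightarrow> (('a, real^'n) tpoint, (real^'n) \<times> (real^'n)) tvec set"

type_synonym ('a, 'n) tm_operator =
  "('a, 'n) tm_field \<Rightarrow> ('a, 'n) tm_field \<Rightarrow> ('a, 'n) tm_field"

text \<open>The coordinate fields \<open>\<partial>/\<partial>x\<^sup>i\<close>, \<open>\<partial>/\<partial>y\<^sup>i\<close> of an induced chart, the coefficients \<open>N\<^sub>i\<^sup>j\<close> (first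
  index the lower one) and the adapted fields \<open>\<delta>/\<delta>x\<^sup>i\<close>.\<close>

definition dx :: "('a, real^'n) chart set \<Rightarrow> ('a, real^'n) chart \<Rightarrow> 'n \<Rightarrow> ('a, 'n) tm_field"
  where "dx A c i z = coord_vec (TM A) (induced_chart A c) z (axis i 1, 0)"

definition dy :: "('a, real^'n) chart set \<Rightarrow> ('a, real^'n) chart \<Rightarrow> 'n \<Rightarrow> ('a, 'n) tm_field"
  where "dy A c i z = coord_vec (TM A) (induced_chart A c) z (0, axis i 1)"

definition nlc_coeff :: "('a, real^'n) chart set \<Rightarrow> ('a, 'n) tm_distribution \<Rightarrow>
    ('a, real^'n) chart \<Rightarrow> ('a, real^'n) tpoint \<Rightarrow> real^'n^'n"
  where "nlc_coeff A H c z =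
    (THE N. \<forall>i. dx A c i z - (\<Sum>j\<in>UNIV. N $ i $ j *\<^sub>R dy A c j z) \<in> H z)"

definition delta :: "('a, real^'n) chart set \<Rightarrow> ('a, 'n) tm_distribution \<Rightarrow>
    ('a, real^'n) chart \<Rightarrow> 'n \<Rightarrow> ('a, 'n) tm_field"
  where "delta A H c i z =
    dx A c i z - (\<Sum>j\<in>UNIV. nlc_coeff A H c z $ i $ j *\<^sub>R dy A c j z)"

section \<open>d-tensor fields and generalized Lagrange-Weyl structures\<close>

text \<open>A d-tensor field of type \<open>(0,2)\<close> is given by its component matrices, one function
  \<^term>\<open>g c\<close> on the domain of the induced chart for every chart \<^term>\<open>c\<close>, extended by 0.\<close>

type_synonym ('a, 'n) dtensor = "('a, real^'n) chart \<Rightarrow> ('a, real^'n) tpoint \<Rightarrow> real^'n^'n"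

definition d_tensor :: "('a, real^'n) chart set \<Rightarrow> ('a, 'n) dtensor \<Rightarrow> bool"
  where "d_tensor A g \<longleftrightarrow>
    (\<forall>c z. c \<notin> A \<or> z \<notin> cdom (induced_chart A c) \<longrightarrow> g c z = 0) \<and>
    (\<forall>c\<in>A. smooth_on (cmap (induced_chart A c) ` cdom (induced_chart A c))
              (g c \<circ> cinv (induced_chart A c))) \<and>
    (\<forall>c\<in>A. \<forall>d\<in>A. \<forall>z \<in> cdom (induced_chart A c) \<inter> cdom (induced_chart A d). \<forall>i j.
        g c z $ i $ j =
          (let J = jacobian (transition c d) (at (cmap c (fst z)))
           in \<Sum>a\<in>UNIV. \<Sum>b\<in>UNIV. g d z $ a $ b * J $ a $ i * J $ b $ j))"

text \<open>The signature of the quadratic form of a symmetric matrix: maximal dimensions of positive and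
  of negative definite subspaces.\<close>

definition signature :: "real^'n^'n \<Rightarrow> nat \<times> nat"
  where "signature m =
    (Max (dim ` {S. subspace S \<and> (\<forall>\<xi>\<in>S. \<xi> \<noteq> 0 \<longrightarrow> \<xi> \<bullet> (m *v \<xi>) > 0)}),
     Max (dim ` {S. subspace S \<and> (\<forall>\<xi>\<in>S. \<xi> \<noteq> 0 \<longrightarrow> \<xi> \<bullet> (m *v \<xi>) < 0)}))"

definition GL_metrics :: "('a, real^'n) chart set \<Rightarrow> ('a, 'n) dtensor set"
  where "GL_metrics A = {g. d_tensor A g \<and>
    (\<forall>c\<in>A. \<forall>z\<in>cdom (induced_chart A c). transpose (g c z) = g c z \<and> det (g c z) \<noteq> 0) \<and>
    (\<exists>\<sigma>. \<forall>c\<in>A. \<forall>z\<in>cdom (induced_chart A c). signature (g c z) = \<sigma>)}"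

text \<open>\<open>g' = e\<^sup>2\<^sup>f g\<close>.\<close>

definition conformal_by ::
    "('a, real^'n) chart set \<Rightarrow> ('a \<Rightarrow> real) \<Rightarrow> ('a, 'n) dtensor \<Rightarrow> ('a, 'n) dtensor \<Rightarrow> bool"
  where "conformal_by A f g g' \<longleftrightarrow>
    (\<forall>c\<in>A. \<forall>z\<in>cdom (induced_chart A c). g' c z = exp (2 * f (fst z)) *\<^sub>R g c z)"

definition conformal_rel :: "('a, real^'n) chart set \<Rightarrow> ('a, 'n) dtensor rel"
  where "conformal_rel A = {(g, g'). g \<in> GL_metrics A \<and> g' \<in> GL_metrics A \<and>
    (\<exists>f\<in>smooth_funs A. conformal_by A f g g')}"

definition conformal_structure :: "('a, real^'n) chart set \<Rightarrow> ('a, 'n) dtensor set \<Rightarrow> bool"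
  where "conformal_structure A \<G> \<longleftrightarrow> \<G> \<in> GL_metrics A // conformal_rel A"

definition GLW_manifold :: "('a, real^'n) chart set \<Rightarrow> ('a, 'n) dtensor set \<Rightarrow>
    (('a, 'n) dtensor \<Rightarrow> 'a \<Rightarrow> ('a, real^'n) tvec \<Rightarrow> real) \<Rightarrow> bool"
  where "GLW_manifold A \<G> W \<longleftrightarrow>
    smooth_manifold A \<and> conformal_structure A \<G> \<and> W \<in> \<G> \<rightarrow> one_forms A \<and>
    (\<forall>g\<in>\<G>. \<forall>g'\<in>\<G>. \<forall>f\<in>smooth_funs A. conformal_by A f g g' \<longrightarrow>
      (\<forall>p\<in>points A. \<forall>v\<in>tangent_space A p. W g' p v = W g p v + 2 * dderiv A f p v))"

section \<open>d-connections\<close>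

text \<open>\<^term>\<open>F\<close> and \<^term>\<open>C\<close> are the values at the point \<^term>\<open>z\<close> of the coefficients in the chart
  induced by \<^term>\<open>c\<close>; \<^term>\<open>F i j k\<close> stands for \<open>F\<^sup>i\<^sub>j\<^sub>k\<close>.\<close>

definition d_coeffs :: "('a, real^'n) chart set \<Rightarrow> ('a, 'n) tm_distribution \<Rightarrow>
    ('a, 'n) tm_operator \<Rightarrow>
    ('a, real^'n) chart \<Rightarrow> ('a, real^'n) tpoint \<Rightarrow>
    ('n \<Rightarrow> 'n \<Rightarrow> 'n \<Rightarrow> real) \<Rightarrow> ('n \<Rightarrow> 'n \<Rightarrow> 'n \<Rightarrow> real) \<Rightarrow> bool"
  where "d_coeffs A H D c z F C \<longleftrightarrow> (\<forall>j k.
    local_conn (TM A) D (delta A H c j) (delta A H c k) z =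
      (\<Sum>i\<in>UNIV. F i j k *\<^sub>R delta A H c i z) \<and>
    local_conn (TM A) D (delta A H c j) (dy A c k) z =
      (\<Sum>i\<in>UNIV. F i j k *\<^sub>R dy A c i z) \<and>
    local_conn (TM A) D (dy A c j) (delta A H c k) z =
      (\<Sum>i\<in>UNIV. C i j k *\<^sub>R delta A H c i z) \<and>
    local_conn (TM A) D (dy A c j) (dy A c k) z =
      (\<Sum>i\<in>UNIV. C i j k *\<^sub>R dy A c i z))"

definition d_connection :: "('a, real^'n) chart set \<Rightarrow> ('a, 'n) tm_distribution \<Rightarrow>
    ('a, 'n) tm_operator \<Rightarrow> bool"
  where "d_connection A H D \<longleftrightarrow>
    linear_connection (TM A) D \<and>
    (\<forall>c\<in>A. \<exists>F C. \<forall>z\<in>cdom (induced_chart A c). d_coeffs A H D c z (F z) (C z))"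

text \<open>The coefficients of a d-connection are unique because the adapted fields form a frame.\<close>

definition F_coeff :: "('a, real^'n) chart set \<Rightarrow> ('a, 'n) tm_distribution \<Rightarrow>
    ('a, 'n) tm_operator \<Rightarrow>
    ('a, real^'n) chart \<Rightarrow> ('a, real^'n) tpoint \<Rightarrow> 'n \<Rightarrow> 'n \<Rightarrow> 'n \<Rightarrow> real"
  where "F_coeff A H D c z = (THE F. \<exists>C. d_coeffs A H D c z F C)"

definition C_coeff :: "('a, real^'n) chart set \<Rightarrow> ('a, 'n) tm_distribution \<Rightarrow>
    ('a, 'n) tm_operator \<Rightarrow>
    ('a, real^'n) chart \<Rightarrow> ('a, real^'n) tpoint \<Rightarrow> 'n \<Rightarrow> 'n \<Rightarrow> 'n \<Rightarrow> real"
  where "C_coeff A H D c z = (THE C. \<exists>F. d_coeffs A H D c z F C)"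

definition horizontal :: "('a, real^'n) chart set \<Rightarrow> ('a, 'n) tm_distribution \<Rightarrow>
    ('a, 'n) tm_operator \<Rightarrow> bool"
  where "horizontal A H D \<longleftrightarrow>
    (\<forall>c\<in>A. \<forall>z\<in>cdom (induced_chart A c). \<forall>i j k. C_coeff A H D c z i j k = 0)"

definition h_symmetric :: "('a, real^'n) chart set \<Rightarrow> ('a, 'n) tm_distribution \<Rightarrow>
    ('a, 'n) tm_operator \<Rightarrow> bool"
  where "h_symmetric A H D \<longleftrightarrow>
    (\<forall>c\<in>A. \<forall>z\<in>cdom (induced_chart A c). \<forall>i j k.
        F_coeff A H D c z i j k = F_coeff A H D c z i k j)"

text \<open>\<^term>\<open>h_cov A H D g c z i j k\<close> is \<open>g\<^sub>j\<^sub>k\<^sub>|\<^sub>i\<close>.\<close>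

definition h_cov :: "('a, real^'n) chart set \<Rightarrow> ('a, 'n) tm_distribution \<Rightarrow>
    ('a, 'n) tm_operator \<Rightarrow> ('a, 'n) dtensor \<Rightarrow>
    ('a, real^'n) chart \<Rightarrow> ('a, real^'n) tpoint \<Rightarrow> 'n \<Rightarrow> 'n \<Rightarrow> 'n \<Rightarrow> real"
  where "h_cov A H D g c z i j k =
    dderiv (TM A) (\<lambda>z'. g c z' $ j $ k) z (delta A H c i z)
    - (\<Sum>a\<in>UNIV. g c z $ a $ k * F_coeff A H D c z a i j)
    - (\<Sum>a\<in>UNIV. g c z $ j $ a * F_coeff A H D c z a i k)"

text \<open>The components of \<open>\<nabla>\<^sub>X\<^sub>h g\<close>, where \<open>Xh\<close> is the horizontal lift of \<^term>\<open>X\<close>.\<close>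

definition nabla_hlift :: "('a, real^'n) chart set \<Rightarrow> ('a, 'n) tm_distribution \<Rightarrow>
    ('a, 'n) tm_operator \<Rightarrow>
    ('a \<Rightarrow> ('a, real^'n) tvec) \<Rightarrow> ('a, 'n) dtensor \<Rightarrow> ('a, 'n) dtensor"
  where "nabla_hlift A H D X g c z =
    (\<chi> j k. \<Sum>i\<in>UNIV. X (fst z) c $ i * h_cov A H D g c z i j k)"

definition compatible :: "('a, real^'n) chart set \<Rightarrow> ('a, 'n) tm_distribution \<Rightarrow>
    ('a, 'n) dtensor set \<Rightarrow> (('a, 'n) dtensor \<Rightarrow> 'a \<Rightarrow> ('a, real^'n) tvec \<Rightarrow> real) \<Rightarrow>
    ('a, 'n) tm_operator \<Rightarrow> bool"
  where "compatible A H \<G> W D \<longleftrightarrow>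
    (\<exists>g\<in>\<G>. \<forall>X\<in>vector_fields A. \<forall>c\<in>A. \<forall>z\<in>cdom (induced_chart A c).
        nabla_hlift A H D X g c z = W g (fst z) (X (fst z)) *\<^sub>R g c z)"

end

theory Submission
  imports Defs
begin

text \<open>The proof is the argument that produces the Levi-Civita connection, carried out in adapted frames.

With respect to an adapted frame a horizontal d-connection is nothing but its coefficients \<open>F\<close>. The
connection is h-symmetric if \<open>F\<close> is symmetric in its lower indices, and it is compatible if
\<open>g(F(u,v),w) + g(v,F(u,w)) = t(u,v,w)\<close> where \<open>t(u,\<cdot>,\<cdot>)\<close> is the derivative of \<open>g\<close> along the horizontal
lift of \<open>u\<close> minus \<open>\<omega>(u) g\<close>, with \<open>\<omega> = W(g)\<close>. Adding and subtracting the cyclic permutations of this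
equation determines \<open>F\<close>, because \<open>g\<close> is nondegenerate; conversely the solution of the resulting linear
system satisfies both conditions (\<open>christoffel_unique\<close>, \<open>christoffel_compatible\<close>). Replacing \<open>g\<close> by
\<open>e\<^sup>2\<^sup>f g\<close> and \<open>W(g)\<close> by \<open>W(g) + 2 df\<close> multiplies both \<open>g\<close> and \<open>t\<close> by \<open>e\<^sup>2\<^sup>f\<close>, so that \<open>F\<close> only depends
on the Weyl structure (\<open>F_conformal\<close>). This settles everything at the level of coefficients.

For existence, the coefficients found in the various charts have to fit together. The equations are
not invariant under a change of charts: the derivative of \<open>g\<close> produces second derivatives of the
coordinate change. Uniqueness turns this into an advantage. Solving the equations in one chart and
transporting the solution to another one, corrected by the second derivative, gives a solution there;
hence \<open>F\<close> transforms like the coefficients of a linear connection (\<open>F_change\<close>, where the symmetry of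
second derivatives is essential). Now \<open>H\<close> and the vertical bundle are both isomorphic to the pullback
of the tangent bundle of \<open>M\<close>, and by its transformation law \<open>F\<close> defines a covariant derivative of
sections of that bundle (\<open>nab_change\<close>). The connection on \<open>TM\<close> differentiates the horizontal and the
vertical part of a vector field separately in this way.

For uniqueness, a linear connection is a local operator, and by the Leibniz rule it is determined by its
values on a local frame (\<open>connection_determined_by_frame\<close>); on the adapted frame these values are the
coefficients. Both this and the meaning of \<open>local_conn\<close> rest on cutoff functions, which exist since
the manifolds are Hausdorff spaces. Finally, smoothness of the connection coefficients of \<open>H\<close> and of
\<open>F\<close> follows from Cramer's rule, as both are solutions of regular linear systems with smooth data.\<close>

section \<open>Calculus of smooth functions on open sets\<close>

abbreviation fd :: "('e::real_normed_vector \<Rightarrow> 'b::real_normed_vector) \<Rightarrow> 'e \<Rightarrow> 'e \<Rightarrow> 'b"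
  where "fd f x \<equiv> frechet_derivative f (at x)"

lemma fd_eqI: "(f has_derivative f') (at x) \<Longrightarrow> fd f x = f'"
  by (metis frechet_derivative_at)

lemma fd_cong_open:
  assumes "open S" "x \<in> S" "\<And>y. y \<in> S \<Longrightarrow> f y = g y"
  shows "fd f x = fd g x"
proof -
  have "\<And>h. (f has_derivative h) (at x) = (g has_derivative h) (at x)"
    using assms has_derivative_transform_within_open[of f _ x UNIV S g]
      has_derivative_transform_within_open[of g _ x UNIV S f] by auto
  then show ?thesis by (simp add: frechet_derivative_def)
qed

lemma has_derivative_cong_open:
  assumes "open S" "x \<in> S" "\<And>y. y \<in> S \<Longrightarrow> f y = g y"
  shows "(f has_derivative f') (at x) \<longleftrightarrow> (g has_derivative f') (at x)"
  using assms has_derivative_transform_within_open[of f _ x UNIV S g]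
      has_derivative_transform_within_open[of g _ x UNIV S f] by auto

lemma differentiable_cong_open:
  assumes "open S" "x \<in> S" "\<And>y. y \<in> S \<Longrightarrow> f y = g y"
  shows "f differentiable (at x) \<longleftrightarrow> g differentiable (at x)"
  unfolding differentiable_def using has_derivative_cong_open[of S x f g] assms by blast

lemma fd_works: "f differentiable (at x) \<Longrightarrow> (f has_derivative fd f x) (at x)"
  by (simp add: frechet_derivative_works)

declare Ck_on.simps(2) [simp del]

lemma Ck_on_fd: "Ck_on (Suc k) S f \<Longrightarrow> Ck_on k S (\<lambda>x. fd f x v)"
  by (simp add: Ck_on.simps(2))

lemma Ck_on_differentiable:
  assumes "Ck_on (Suc k) S f" "open S" "x \<in> S"
  shows "f differentiable (at x)"
proof -
  have "f differentiable_on S" using assms(1) by (simp only: Ck_on.simps)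
  then show ?thesis using assms(2,3) differentiable_on_eq_differentiable_at by blast
qed

lemma Ck_on_Suc_iff:
  assumes "open S"
  shows "Ck_on (Suc k) S f \<longleftrightarrow> (\<forall>x\<in>S. f differentiable (at x)) \<and> (\<forall>v. Ck_on k S (\<lambda>x. fd f x v))"
  using assms by (simp add: Ck_on.simps(2) differentiable_on_eq_differentiable_at)

lemma Ck_on_cong:
  assumes "open S" "\<And>x. x \<in> S \<Longrightarrow> f x = g x" "Ck_on k S f"
  shows "Ck_on k S g"
  using assms(2,3)
proof (induction k arbitrary: f g)
  case 0 then show ?case by (simp cong: continuous_on_cong)
next
  case (Suc k)
  have eq: "fd f x = fd g x" if "x \<in> S" for x
    using fd_cong_open[OF assms(1) that Suc.prems(1)] .
  show ?case
    unfolding Ck_on_Suc_iff[OF assms(1)]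
  proof (intro conjI allI ballI)
    fix x assume x: "x \<in> S"
    show "g differentiable (at x)"
      using Ck_on_differentiable[OF Suc.prems(2) assms(1) x] differentiable_cong_open[OF assms(1) x, of f g] Suc.prems(1)
      by blast
  next
    fix v
    show "Ck_on k S (\<lambda>x. fd g x v)"
      by (rule Suc.IH[of "\<lambda>x. fd f x v"]) (use Ck_on_fd[OF Suc.prems(2)] eq in auto)
  qed
qed

lemma Ck_on_SucI:
  assumes "open S" "\<And>x. x \<in> S \<Longrightarrow> (f has_derivative f' x) (at x)" "\<And>v. Ck_on k S (\<lambda>x. f' x v)"
  shows "Ck_on (Suc k) S f"
  unfolding Ck_on_Suc_iff[OF assms(1)]
proof (intro conjI allI ballI)
  show "Ck_on k S (\<lambda>x. fd f x v)" for v
    by (rule Ck_on_cong[OF assms(1) _ assms(3)[of v]]) (simp add: fd_eqI[OF assms(2)])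
qed (use assms(2) differentiable_def in blast)

lemma Ck_on_Suc_imp: "open S \<Longrightarrow> Ck_on (Suc k) S f \<Longrightarrow> Ck_on k S f"
proof (induction k arbitrary: f)
  case 0 then show ?case
    by (auto simp: Ck_on.simps(2) intro: differentiable_imp_continuous_on)
next
  case (Suc k)
  then show ?case by (auto simp: Ck_on.simps(2)[of "Suc k" S f] Ck_on.simps(2)[of k S f])
qed

lemma Ck_on_subset: "Ck_on k S f \<Longrightarrow> T \<subseteq> S \<Longrightarrow> Ck_on k T f"
  by (induction k arbitrary: f) (auto simp: Ck_on.simps(2) intro: continuous_on_subset differentiable_on_subset)

lemma Ck_on_local:
  assumes "open S" "\<And>x. x \<in> S \<Longrightarrow> \<exists>T. open T \<and> x \<in> T \<and> Ck_on k T f"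
  shows "Ck_on k S f"
  using assms(2)
proof (induction k arbitrary: f)
  case 0
  have "isCont f x" if "x \<in> S" for x
    using 0[OF that] by (auto simp: continuous_on_eq_continuous_at)
  then show ?case by (simp add: continuous_at_imp_continuous_on)
next
  case (Suc k)
  show ?case
    unfolding Ck_on_Suc_iff[OF assms(1)]
  proof (intro conjI allI ballI)
    fix x assume "x \<in> S"
    then show "f differentiable (at x)" using Suc.prems Ck_on_differentiable by blast
  next
    fix v show "Ck_on k S (\<lambda>x. fd f x v)"
    proof (rule Suc.IH)
      fix x assume "x \<in> S"
      then obtain T where "open T" "x \<in> T" "Ck_on (Suc k) T f" using Suc.prems by blast
      then show "\<exists>T. open T \<and> x \<in> T \<and> Ck_on k T (\<lambda>x. fd f x v)"
        by (intro exI[of _ T]) (simp add: Ck_on_fd)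
    qed
  qed
qed

lemma Ck_on_const: "Ck_on k S (\<lambda>x. c)"
  by (induction k arbitrary: c) (auto simp: Ck_on.simps(2))

lemma Ck_on_add:
  assumes "open S"
  shows "Ck_on k S f \<Longrightarrow> Ck_on k S g \<Longrightarrow> Ck_on k S (\<lambda>x. f x + g x)"
proof (induction k arbitrary: f g)
  case 0 then show ?case by (auto intro: continuous_intros)
next
  case (Suc k)
  have "Ck_on k S (\<lambda>x. fd f x v + fd g x v)" for v
    using Suc by (simp add: Ck_on_fd)
  moreover have "((\<lambda>x. f x + g x) has_derivative (\<lambda>v. fd f x v + fd g x v)) (at x)" if "x \<in> S" for x
    using Ck_on_differentiable[OF _ assms that] Suc.prems by (blast intro: has_derivative_add fd_works)
  ultimately show ?case by (intro Ck_on_SucI[OF assms])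
qed

lemma Ck_on_bounded_linear:
  assumes "open S" "bounded_linear L"
  shows "Ck_on k S f \<Longrightarrow> Ck_on k S (\<lambda>x. L (f x))"
proof (induction k arbitrary: f)
  case 0 then show ?case using bounded_linear.continuous_on[OF assms(2)] by auto
next
  case (Suc k)
  have "Ck_on k S (\<lambda>x. L (fd f x v))" for v
    using Suc by (simp add: Ck_on_fd)
  moreover have "((\<lambda>x. L (f x)) has_derivative (\<lambda>v. L (fd f x v))) (at x)" if "x \<in> S" for x
    using Ck_on_differentiable[OF _ assms(1) that] Suc.prems by (blast intro: bounded_linear.has_derivative[OF assms(2)] fd_works)
  ultimately show ?case by (intro Ck_on_SucI[OF assms(1)])
qed

lemma Ck_on_bilinear:
  assumes "open S" "bounded_bilinear P"
  shows "Ck_on k S f \<Longrightarrow> Ck_on k S g \<Longrightarrow> Ck_on k S (\<lambda>x. P (f x) (g x))"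
proof (induction k arbitrary: f g)
  case 0 then show ?case using bounded_bilinear.continuous_on[OF assms(2)] by auto
next
  case (Suc k)
  have "Ck_on k S (\<lambda>x. P (f x) (fd g x v) + P (fd f x v) (g x))" for v
    by (rule Ck_on_add[OF assms(1) Suc.IH[OF Ck_on_Suc_imp[OF assms(1)] Ck_on_fd] Suc.IH[OF Ck_on_fd Ck_on_Suc_imp[OF assms(1)]]])
      (rule Suc.prems)+
  moreover have "((\<lambda>x. P (f x) (g x)) has_derivative (\<lambda>v. P (f x) (fd g x v) + P (fd f x v) (g x))) (at x)"
    if "x \<in> S" for x
    by (rule bounded_bilinear.FDERIV[OF assms(2) fd_works[OF Ck_on_differentiable[OF Suc.prems(1) assms(1) that]]
          fd_works[OF Ck_on_differentiable[OF Suc.prems(2) assms(1) that]]])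
  ultimately show ?case by (intro Ck_on_SucI[OF assms(1)])
qed

lemma Ck_on_sum:
  assumes "open S" "\<And>i. i \<in> I \<Longrightarrow> Ck_on k S (f i)"
  shows "Ck_on k S (\<lambda>x. \<Sum>i\<in>I. f i x)"
  using assms(2)
  by (induction I rule: infinite_finite_induct) (auto simp: Ck_on_const intro: Ck_on_add[OF assms(1)])

lemma Ck_on_id: "open S \<Longrightarrow> Ck_on k S (\<lambda>x. x)"
  by (cases k) (auto simp: Ck_on.simps(2) Ck_on_const intro: differentiable_on_ident)

lemma linear_basis_expansion:
  fixes f :: "'e::euclidean_space \<Rightarrow> 'b::real_normed_vector"
  assumes "linear f"
  shows "f y = (\<Sum>b\<in>Basis. (y \<bullet> b) *\<^sub>R f b)"
proof -
  have "f y = f (\<Sum>b\<in>Basis. (y \<bullet> b) *\<^sub>R b)" by (simp add: euclidean_representation)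
  then show ?thesis by (simp add: linear_sum[OF assms] linear_scale[OF assms])
qed

text \<open>The chain rule produces derivatives of \<open>g\<close> in directions that vary with the point, whereas \<open>Ck_on\<close>
  only speaks of constant directions. Expanding the direction in the standard basis removes the
  difference.\<close>

lemma Ck_on_compose:
  fixes f :: "'e::real_normed_vector \<Rightarrow> 'f::euclidean_space" and g :: "'f \<Rightarrow> 'b::real_normed_vector"
  assumes "open S" "open T" "f ` S \<subseteq> T"
  shows "Ck_on k T g \<Longrightarrow> Ck_on k S f \<Longrightarrow> Ck_on k S (\<lambda>x. g (f x))"
proof (induction k arbitrary: g)
  case 0 then show ?case using assms(3) by (auto intro: continuous_on_compose2)
next
  case (Suc k)
  have f: "f differentiable (at x)" if "x \<in> S" for x using Ck_on_differentiable Suc.prems(2) assms(1) that by blast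
  have g: "g differentiable (at (f x))" if "x \<in> S" for x
    using Ck_on_differentiable[OF Suc.prems(1) assms(2), of "f x"] assms(3) that by blast
  have "Ck_on k S (\<lambda>x. \<Sum>b\<in>Basis. (fd f x v \<bullet> b) *\<^sub>R fd g (f x) b)" for v
  proof (intro Ck_on_sum[OF assms(1)] Ck_on_bilinear[OF assms(1) bounded_bilinear_scaleR])
    fix b :: 'f
    show "Ck_on k S (\<lambda>x. fd f x v \<bullet> b)"
      using Suc.prems(2) by (intro Ck_on_bounded_linear[OF assms(1) bounded_linear_inner_left] Ck_on_fd)
    show "Ck_on k S (\<lambda>x. fd g (f x) b)"
      using Suc.prems Ck_on_Suc_imp[OF assms(1) Suc.prems(2)] by (intro Suc.IH Ck_on_fd)
  qed
  moreover have eq: "(\<Sum>b\<in>Basis. (fd f x v \<bullet> b) *\<^sub>R fd g (f x) b) = fd g (f x) (fd f x v)" if "x \<in> S" for x v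
    by (rule linear_basis_expansion[OF linear_frechet_derivative[OF g[OF that]], symmetric])
  moreover have "((\<lambda>x. g (f x)) has_derivative (\<lambda>v. fd g (f x) (fd f x v))) (at x)" if "x \<in> S" for x
    using diff_chain_at[OF fd_works[OF f[OF that]] fd_works[OF g[OF that]]] by (simp add: o_def)
  moreover have "Ck_on k S (\<lambda>x. fd g (f x) (fd f x v))" for v
    by (rule Ck_on_cong[OF assms(1) _ calculation(1)[of v]]) (rule eq)
  ultimately show ?case by (intro Ck_on_SucI[OF assms(1)])
qed

lemma Ck_on_inverse:
  fixes f :: "'e::real_normed_vector \<Rightarrow> real"
  assumes "open S" "\<And>x. x \<in> S \<Longrightarrow> f x \<noteq> 0"
  shows "Ck_on k S f \<Longrightarrow> Ck_on k S (\<lambda>x. inverse (f x))"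
proof (induction k)
  case 0 then show ?case using assms by (auto intro: continuous_intros)
next
  case (Suc k)
  then have IH: "Ck_on k S (\<lambda>x. inverse (f x))" using Ck_on_Suc_imp[OF assms(1)] by blast
  have "Ck_on k S (\<lambda>x. - (inverse (f x) * fd f x v * inverse (f x)))" for v
    using Suc IH by (intro Ck_on_bounded_linear[OF assms(1) bounded_linear_minus[OF bounded_linear_ident]]
        Ck_on_bilinear[OF assms(1) bounded_bilinear_mult] Ck_on_fd)
  moreover have "((\<lambda>x. inverse (f x)) has_derivative (\<lambda>v. - (inverse (f x) * fd f x v * inverse (f x)))) (at x)"
    if "x \<in> S" for x
    using Deriv.has_derivative_inverse[OF assms(2)[OF that] fd_works[OF Ck_on_differentiable[OF Suc.prems assms(1) that]]] by simp
  ultimately show ?case by (intro Ck_on_SucI[OF assms(1)])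
qed

lemma smooth_on_cong:
  assumes "open S" "\<And>x. x \<in> S \<Longrightarrow> f x = g x" "smooth_on S f"
  shows "smooth_on S g"
  using assms(3) Ck_on_cong[OF assms(1,2)] unfolding smooth_on_def by simp

lemma smooth_on_subset: "smooth_on S f \<Longrightarrow> T \<subseteq> S \<Longrightarrow> smooth_on T f"
  unfolding smooth_on_def using Ck_on_subset by metis

lemma smooth_on_local:
  assumes "\<And>x. x \<in> S \<Longrightarrow> \<exists>T. open T \<and> x \<in> T \<and> smooth_on T f" "open S"
  shows "smooth_on S f"
  unfolding smooth_on_def
proof
  fix k
  have "\<exists>T. open T \<and> x \<in> T \<and> Ck_on k T f" if "x \<in> S" for x
    using assms(1)[OF that] unfolding smooth_on_def by blast
  then show "Ck_on k S f" by (rule Ck_on_local[OF assms(2)])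
qed

lemma smooth_on_differentiable: "smooth_on S f \<Longrightarrow> open S \<Longrightarrow> x \<in> S \<Longrightarrow> f differentiable (at x)"
  unfolding smooth_on_def using Ck_on_differentiable[of 0 S f x] by simp

lemma smooth_on_continuous: "smooth_on S f \<Longrightarrow> continuous_on S f"
  unfolding smooth_on_def using Ck_on.simps(1)[of S f] by metis

lemma smooth_on_fd: "smooth_on S f \<Longrightarrow> smooth_on S (\<lambda>x. fd f x v)"
  unfolding smooth_on_def by (simp add: Ck_on_fd)

lemma smooth_on_const: "smooth_on S (\<lambda>x. c)"
  by (simp add: smooth_on_def Ck_on_const)

lemma smooth_on_id: "open S \<Longrightarrow> smooth_on S (\<lambda>x. x)"
  by (simp add: smooth_on_def Ck_on_id)

lemma smooth_on_add: "open S \<Longrightarrow> smooth_on S f \<Longrightarrow> smooth_on S g \<Longrightarrow> smooth_on S (\<lambda>x. f x + g x)"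
  by (simp add: smooth_on_def Ck_on_add)

lemma smooth_on_sum: "open S \<Longrightarrow> (\<And>i. i \<in> I \<Longrightarrow> smooth_on S (f i)) \<Longrightarrow> smooth_on S (\<lambda>x. \<Sum>i\<in>I. f i x)"
  by (simp add: smooth_on_def Ck_on_sum)

lemma smooth_on_bounded_linear:
  "bounded_linear L \<Longrightarrow> open S \<Longrightarrow> smooth_on S f \<Longrightarrow> smooth_on S (\<lambda>x. L (f x))"
  by (simp add: smooth_on_def Ck_on_bounded_linear)

lemma smooth_on_bilinear:
  "bounded_bilinear P \<Longrightarrow> open S \<Longrightarrow> smooth_on S f \<Longrightarrow> smooth_on S g \<Longrightarrow> smooth_on S (\<lambda>x. P (f x) (g x))"
  by (simp add: smooth_on_def Ck_on_bilinear)

lemmas smooth_on_scaleR = smooth_on_bilinear[OF bounded_bilinear_scaleR]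
lemmas smooth_on_mult = smooth_on_bilinear[OF bounded_bilinear_mult[where 'a=real]]
lemmas smooth_on_inner = smooth_on_bilinear[OF bounded_bilinear_inner]
lemmas smooth_on_inner_left = smooth_on_bounded_linear[OF bounded_linear_inner_left]
lemmas smooth_on_nth = smooth_on_bounded_linear[OF bounded_linear_vec_nth]
lemmas smooth_on_fst = smooth_on_bounded_linear[OF bounded_linear_fst]
lemmas smooth_on_snd = smooth_on_bounded_linear[OF bounded_linear_snd]
lemmas smooth_on_minus = smooth_on_bounded_linear[OF bounded_linear_minus[OF bounded_linear_ident]]

lemma smooth_on_diff: "open S \<Longrightarrow> smooth_on S f \<Longrightarrow> smooth_on S g \<Longrightarrow> smooth_on S (\<lambda>x. f x - g x)"
  using smooth_on_add[OF _ _ smooth_on_minus, of S f g] by simp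

lemma smooth_on_prod:
  fixes f :: "_ \<Rightarrow> _ \<Rightarrow> real"
  assumes "open S"
  shows "(\<And>i. i \<in> I \<Longrightarrow> smooth_on S (f i)) \<Longrightarrow> smooth_on S (\<lambda>x. \<Prod>i\<in>I. f i x)"
  by (induction I rule: infinite_finite_induct) (auto simp: smooth_on_const intro: smooth_on_mult[OF assms])

lemma smooth_on_compose:
  fixes f :: "'e::real_normed_vector \<Rightarrow> 'f::euclidean_space"
  assumes "smooth_on T g" "smooth_on S f" "open S" "open T" "f ` S \<subseteq> T"
  shows "smooth_on S (\<lambda>x. g (f x))"
  using assms(1,2) Ck_on_compose[OF assms(3-5), of _ g] unfolding smooth_on_def by simp

lemma smooth_on_inverse:
  fixes f :: "_ \<Rightarrow> real"
  shows "open S \<Longrightarrow> (\<And>x. x \<in> S \<Longrightarrow> f x \<noteq> 0) \<Longrightarrow> smooth_on S f \<Longrightarrow> smooth_on S (\<lambda>x. inverse (f x))"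
  unfolding smooth_on_def by (simp add: Ck_on_inverse)

lemma smooth_on_divide:
  fixes f :: "_ \<Rightarrow> real"
  shows "open S \<Longrightarrow> (\<And>x. x \<in> S \<Longrightarrow> g x \<noteq> 0) \<Longrightarrow> smooth_on S f \<Longrightarrow> smooth_on S g \<Longrightarrow> smooth_on S (\<lambda>x. f x / g x)"
  unfolding divide_inverse by (intro smooth_on_mult smooth_on_inverse)

lemma smooth_on_Pair:
  assumes "open S" "smooth_on S f" "smooth_on S g"
  shows "smooth_on S (\<lambda>x. (f x, g x))"
proof -
  have "smooth_on S (\<lambda>x. (f x, 0) + (0, g x))"
    using assms by (intro smooth_on_add smooth_on_bounded_linear[of "\<lambda>u. (u, 0)"]
        smooth_on_bounded_linear[of "\<lambda>u. (0, u)"])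
      (auto intro!: bounded_linear_Pair bounded_linear_ident bounded_linear_zero)
  then show ?thesis by simp
qed

lemma smooth_on_vec_lambda:
  fixes f :: "'e::real_normed_vector \<Rightarrow> 'n::finite \<Rightarrow> 'b::euclidean_space"
  assumes "open S" "\<And>i. smooth_on S (\<lambda>x. f x i)"
  shows "smooth_on S (\<lambda>x. \<chi> i. f x i)"
proof -
  have "smooth_on S (\<lambda>x. \<Sum>i\<in>UNIV. axis i (f x i))"
  proof (intro smooth_on_sum[OF assms(1)])
    fix i :: 'n
    have "bounded_linear (axis i :: 'b \<Rightarrow> 'b^'n)"
      unfolding linear_conv_bounded_linear[symmetric] by (auto simp: linear_iff axis_def vec_eq_iff)
    then show "smooth_on S (\<lambda>x. axis i (f x i))"
      by (rule smooth_on_bounded_linear[OF _ assms])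
  qed
  moreover have "(\<Sum>i\<in>UNIV. axis i (f x i)) = (\<chi> i. f x i)" for x
    by (simp add: vec_eq_iff axis_def)
  ultimately show ?thesis by simp
qed

lemma smooth_on_fd_field:
  fixes f :: "'e::euclidean_space \<Rightarrow> 'b::real_normed_vector"
  assumes "open S" "smooth_on S f" "smooth_on S v"
  shows "smooth_on S (\<lambda>x. fd f x (v x))"
proof -
  have "smooth_on S (\<lambda>x. \<Sum>b\<in>Basis. (v x \<bullet> b) *\<^sub>R fd f x b)"
    using assms by (intro smooth_on_sum smooth_on_scaleR smooth_on_fd smooth_on_inner_left)
  moreover have "(\<Sum>b\<in>Basis. (v x \<bullet> b) *\<^sub>R fd f x b) = fd f x (v x)" if "x \<in> S" for x
    by (rule linear_basis_expansion[OF linear_frechet_derivative[OF smooth_on_differentiable[OF assms(2,1) that]], symmetric])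
  ultimately show ?thesis by (rule smooth_on_cong[OF assms(1), rotated])
qed

lemma smooth_on_det:
  fixes m :: "'e::real_normed_vector \<Rightarrow> real^'n^'n"
  assumes "open S" "\<And>i j. smooth_on S (\<lambda>x. m x $ i $ j)"
  shows "smooth_on S (\<lambda>x. det (m x))"
  unfolding det_def using assms
  by (intro smooth_on_sum smooth_on_mult smooth_on_const smooth_on_prod)

text \<open>Cramer's rule expresses the solution by determinants, which are polynomials in the entries.\<close>

lemma smooth_on_solution:
  fixes m :: "'e::real_normed_vector \<Rightarrow> real^'n^'n"
  assumes "open S" "\<And>i j. smooth_on S (\<lambda>x. m x $ i $ j)" "\<And>i. smooth_on S (\<lambda>x. b x $ i)"
    and "\<And>x. x \<in> S \<Longrightarrow> det (m x) \<noteq> 0" "\<And>x. x \<in> S \<Longrightarrow> m x *v s x = b x"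
  shows "smooth_on S s"
proof -
  let ?c = "\<lambda>x. \<chi> k. det (\<chi> i j. if j = k then b x $ i else m x $ i $ j) / det (m x)"
  have "smooth_on S ?c"
  proof (intro smooth_on_vec_lambda smooth_on_divide smooth_on_det)
    show "smooth_on S (\<lambda>x. (\<chi> i j. if j = k then b x $ i else m x $ i $ j) $ i $ j)" for i j k
      using assms(2,3) by (cases "j = k") auto
  qed (use assms in auto)
  moreover have "?c x = s x" if "x \<in> S" for x
    using cramer[OF assms(4)[OF that], of "s x" "b x"] assms(5)[OF that] by simp
  ultimately show ?thesis by (rule smooth_on_cong[OF assms(1), rotated])
qed

lemma bounded_bilinear_matrix_vector_mult: "bounded_bilinear ((*v) :: real^'n^'n \<Rightarrow> real^'n \<Rightarrow> real^'n)"
  unfolding bilinear_conv_bounded_bilinear[symmetric] bilinear_def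
  by (auto intro!: linearI simp: matrix_vector_right_distrib matrix_vector_mult_add_rdistrib
      matrix_vector_mult_scaleR scaleR_matrix_vector_assoc)

lemmas smooth_on_matrix_vector_mult = smooth_on_bilinear[OF bounded_bilinear_matrix_vector_mult]

text \<open>Since \<open>fd f x y\<close> is linear in \<open>y\<close>, the standard basis reduces its joint dependence on \<open>x\<close> and \<open>y\<close>
  to that of finitely many functions of \<open>x\<close> alone.\<close>

lemma fd_joint_has_derivative:
  fixes f :: "'e::euclidean_space \<Rightarrow> 'b::real_normed_vector"
  assumes "open S" "smooth_on S f" "x \<in> S"
  shows "((\<lambda>z. fd f (fst z) (snd z)) has_derivative
    (\<lambda>h. fd (\<lambda>x. fd f x y) x (fst h) + fd f x (snd h))) (at (x, y))"
proof -
  have lin: "linear (fd f x)" if "x \<in> S" for x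
    using smooth_on_differentiable[OF assms(2,1) that] by (rule linear_frechet_derivative)
  have d: "((\<lambda>x. fd f x b) has_derivative fd (\<lambda>x. fd f x b) x) (at x)" for b
    by (rule fd_works[OF smooth_on_differentiable[OF smooth_on_fd[OF assms(2)] assms(1,3)]])
  have o: "open (S \<times> (UNIV :: 'e set))" by (rule open_Times[OF assms(1) open_UNIV])
  have "((\<lambda>x. \<Sum>b\<in>Basis. (y \<bullet> b) *\<^sub>R fd f x b) has_derivative
      (\<lambda>h. \<Sum>b\<in>Basis. (y \<bullet> b) *\<^sub>R fd (\<lambda>x. fd f x b) x h)) (at x)"
    by (intro has_derivative_sum has_derivative_scaleR_right d)
  then have "((\<lambda>x. fd f x y) has_derivative
      (\<lambda>h. \<Sum>b\<in>Basis. (y \<bullet> b) *\<^sub>R fd (\<lambda>x. fd f x b) x h)) (at x)"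
    by (rule has_derivative_transform_within_open[OF _ assms(1,3)]) (rule linear_basis_expansion[OF lin, symmetric])
  from fd_eqI[OF this]
  have 1: "fd (\<lambda>x. fd f x y) x = (\<lambda>h. \<Sum>b\<in>Basis. (y \<bullet> b) *\<^sub>R fd (\<lambda>x. fd f x b) x h)" .
  have inner: "((\<lambda>z. snd z \<bullet> b) has_derivative (\<lambda>h. snd h \<bullet> b)) (at (x, y))" for b :: 'e
    by (auto intro!: derivative_eq_intros)
  have comp: "((\<lambda>z. fd f (fst z) b) has_derivative (\<lambda>h. fd (\<lambda>x. fd f x b) x (fst h))) (at (x, y))" for b
    using diff_chain_at[OF has_derivative_fst[OF has_derivative_ident, of "at (x, y)"], of "\<lambda>x. fd f x b"] d[of b]
    by (simp add: o_def)
  have "((\<lambda>z. \<Sum>b\<in>Basis. (snd z \<bullet> b) *\<^sub>R fd f (fst z) b) has_derivative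
      (\<lambda>h. \<Sum>b\<in>Basis. (snd (x, y) \<bullet> b) *\<^sub>R fd (\<lambda>x. fd f x b) x (fst h) + (snd h \<bullet> b) *\<^sub>R fd f (fst (x, y)) b)) (at (x, y))"
    by (intro has_derivative_sum has_derivative_scaleR inner comp)
  then have "((\<lambda>z. fd f (fst z) (snd z)) has_derivative
      (\<lambda>h. \<Sum>b\<in>Basis. (snd (x, y) \<bullet> b) *\<^sub>R fd (\<lambda>x. fd f x b) x (fst h) + (snd h \<bullet> b) *\<^sub>R fd f (fst (x, y)) b)) (at (x, y))"
    by (rule has_derivative_transform_within_open[OF _ o])
      (use assms(3) in \<open>auto intro!: linear_basis_expansion[OF lin, symmetric]\<close>)
  moreover have "(\<Sum>b\<in>Basis. (snd (x, y) \<bullet> b) *\<^sub>R fd (\<lambda>x. fd f x b) x (fst h) + (snd h \<bullet> b) *\<^sub>R fd f (fst (x, y)) b)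
      = fd (\<lambda>x. fd f x y) x (fst h) + fd f x (snd h)" for h
    using linear_basis_expansion[OF lin[OF assms(3)], of "snd h"] by (simp add: 1 sum.distrib)
  ultimately show ?thesis by simp
qed

lemma smooth_on_fst_compose:
  fixes f :: "'e::euclidean_space \<Rightarrow> 'b::real_normed_vector"
  assumes "open S" "smooth_on S f"
  shows "smooth_on (S \<times> (UNIV :: 'c::euclidean_space set)) (\<lambda>z. f (fst z))"
  by (rule smooth_on_compose[OF assms(2)])
    (auto intro!: smooth_on_fst smooth_on_id open_Times assms(1))

lemma smooth_on_fd_joint:
  fixes f :: "'e::euclidean_space \<Rightarrow> 'b::real_normed_vector"
  assumes "open S" "smooth_on S f"
  shows "smooth_on (S \<times> UNIV) (\<lambda>z. fd f (fst z) (snd z))"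
proof -
  have o: "open (S \<times> (UNIV :: 'e set))" by (rule open_Times[OF assms(1) open_UNIV])
  have "smooth_on (S \<times> UNIV) (\<lambda>z. \<Sum>b\<in>Basis. (snd z \<bullet> b) *\<^sub>R fd f (fst z) b)"
    by (intro smooth_on_sum[OF o] smooth_on_scaleR[OF o] smooth_on_inner_left[OF o] smooth_on_snd[OF o] smooth_on_id[OF o]
        smooth_on_fst_compose[OF assms(1)] smooth_on_fd[OF assms(2)])
  then show ?thesis
  proof (rule smooth_on_cong[OF o, rotated])
    fix z assume "z \<in> S \<times> (UNIV :: 'e set)"
    then have "f differentiable (at (fst z))" using smooth_on_differentiable[OF assms(2,1)] by auto
    then show "(\<Sum>b\<in>Basis. (snd z \<bullet> b) *\<^sub>R fd f (fst z) b) = fd f (fst z) (snd z)"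
      by (intro linear_basis_expansion[symmetric] linear_frechet_derivative)
  qed
qed

lemma line_derivative:
  fixes g :: "'e::real_normed_vector \<Rightarrow> real"
  assumes "g differentiable (at (p + s *\<^sub>R u))"
  shows "((\<lambda>s. g (p + s *\<^sub>R u)) has_real_derivative fd g (p + s *\<^sub>R u) u) (at s)"
proof -
  have l: "linear (fd g (p + s *\<^sub>R u))" using assms by (rule linear_frechet_derivative)
  have "((\<lambda>s. p + s *\<^sub>R u) has_derivative (\<lambda>h. h *\<^sub>R u)) (at s)"
    by (auto intro!: derivative_eq_intros)
  from diff_chain_at[OF this fd_works[OF assms]]
  show ?thesis
    by (simp add: has_field_derivative_def o_def linear_scale[OF l] mult_commute_abs)
qed

text \<open>Two applications of the mean value theorem. The second difference on the left is symmetric in \<open>u\<close> and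
  \<open>v\<close>, which is the reason for the symmetry of second derivatives.\<close>

lemma mixed_difference_quotient:
  fixes g :: "'e::real_normed_vector \<Rightarrow> real"
  assumes "open S" "smooth_on S g" "t > 0"
    and S: "\<And>r s. 0 \<le> r \<Longrightarrow> r \<le> t \<Longrightarrow> 0 \<le> s \<Longrightarrow> s \<le> t \<Longrightarrow> x + r *\<^sub>R u + s *\<^sub>R v \<in> S"
  obtains r s where "0 \<le> r" "r \<le> t" "0 \<le> s" "s \<le> t"
    "g (x + t *\<^sub>R u + t *\<^sub>R v) - g (x + t *\<^sub>R u) - g (x + t *\<^sub>R v) + g x
      = t * t * fd (\<lambda>x. fd g x u) (x + r *\<^sub>R u + s *\<^sub>R v) v"
proof -
  have dg: "g differentiable (at y)" if "y \<in> S" for y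
    using smooth_on_differentiable assms that by blast
  have dg': "(\<lambda>x. fd g x u) differentiable (at y)" if "y \<in> S" for y
    using smooth_on_differentiable[OF smooth_on_fd[OF assms(2)] assms(1) that] .
  let ?h = "\<lambda>r. g (x + t *\<^sub>R v + r *\<^sub>R u) - g (x + r *\<^sub>R u)"
  have "(?h has_real_derivative fd g (x + t *\<^sub>R v + r *\<^sub>R u) u - fd g (x + r *\<^sub>R u) u) (at r)"
    if "0 \<le> r" "r \<le> t" for r
    using S[of r t] S[of r 0] that assms(3)
    by (intro DERIV_diff line_derivative dg) (simp_all add: algebra_simps)
  from MVT2[OF assms(3) this] obtain r where r: "0 < r" "r < t"
    and *: "?h t - ?h 0 = t * (fd g (x + t *\<^sub>R v + r *\<^sub>R u) u - fd g (x + r *\<^sub>R u) u)" by auto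
  let ?k = "\<lambda>s. fd g (x + r *\<^sub>R u + s *\<^sub>R v) u"
  have "(?k has_real_derivative fd (\<lambda>x. fd g x u) (x + r *\<^sub>R u + s *\<^sub>R v) v) (at s)"
    if "0 \<le> s" "s \<le> t" for s
    using S[of r s] that r
    by (intro line_derivative[of "\<lambda>x. fd g x u"] dg') simp_all
  from MVT2[OF assms(3) this] obtain s where s: "0 < s" "s < t"
    and **: "?k t - ?k 0 = t * fd (\<lambda>x. fd g x u) (x + r *\<^sub>R u + s *\<^sub>R v) v" by auto
  show ?thesis
    using * ** r s by (intro that[of r s]) (auto simp: algebra_simps)
qed

lemma symmetric_second_derivative_real:
  fixes g :: "'e::real_normed_vector \<Rightarrow> real"
  assumes "open S" "smooth_on S g" "x \<in> S"
  shows "fd (\<lambda>x. fd g x u) x v = fd (\<lambda>x. fd g x v) x u"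
proof (rule ccontr)
  let ?a = "\<lambda>x. fd (\<lambda>x. fd g x u) x v" and ?b = "\<lambda>x. fd (\<lambda>x. fd g x v) x u"
  assume "?a x \<noteq> ?b x"
  define e where "e = \<bar>?a x - ?b x\<bar> / 2"
  have "e > 0" using \<open>?a x \<noteq> ?b x\<close> by (simp add: e_def)
  have "isCont ?a x" "isCont ?b x"
    using continuous_on_eq_continuous_at[OF assms(1)] assms(2,3)
    by (blast intro: smooth_on_continuous[OF smooth_on_fd[OF smooth_on_fd]])+
  then obtain d1 d2 where d: "d1 > 0" "d2 > 0"
    "\<And>y. dist y x < d1 \<Longrightarrow> dist (?a y) (?a x) < e" "\<And>y. dist y x < d2 \<Longrightarrow> dist (?b y) (?b x) < e"
    using \<open>e > 0\<close> unfolding continuous_at_eps_delta dist_norm by metis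
  obtain d3 where d3: "d3 > 0" "ball x d3 \<subseteq> S" using assms openE by blast
  define \<delta> where "\<delta> = min d1 (min d2 d3)"
  \<comment> \<open>Small enough for the parallelogram spanned by \<open>t u\<close> and \<open>t v\<close> to stay within distance \<open>\<delta>\<close> of \<open>x\<close>.\<close>
  define t where "t = \<delta> / (2 * (norm u + norm v + 1))"
  have "\<delta> > 0" using d d3 by (simp add: \<delta>_def)
  have nn: "norm u + norm v + 1 > 0" by (smt (verit) norm_ge_zero)
  have "t > 0" using \<open>\<delta> > 0\<close> nn by (simp add: t_def)
  have near: "dist (x + r *\<^sub>R u + s *\<^sub>R v) x < \<delta>" if "0 \<le> r" "r \<le> t" "0 \<le> s" "s \<le> t" for r s
  proof -
    have "dist (x + r *\<^sub>R u + s *\<^sub>R v) x \<le> r * norm u + s * norm v"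
      using norm_triangle_ineq[of "r *\<^sub>R u" "s *\<^sub>R v"] that by (simp add: dist_norm add.assoc)
    also have "\<dots> \<le> t * norm u + t * norm v" using that by (intro add_mono mult_right_mono) auto
    also have "\<dots> < \<delta>"
    proof -
      have "t * (2 * (norm u + norm v + 1)) = \<delta>" using nn by (simp add: t_def)
      then show ?thesis using \<open>t > 0\<close> \<open>\<delta> > 0\<close> by (simp add: algebra_simps)
    qed
    finally show ?thesis .
  qed
  then have in_S: "x + r *\<^sub>R u + s *\<^sub>R v \<in> S" if "0 \<le> r" "r \<le> t" "0 \<le> s" "s \<le> t" for r s
    using that d3 by (auto simp: \<delta>_def dist_commute subset_iff)
  have in_S': "x + r *\<^sub>R v + s *\<^sub>R u \<in> S" if "0 \<le> r" "r \<le> t" "0 \<le> s" "s \<le> t" for r s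
    using in_S[of s r] that by (simp add: algebra_simps)
  obtain r s where 1: "0 \<le> r" "r \<le> t" "0 \<le> s" "s \<le> t"
    "g (x + t *\<^sub>R u + t *\<^sub>R v) - g (x + t *\<^sub>R u) - g (x + t *\<^sub>R v) + g x = t * t * ?a (x + r *\<^sub>R u + s *\<^sub>R v)"
    by (rule mixed_difference_quotient[OF assms(1,2) \<open>t > 0\<close> in_S])
  obtain r' s' where 2: "0 \<le> r'" "r' \<le> t" "0 \<le> s'" "s' \<le> t"
    "g (x + t *\<^sub>R v + t *\<^sub>R u) - g (x + t *\<^sub>R v) - g (x + t *\<^sub>R u) + g x = t * t * ?b (x + r' *\<^sub>R v + s' *\<^sub>R u)"
    by (rule mixed_difference_quotient[OF assms(1,2) \<open>t > 0\<close> in_S'])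
  have "t * t * ?a (x + r *\<^sub>R u + s *\<^sub>R v) = t * t * ?b (x + r' *\<^sub>R v + s' *\<^sub>R u)"
    using 1(5) 2(5) by (simp add: algebra_simps)
  then have "?a (x + r *\<^sub>R u + s *\<^sub>R v) = ?b (x + r' *\<^sub>R v + s' *\<^sub>R u)" using \<open>t > 0\<close> by simp
  moreover have "dist (?a (x + r *\<^sub>R u + s *\<^sub>R v)) (?a x) < e"
    using near[OF 1(1-4)] by (intro d) (simp add: \<delta>_def)
  moreover have "dist (?b (x + r' *\<^sub>R v + s' *\<^sub>R u)) (?b x) < e"
    using near[OF 2(3,4,1,2)] by (intro d) (simp add: \<delta>_def algebra_simps)
  moreover have "\<bar>a - b\<bar> < e + e" if "p = q" "dist p a < e" "dist q b < e" for p q a b :: real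
    using that unfolding dist_real_def by linarith
  ultimately have "\<bar>?a x - ?b x\<bar> < e + e" by metis
  then show False by (simp add: e_def)
qed

lemma fd_inner:
  assumes "f differentiable (at x)"
  shows "fd (\<lambda>x. f x \<bullet> b) x v = fd f x v \<bullet> b"
  using fd_eqI[OF bounded_linear.has_derivative[OF bounded_linear_inner_left fd_works[OF assms]]] by metis

lemma symmetric_second_derivative:
  fixes f :: "'e::real_normed_vector \<Rightarrow> 'b::euclidean_space"
  assumes "open S" "smooth_on S f" "x \<in> S"
  shows "fd (\<lambda>x. fd f x u) x v = fd (\<lambda>x. fd f x v) x u"
proof (rule euclidean_eqI)
  fix b :: 'b
  have df: "f differentiable (at y)" if "y \<in> S" for y
    using smooth_on_differentiable assms that by blast
  have "fd (\<lambda>x. fd f x u) x v \<bullet> b = fd (\<lambda>x. fd (\<lambda>x. f x \<bullet> b) x u) x v" for u v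
  proof -
    have *: "fd (\<lambda>x. fd (\<lambda>x. f x \<bullet> b) x u) x = fd (\<lambda>x. fd f x u \<bullet> b) x"
      by (rule fd_cong_open[OF assms(1,3)]) (rule fd_inner[OF df])
    show ?thesis unfolding *
      by (rule fd_inner[symmetric]) (rule smooth_on_differentiable[OF smooth_on_fd[OF assms(2)] assms(1,3)])
  qed
  then show "fd (\<lambda>x. fd f x u) x v \<bullet> b = fd (\<lambda>x. fd f x v) x u \<bullet> b"
    using symmetric_second_derivative_real[OF assms(1) smooth_on_inner_left[OF assms(1,2)] assms(3)] by simp
qed

section \<open>Bump functions on Euclidean spaces\<close>

text \<open>The functions \<open>t\<^sup>-\<^sup>n exp (-1/t)\<close>, continued by 0. The powers are there because the derivative of one
  member of the family is a combination of two others, so that smoothness of all of them follows by a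
  single induction.\<close>

definition flat :: "nat \<Rightarrow> real \<Rightarrow> real"
  where "flat n t = (if t > 0 then inverse t ^ n / exp (inverse t) else 0)"

lemma flat_tendsto_0: "(flat n \<longlongrightarrow> 0) (at 0)"
proof -
  have "((\<lambda>t. (inverse t) ^ n / exp (inverse t :: real)) \<longlongrightarrow> 0) (at_right 0)"
    using filterlim_compose[OF tendsto_power_div_exp_0 filterlim_inverse_at_top_right] .
  then have "(flat n \<longlongrightarrow> 0) (at_right 0)"
    by (rule Lim_transform_eventually) (auto simp: flat_def eventually_at_filter)
  moreover have "(flat n \<longlongrightarrow> 0) (at_left 0)"
    by (rule Lim_transform_eventually[OF tendsto_const]) (auto simp: flat_def eventually_at_filter)
  ultimately show ?thesis by (simp add: filterlim_split_at)
qed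

lemma flat_has_derivative:
  "(flat n has_real_derivative flat (n + 2) t - n * flat (n + 1) t) (at t)"
proof -
  consider "t > 0" | "t < 0" | "t = 0" by linarith
  then show ?thesis
  proof cases
    case 1
    have "((\<lambda>t. inverse t ^ n / exp (inverse t)) has_real_derivative flat (n + 2) t - n * flat (n + 1) t) (at t)"
    proof -
      have "((\<lambda>t. inverse t ^ n) has_real_derivative - (n * inverse t ^ (n + 1))) (at t)"
        using DERIV_power[OF DERIV_inverse[of t], of n] 1 by (cases n) (auto simp: algebra_simps)
      moreover have "((\<lambda>t. exp (inverse t)) has_real_derivative - (inverse t)\<^sup>2 * exp (inverse t)) (at t)"
        using 1 by (auto intro!: derivative_eq_intros simp: power2_eq_square)
      ultimately have "((\<lambda>t. inverse t ^ n / exp (inverse t)) has_real_derivative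
          (- (n * inverse t ^ (n + 1)) * exp (inverse t) - inverse t ^ n * (- (inverse t)\<^sup>2 * exp (inverse t)))
            / (exp (inverse t) * exp (inverse t))) (at t)"
        by (rule DERIV_divide) simp
      also have "(- (n * inverse t ^ (n + 1)) * exp (inverse t) - inverse t ^ n * (- (inverse t)\<^sup>2 * exp (inverse t)))
            / (exp (inverse t) * exp (inverse t)) = flat (n + 2) t - n * flat (n + 1) t"
        using 1 by (simp add: flat_def field_simps power2_eq_square)
      finally show ?thesis .
    qed
    then show ?thesis
      by (rule has_field_derivative_transform_within_open[of _ _ _ "{0<..}"]) (use 1 in \<open>auto simp: flat_def\<close>)
  next
    case 2
    have "((\<lambda>t. 0) has_real_derivative flat (n + 2) t - n * flat (n + 1) t) (at t)"
      using 2 by (auto simp: flat_def)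
    then show ?thesis
      by (rule has_field_derivative_transform_within_open[of _ _ _ "{..<0}"]) (use 2 in \<open>auto simp: flat_def\<close>)
  next
    case 3
    have "((\<lambda>h. (flat n (0 + h) - flat n 0) / h) \<longlongrightarrow> 0) (at 0)"
      by (rule Lim_transform_eventually[OF flat_tendsto_0[of "Suc n"]])
        (auto simp: flat_def eventually_at_filter divide_simps)
    then show ?thesis using 3 by (simp add: DERIV_def flat_def)
  qed
qed

lemma Ck_on_flat: "Ck_on k UNIV (flat n)"
proof (induction k arbitrary: n)
  case 0 then show ?case
    using flat_has_derivative by (auto intro!: continuous_at_imp_continuous_on DERIV_isCont)
next
  case (Suc k)
  have "Ck_on k UNIV (\<lambda>t. (flat (n + 2) t + (- real n) * flat (n + 1) t) * v)" for v
    by (intro Ck_on_bilinear[OF _ bounded_bilinear_mult] Ck_on_add Suc Ck_on_const) auto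
  moreover have "(flat n has_derivative (\<lambda>v. (flat (n + 2) t + (- real n) * flat (n + 1) t) * v)) (at t)" for t
    using flat_has_derivative[of n t] by (simp add: has_field_derivative_def)
  ultimately show ?case by (intro Ck_on_SucI) auto
qed

lemma smooth_on_flat: "smooth_on UNIV (flat n)"
  by (simp add: smooth_on_def Ck_on_flat)

lemma euclidean_bump:
  fixes a :: "'e::euclidean_space"
  assumes "r > 0"
  obtains \<beta> :: "'e \<Rightarrow> real" where "smooth_on UNIV \<beta>" "\<And>x. x \<in> ball a (r/2) \<Longrightarrow> \<beta> x = 1"
    "\<And>x. x \<notin> ball a r \<Longrightarrow> \<beta> x = 0"
proof -
  define q where "q x = (a - x) \<bullet> (a - x)" for x
  have q: "q x = (dist a x)\<^sup>2" for x
    by (simp add: q_def dist_norm power2_norm_eq_inner)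
  \<comment> \<open>The denominator is positive because \<open>q x\<close> cannot be both at least \<open>r\<^sup>2\<close> and at most \<open>(r/2)\<^sup>2\<close>.\<close>
  define \<beta> where "\<beta> x = flat 0 (r\<^sup>2 - q x) / (flat 0 (r\<^sup>2 - q x) + flat 0 (q x - (r/2)\<^sup>2))" for x
  have pos: "flat 0 t > 0" if "t > 0" for t using that by (simp add: flat_def)
  have nonneg: "flat 0 t \<ge> 0" for t by (simp add: flat_def)
  have "(r/2)\<^sup>2 < r\<^sup>2" using assms by (simp add: power2_eq_square)
  then have denom: "flat 0 (r\<^sup>2 - q x) + flat 0 (q x - (r/2)\<^sup>2) > 0" for x
    using pos[of "r\<^sup>2 - q x"] pos[of "q x - (r/2)\<^sup>2"] nonneg[of "r\<^sup>2 - q x"] nonneg[of "q x - (r/2)\<^sup>2"]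
    by (cases "q x < r\<^sup>2") linarith+
  have "smooth_on UNIV q" unfolding q_def
    by (intro smooth_on_inner smooth_on_diff smooth_on_id smooth_on_const) auto
  then have "smooth_on UNIV (\<lambda>x. flat 0 (r\<^sup>2 - q x))" "smooth_on UNIV (\<lambda>x. flat 0 (q x - (r/2)\<^sup>2))"
    by (intro smooth_on_compose[OF smooth_on_flat] smooth_on_diff smooth_on_const; simp)+
  then have "smooth_on UNIV \<beta>" unfolding \<beta>_def
    using denom by (intro smooth_on_divide smooth_on_add) (auto simp: less_imp_neq[symmetric] order_less_imp_not_eq2)
  moreover have "\<beta> x = 1" if "x \<in> ball a (r/2)" for x
  proof -
    have "q x < (r/2)\<^sup>2" using that assms unfolding q by (intro power_strict_mono) auto
    then have "flat 0 (q x - (r/2)\<^sup>2) = 0" by (simp add: flat_def)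
    then show ?thesis using denom[of x] by (simp add: \<beta>_def)
  qed
  moreover have "\<beta> x = 0" if "x \<notin> ball a r" for x
  proof -
    have "q x \<ge> r\<^sup>2" using that assms unfolding q by (intro power_mono) auto
    then show ?thesis by (simp add: \<beta>_def flat_def)
  qed
  ultimately show ?thesis using that by blast
qed

section \<open>Manifolds presented by an atlas\<close>

text \<open>Charts are pairs; splitting quantifiers over charts would replace them by their components.\<close>

declare split_paired_All [simp del] split_paired_Ex [simp del]

locale atlas =
  fixes A :: "('a, 'e::euclidean_space) chart set"
  assumes smooth_atlas: "smooth_atlas A"
begin

abbreviation is_open :: "'a set \<Rightarrow> bool" where "is_open \<equiv> openin (atlas_topology A)"

abbreviation J :: "('a, 'e) chart \<Rightarrow> ('a, 'e) chart \<Rightarrow> 'a \<Rightarrow> 'e \<Rightarrow> 'e"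
  where "J c d p \<equiv> fd (transition c d) (cmap c p)"

abbreviation T :: "'a \<Rightarrow> ('a, 'e) tvec set" where "T \<equiv> tangent_space A"

lemma inj_cmap: "c \<in> A \<Longrightarrow> inj_on (cmap c) (cdom c)"
  using smooth_atlas by (simp add: smooth_atlas_def)

lemma cinv_cmap [simp]: "c \<in> A \<Longrightarrow> p \<in> cdom c \<Longrightarrow> cinv c (cmap c p) = p"
  by (simp add: cinv_def inj_cmap)

lemma is_open_iff: "is_open W \<longleftrightarrow> W \<subseteq> points A \<and> (\<forall>c\<in>A. open (cmap c ` (W \<inter> cdom c)))"
  by (rule openin_atlas_topology[OF smooth_atlas])

lemma open_image: "c \<in> A \<Longrightarrow> is_open U \<Longrightarrow> open (cmap c ` (U \<inter> cdom c))"
  by (simp add: is_open_iff)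

lemma open_image': "c \<in> A \<Longrightarrow> is_open U \<Longrightarrow> U \<subseteq> cdom c \<Longrightarrow> open (cmap c ` U)"
  using open_image[of c U] by (simp add: Int_absorb2)

lemma open_overlap: "c \<in> A \<Longrightarrow> d \<in> A \<Longrightarrow> open (cmap c ` (cdom c \<inter> cdom d))"
  using smooth_atlas by (simp add: smooth_atlas_def)

lemma is_open_cdom: "c \<in> A \<Longrightarrow> is_open (cdom c)"
  unfolding is_open_iff using open_overlap by (auto simp: points_def Int_commute)

lemma open_chart: "c \<in> A \<Longrightarrow> open (cmap c ` cdom c)"
  using open_overlap[of c c] by simp

lemma is_open_points: "is_open (points A)"
  unfolding is_open_iff
proof (intro conjI ballI)
  fix c assume "c \<in> A"
  then have "points A \<inter> cdom c = cdom c" by (auto simp: points_def)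
  then show "open (cmap c ` (points A \<inter> cdom c))" using open_chart \<open>c \<in> A\<close> by simp
qed simp

lemma points_Int_cdom: "c \<in> A \<Longrightarrow> points A \<inter> cdom c = cdom c"
  by (auto simp: points_def)

lemma topspace_atlas: "topspace (atlas_topology A) = points A"
  using is_open_points by (metis is_open_iff openin_subset openin_topspace subset_antisym)

lemma transition_cmap [simp]: "c \<in> A \<Longrightarrow> p \<in> cdom c \<Longrightarrow> transition c d (cmap c p) = cmap d p"
  by (simp add: transition_def)

lemma smooth_transition: "c \<in> A \<Longrightarrow> d \<in> A \<Longrightarrow> smooth_on (cmap c ` (cdom c \<inter> cdom d)) (transition c d)"
  using smooth_atlas by (simp add: smooth_atlas_def)

lemma is_open_coord:
  assumes "c \<in> A" "open S"
  shows "is_open {p \<in> cdom c. cmap c p \<in> S}"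
  unfolding is_open_iff
proof (intro conjI ballI)
  show "{p \<in> cdom c. cmap c p \<in> S} \<subseteq> points A" using assms by (auto simp: points_def)
next
  fix d assume d: "d \<in> A"
  have "open (cmap d ` (cdom d \<inter> cdom c) \<inter> transition d c -` S)"
    by (intro continuous_open_preimage smooth_on_continuous smooth_transition open_overlap assms d)
  moreover have "cmap d ` ({p \<in> cdom c. cmap c p \<in> S} \<inter> cdom d)
      = cmap d ` (cdom d \<inter> cdom c) \<inter> transition d c -` S"
    using d by auto
  ultimately show "open (cmap d ` ({p \<in> cdom c. cmap c p \<in> S} \<inter> cdom d))" by simp
qed

text \<open>The coordinate changes are smooth, so that it suffices to check smoothness in one chart.\<close>

lemma smooth_chart_change:
  assumes "c \<in> A" "d \<in> A" "is_open W" "W \<subseteq> cdom c" "W \<subseteq> cdom d"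
    and "smooth_on (cmap c ` W) (\<lambda>x. f (cinv c x))"
  shows "smooth_on (cmap d ` W) (\<lambda>x. f (cinv d x))"
proof -
  have "smooth_on (cmap d ` W) (transition d c)"
    by (rule smooth_on_subset[OF smooth_transition[OF assms(2,1)]]) (use assms in auto)
  moreover have "transition d c ` cmap d ` W \<subseteq> cmap c ` W"
    using assms by (auto intro!: imageI)
  ultimately have "smooth_on (cmap d ` W) (\<lambda>y. f (cinv c (transition d c y)))"
    using smooth_on_compose[OF assms(6) _ open_image'[OF assms(2,3,5)] open_image'[OF assms(1,3,4)]] by simp
  moreover have "f (cinv c (transition d c y)) = f (cinv d y)" if "y \<in> cmap d ` W" for y
  proof -
    from that obtain p where p: "y = cmap d p" "p \<in> W" by blast
    moreover have "p \<in> cdom c" "p \<in> cdom d" using p assms(4,5) by blast+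
    ultimately show ?thesis using assms(1,2) by simp
  qed
  ultimately show ?thesis by (rule smooth_on_cong[OF open_image'[OF assms(2,3,5)], rotated])
qed

lemma J_has_derivative:
  assumes "c \<in> A" "d \<in> A" "p \<in> cdom c" "p \<in> cdom d"
  shows "(transition c d has_derivative J c d p) (at (cmap c p))"
  using assms by (intro fd_works smooth_on_differentiable[OF smooth_transition open_overlap]) auto

lemma J_linear:
  assumes "c \<in> A" "d \<in> A" "p \<in> cdom c" "p \<in> cdom d"
  shows "linear (J c d p)"
  using J_has_derivative[OF assms] has_derivative_linear by blast

lemma J_compose:
  assumes "c \<in> A" "d \<in> A" "e \<in> A" "p \<in> cdom c" "p \<in> cdom d" "p \<in> cdom e"
  shows "J d e p (J c d p u) = J c e p u"
proof -
  let ?W = "cdom c \<inter> cdom d \<inter> cdom e"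
  have W: "open (cmap c ` ?W)"
    using assms by (intro open_image' openin_Int is_open_cdom) auto
  have "(transition d e \<circ> transition c d has_derivative J d e p \<circ> J c d p) (at (cmap c p))"
    using J_has_derivative[of c d p] J_has_derivative[of d e p] assms
    by (intro diff_chain_at) simp_all
  then have "(transition c e has_derivative J d e p \<circ> J c d p) (at (cmap c p))"
    by (rule has_derivative_transform_within_open[OF _ W]) (use assms in auto)
  from fd_eqI[OF this] show ?thesis by simp
qed

lemma J_id:
  assumes "c \<in> A" "p \<in> cdom c"
  shows "J c c p u = u"
proof -
  have "(transition c c has_derivative (\<lambda>u. u)) (at (cmap c p))"
    by (rule has_derivative_transform_within_open[OF has_derivative_ident open_chart[OF assms(1)]])
      (use assms in auto)
  from fd_eqI[OF this] show ?thesis by simp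
qed

lemma J_inverse:
  assumes "c \<in> A" "d \<in> A" "p \<in> cdom c" "p \<in> cdom d"
  shows "J d c p (J c d p u) = u"
  using J_compose[OF assms(1,2,1,3,4,3)] J_id[OF assms(1,3)] by metis

subsection \<open>Tangent vectors\<close>

lemma tangent_change:
  assumes "v \<in> T p" "c \<in> A" "d \<in> A" "p \<in> cdom c" "p \<in> cdom d"
  shows "v d = J c d p (v c)"
proof -
  have "\<forall>c\<in>A. \<forall>d\<in>A. p \<in> cdom c \<inter> cdom d \<longrightarrow> v d = J c d p (v c)"
    using assms(1) unfolding tangent_space_def mem_Collect_eq by (rule conjunct2)
  from bspec[OF bspec[OF this assms(2)] assms(3)] show ?thesis using assms(4,5) by blast
qed

lemma tangent_outside:
  assumes "v \<in> T p" "c \<notin> A \<or> p \<notin> cdom c"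
  shows "v c = 0"
proof -
  have "\<forall>c. c \<notin> A \<or> p \<notin> cdom c \<longrightarrow> v c = 0"
    using assms(1) unfolding tangent_space_def mem_Collect_eq by (rule conjunct1)
  then have "c \<notin> A \<or> p \<notin> cdom c \<longrightarrow> v c = 0" by (rule spec)
  then show ?thesis using assms(2) by (rule mp)
qed

lemma tangentI:
  assumes "\<And>c. c \<notin> A \<or> p \<notin> cdom c \<Longrightarrow> v c = 0"
    and "\<And>c d. c \<in> A \<Longrightarrow> d \<in> A \<Longrightarrow> p \<in> cdom c \<Longrightarrow> p \<in> cdom d \<Longrightarrow> v d = J c d p (v c)"
  shows "v \<in> T p"
  unfolding tangent_space_def mem_Collect_eq
  by (intro conjI allI ballI impI; (rule assms; (elim IntE)?; assumption))

lemma tangent_eqI: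
  assumes "v \<in> T p" "w \<in> T p" "c \<in> A" "p \<in> cdom c" "v c = w c"
  shows "v = w"
proof
  fix d show "v d = w d"
  proof (cases "d \<in> A \<and> p \<in> cdom d")
    case True
    then show ?thesis using tangent_change[OF assms(1,3)] tangent_change[OF assms(2,3)] assms(4,5) by simp
  next
    case False
    then have "d \<notin> A \<or> p \<notin> cdom d" by blast
    then show ?thesis using tangent_outside[OF assms(1)] tangent_outside[OF assms(2)] by simp
  qed
qed

lemma tangent_zero: "0 \<in> T p"
  by (rule tangentI) (simp_all add: linear_0[OF J_linear])

lemma tangent_add:
  assumes "v \<in> T p" "w \<in> T p"
  shows "v + w \<in> T p"
proof (rule tangentI)
  fix c d assume "c \<in> A" "d \<in> A" "p \<in> cdom c" "p \<in> cdom d"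
  then show "(v + w) d = J c d p ((v + w) c)"
    using tangent_change[OF assms(1), of c d] tangent_change[OF assms(2), of c d]
    by (simp add: linear_add[OF J_linear])
qed (simp add: tangent_outside[OF assms(1)] tangent_outside[OF assms(2)])

lemma tangent_scale:
  assumes "v \<in> T p"
  shows "r *\<^sub>R v \<in> T p"
proof (rule tangentI)
  fix c d assume "c \<in> A" "d \<in> A" "p \<in> cdom c" "p \<in> cdom d"
  then show "(r *\<^sub>R v) d = J c d p ((r *\<^sub>R v) c)"
    using tangent_change[OF assms(1), of c d] by (simp add: scaleR_fun_def linear_scale[OF J_linear])
qed (simp add: scaleR_fun_def tangent_outside[OF assms(1)])

lemma tangent_diff: "v \<in> T p \<Longrightarrow> w \<in> T p \<Longrightarrow> v - w \<in> T p"
  using tangent_add[of v p "(-1) *\<^sub>R w"] tangent_scale[of w p "-1"] by simp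

lemma subspace_tangent: "subspace (T p)"
  by (simp add: subspace_def tangent_zero tangent_add tangent_scale)

lemma tangent_sum: "(\<And>i. i \<in> I \<Longrightarrow> v i \<in> T p) \<Longrightarrow> (\<Sum>i\<in>I. v i) \<in> T p"
  by (rule subspace_sum[OF subspace_tangent])

lemma coord_vec_apply: "d \<in> A \<Longrightarrow> p \<in> cdom d \<Longrightarrow> coord_vec A c p u d = J c d p u"
  by (simp add: coord_vec_def)

lemma coord_vec_self: "c \<in> A \<Longrightarrow> p \<in> cdom c \<Longrightarrow> coord_vec A c p u c = u"
  by (simp add: coord_vec_apply J_id)

lemma coord_vec_tangent: "c \<in> A \<Longrightarrow> p \<in> cdom c \<Longrightarrow> coord_vec A c p u \<in> T p"
  by (rule tangentI) (auto simp: coord_vec_def J_compose)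

lemma coord_vec_component:
  assumes "v \<in> T p" "c \<in> A" "p \<in> cdom c"
  shows "coord_vec A c p (v c) = v"
  by (rule tangent_eqI[OF coord_vec_tangent[OF assms(2,3)] assms coord_vec_self[OF assms(2,3)]])

lemma coord_vec_lincomb:
  assumes "c \<in> A" "p \<in> cdom c"
  shows "coord_vec A c p (r *\<^sub>R u + s *\<^sub>R v) = r *\<^sub>R coord_vec A c p u + s *\<^sub>R coord_vec A c p v"
proof (rule tangent_eqI[OF coord_vec_tangent[OF assms] _ assms])
  show "r *\<^sub>R coord_vec A c p u + s *\<^sub>R coord_vec A c p v \<in> T p"
    by (intro tangent_add tangent_scale coord_vec_tangent assms)
qed (simp add: coord_vec_self[OF assms] scaleR_fun_def)

subsection \<open>Smooth functions and vector fields on open subsets\<close>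

definition smooth_fun_on :: "'a set \<Rightarrow> ('a \<Rightarrow> 'b::real_normed_vector) \<Rightarrow> bool"
  where "smooth_fun_on U f \<longleftrightarrow> (\<forall>c\<in>A. smooth_on (cmap c ` (U \<inter> cdom c)) (\<lambda>x. f (cinv c x)))"

lemma smooth_funs_iff: "f \<in> smooth_funs A \<longleftrightarrow> smooth_fun_on (points A) f"
  by (simp add: smooth_funs_def smooth_fun_on_def points_Int_cdom o_def)

lemma smooth_fun_onD:
  "smooth_fun_on U f \<Longrightarrow> c \<in> A \<Longrightarrow> smooth_on (cmap c ` (U \<inter> cdom c)) (\<lambda>x. f (cinv c x))"
  by (simp add: smooth_fun_on_def)

lemma smooth_fun_onI_chart:
  assumes "c \<in> A" "is_open W" "W \<subseteq> cdom c" "smooth_on (cmap c ` W) (\<lambda>x. f (cinv c x))"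
  shows "smooth_fun_on W f"
  unfolding smooth_fun_on_def
proof
  fix d assume d: "d \<in> A"
  have "smooth_on (cmap c ` (W \<inter> cdom d)) (\<lambda>x. f (cinv c x))"
    by (rule smooth_on_subset[OF assms(4)]) auto
  with assms d show "smooth_on (cmap d ` (W \<inter> cdom d)) (\<lambda>x. f (cinv d x))"
    by (intro smooth_chart_change[of c d]) (auto intro!: openin_Int is_open_cdom)
qed

lemma smooth_fun_on_subset: "smooth_fun_on U f \<Longrightarrow> W \<subseteq> U \<Longrightarrow> smooth_fun_on W f"
  unfolding smooth_fun_on_def by (meson Int_mono image_mono order_refl smooth_on_subset)

lemma smooth_fun_on_local:
  assumes "is_open U" "\<And>p. p \<in> U \<Longrightarrow> \<exists>W. is_open W \<and> p \<in> W \<and> smooth_fun_on W f"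
  shows "smooth_fun_on U f"
  unfolding smooth_fun_on_def
proof
  fix c assume c: "c \<in> A"
  show "smooth_on (cmap c ` (U \<inter> cdom c)) (\<lambda>x. f (cinv c x))"
  proof (rule smooth_on_local)
    fix x assume "x \<in> cmap c ` (U \<inter> cdom c)"
    then obtain p where p: "p \<in> U" "p \<in> cdom c" "x = cmap c p" by auto
    then obtain W where W: "is_open W" "p \<in> W" "smooth_fun_on W f" using assms(2) by meson
    show "\<exists>S. open S \<and> x \<in> S \<and> smooth_on S (\<lambda>x. f (cinv c x))"
      using p W c by (intro exI[of _ "cmap c ` (W \<inter> cdom c)"]) (auto simp: open_image smooth_fun_onD)
  qed (simp add: open_image c assms)
qed

lemma smooth_fun_on_cong:
  assumes "is_open U" "\<And>p. p \<in> U \<Longrightarrow> f p = g p" "smooth_fun_on U f"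
  shows "smooth_fun_on U g"
  unfolding smooth_fun_on_def
proof
  fix c assume c: "c \<in> A"
  show "smooth_on (cmap c ` (U \<inter> cdom c)) (\<lambda>x. g (cinv c x))"
    by (rule smooth_on_cong[OF open_image[OF c assms(1)] _ smooth_fun_onD[OF assms(3) c]])
      (use assms(2) c in auto)
qed

lemma smooth_fun_on_const: "smooth_fun_on U (\<lambda>p. r)"
  by (simp add: smooth_fun_on_def smooth_on_const)

lemma smooth_vf_on_tangent: "smooth_vf_on A U X \<Longrightarrow> p \<in> U \<Longrightarrow> X p \<in> T p"
  by (simp add: smooth_vf_on_def)

lemma smooth_vf_onD:
  "smooth_vf_on A U X \<Longrightarrow> c \<in> A \<Longrightarrow> smooth_on (cmap c ` (U \<inter> cdom c)) (\<lambda>x. X (cinv c x) c)"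
  by (simp add: smooth_vf_on_def)

text \<open>One chart suffices: in another one the components are obtained by applying the derivative of the
  coordinate change, and both factors of this expression are smooth.\<close>

lemma smooth_vf_onI_chart:
  assumes "c \<in> A" "is_open W" "W \<subseteq> cdom c" "\<And>p. p \<in> W \<Longrightarrow> X p \<in> T p"
    and "smooth_on (cmap c ` W) (\<lambda>x. X (cinv c x) c)"
  shows "smooth_vf_on A W X"
  unfolding smooth_vf_on_def
proof (intro conjI ballI)
  fix d assume d: "d \<in> A"
  let ?W = "W \<inter> cdom d"
  have W: "is_open ?W" "?W \<subseteq> cdom c" "?W \<subseteq> cdom d" "open (cmap c ` ?W)"
    using assms d by (auto intro!: openin_Int is_open_cdom open_image')
  have "smooth_on (cmap c ` ?W) (\<lambda>x. fd (transition c d) x (X (cinv c x) c))"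
    using W assms d
    by (intro smooth_on_fd_field smooth_on_subset[OF smooth_transition] smooth_on_subset[OF assms(5)]) auto
  then have "smooth_on (cmap c ` ?W) (\<lambda>x. X (cinv c x) d)"
    by (rule smooth_on_cong[OF W(4), rotated]) (use assms d in \<open>auto simp: tangent_change[symmetric]\<close>)
  then show "smooth_on (cmap d ` ?W) (\<lambda>x. X (cinv d x) d)"
    using smooth_chart_change[OF assms(1) d W(1-3), of "\<lambda>p. X p d"] by simp
qed (use assms in auto)

lemma smooth_vf_on_subset: "smooth_vf_on A U X \<Longrightarrow> W \<subseteq> U \<Longrightarrow> smooth_vf_on A W X"
  unfolding smooth_vf_on_def by (meson Int_mono image_mono order_refl smooth_on_subset subsetD)

lemma smooth_vf_on_local:
  assumes "is_open U" "\<And>p. p \<in> U \<Longrightarrow> \<exists>W. is_open W \<and> p \<in> W \<and> smooth_vf_on A W X"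
  shows "smooth_vf_on A U X"
proof -
  have "smooth_on (cmap c ` (U \<inter> cdom c)) (\<lambda>x. X (cinv c x) c)" if c: "c \<in> A" for c
  proof (rule smooth_on_local)
    fix x assume "x \<in> cmap c ` (U \<inter> cdom c)"
    then obtain p where p: "p \<in> U" "p \<in> cdom c" "x = cmap c p" by auto
    then obtain W where W: "is_open W" "p \<in> W" "smooth_vf_on A W X" using assms(2) by meson
    show "\<exists>S. open S \<and> x \<in> S \<and> smooth_on S (\<lambda>x. X (cinv c x) c)"
      using p W c by (intro exI[of _ "cmap c ` (W \<inter> cdom c)"]) (auto simp: open_image smooth_vf_onD)
  qed (simp add: open_image c assms)
  moreover have "X p \<in> T p" if "p \<in> U" for p
    using assms(2)[OF that] smooth_vf_on_tangent by blast
  ultimately show ?thesis unfolding smooth_vf_on_def by blast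
qed

lemma smooth_vf_on_cong:
  assumes "is_open U" "\<And>p. p \<in> U \<Longrightarrow> X p = Y p" "smooth_vf_on A U X"
  shows "smooth_vf_on A U Y"
  unfolding smooth_vf_on_def
proof (intro conjI ballI)
  show "Y p \<in> T p" if "p \<in> U" for p using assms that smooth_vf_on_tangent by metis
next
  fix c assume c: "c \<in> A"
  show "smooth_on (cmap c ` (U \<inter> cdom c)) (\<lambda>x. Y (cinv c x) c)"
    by (rule smooth_on_cong[OF open_image[OF c assms(1)] _ smooth_vf_onD[OF assms(3) c]])
      (use assms(2) c in auto)
qed

lemma smooth_vf_on_scale:
  assumes "is_open U" "smooth_fun_on U f" "smooth_vf_on A U X"
  shows "smooth_vf_on A U (\<lambda>p. f p *\<^sub>R X p)"
  unfolding smooth_vf_on_def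
proof (intro conjI ballI)
  show "f p *\<^sub>R X p \<in> T p" if "p \<in> U" for p using assms that smooth_vf_on_tangent tangent_scale by metis
next
  fix c assume c: "c \<in> A"
  show "smooth_on (cmap c ` (U \<inter> cdom c)) (\<lambda>x. (f (cinv c x) *\<^sub>R X (cinv c x)) c)"
    unfolding scaleR_fun_def
    by (intro smooth_on_scaleR open_image smooth_fun_onD smooth_vf_onD assms c)
qed

lemma smooth_vf_on_zero: "smooth_vf_on A U (\<lambda>p. 0)"
  by (simp add: smooth_vf_on_def tangent_zero smooth_on_const)

lemma smooth_vf_on_add:
  assumes "is_open U" "smooth_vf_on A U X" "smooth_vf_on A U Y"
  shows "smooth_vf_on A U (\<lambda>p. X p + Y p)"
  unfolding smooth_vf_on_def
proof (intro conjI ballI)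
  show "X p + Y p \<in> T p" if "p \<in> U" for p using assms that smooth_vf_on_tangent tangent_add by metis
next
  fix c assume c: "c \<in> A"
  show "smooth_on (cmap c ` (U \<inter> cdom c)) (\<lambda>x. (X (cinv c x) + Y (cinv c x)) c)"
    unfolding plus_fun_apply
    by (intro smooth_on_add open_image smooth_vf_onD assms c)
qed

lemma vector_fields_iff:
  "X \<in> vector_fields A \<longleftrightarrow> smooth_vf_on A (points A) X \<and> (\<forall>p. p \<notin> points A \<longrightarrow> X p = 0)"
  by (simp add: vector_fields_def)

lemma vector_fields_smooth: "X \<in> vector_fields A \<Longrightarrow> is_open U \<Longrightarrow> smooth_vf_on A U X"
  unfolding vector_fields_iff using smooth_vf_on_subset is_open_iff by metis

lemma vector_fields_tangent: "X \<in> vector_fields A \<Longrightarrow> p \<in> points A \<Longrightarrow> X p \<in> T p"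
  unfolding vector_fields_iff using smooth_vf_on_tangent by metis

lemma vector_fields_add:
  assumes "X \<in> vector_fields A" "Y \<in> vector_fields A"
  shows "X + Y \<in> vector_fields A"
proof -
  have eq: "X + Y = (\<lambda>p. X p + Y p)" by (rule ext) simp
  show ?thesis
    using assms smooth_vf_on_add[OF is_open_points, of X Y] unfolding vector_fields_iff eq by simp
qed

lemma vector_fields_zero: "0 \<in> vector_fields A"
  unfolding vector_fields_iff using smooth_vf_on_zero by (simp add: zero_fun_def)

lemma vector_fields_scale:
  "f \<in> smooth_funs A \<Longrightarrow> X \<in> vector_fields A \<Longrightarrow> (\<lambda>p. f p *\<^sub>R X p) \<in> vector_fields A"
  unfolding vector_fields_iff smooth_funs_iff using smooth_vf_on_scale[OF is_open_points] by simp

lemma vector_fields_sum: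
  "(\<And>i. i \<in> I \<Longrightarrow> X i \<in> vector_fields A) \<Longrightarrow> (\<Sum>i\<in>I. X i) \<in> vector_fields A"
  by (induction I rule: infinite_finite_induct) (auto intro: vector_fields_add vector_fields_zero)

subsection \<open>Differentials of functions\<close>

lemma chart_at: "p \<in> points A \<Longrightarrow> chart_at A p \<in> A \<and> p \<in> cdom (chart_at A p)"
  unfolding chart_at_def points_def by (rule someI_ex) auto

lemma dderiv_chart:
  assumes "c \<in> A" "p \<in> cdom c" "v \<in> T p" "(\<lambda>x. f (cinv c x)) differentiable (at (cmap c p))"
  shows "dderiv A f p v = fd (\<lambda>x. f (cinv c x)) (cmap c p) (v c)"
proof -
  define d where "d = chart_at A p"
  have d: "d \<in> A" "p \<in> cdom d" using chart_at[of p] assms unfolding d_def points_def by auto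
  have "((\<lambda>x. f (cinv c x)) \<circ> transition d c has_derivative fd (\<lambda>x. f (cinv c x)) (cmap c p) \<circ> J d c p) (at (cmap d p))"
    using fd_works[OF assms(4)] assms d by (intro diff_chain_at J_has_derivative) simp_all
  then have "(f \<circ> cinv d has_derivative fd (\<lambda>x. f (cinv c x)) (cmap c p) \<circ> J d c p) (at (cmap d p))"
    by (rule has_derivative_transform_within_open[OF _ open_overlap[OF d(1) assms(1)]]) (use assms d in auto)
  from fd_eqI[OF this] show ?thesis
    using tangent_change[OF assms(3) d(1) assms(1) d(2) assms(2)] by (simp add: dderiv_def d_def[symmetric])
qed

lemma smooth_fun_on_differentiable:
  assumes "smooth_fun_on U f" "is_open U" "c \<in> A" "p \<in> U" "p \<in> cdom c"
  shows "(\<lambda>x. f (cinv c x)) differentiable (at (cmap c p))"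
  using assms by (intro smooth_on_differentiable[OF smooth_fun_onD open_image]) auto

lemma dderiv_eq:
  assumes "smooth_fun_on U f" "is_open U" "c \<in> A" "p \<in> U" "p \<in> cdom c" "v \<in> T p"
  shows "dderiv A f p v = fd (\<lambda>x. f (cinv c x)) (cmap c p) (v c)"
  using assms by (intro dderiv_chart smooth_fun_on_differentiable)

text \<open>By the chain rule the derivative along a tangent vector does not depend on the chart: the Jacobian of
  the coordinate change is exactly what transforms the components of the vector.\<close>

lemma directional_derivative_change:
  assumes "c \<in> A" "d \<in> A" "p \<in> cdom c" "p \<in> cdom d" "w \<in> T p"
    and "(\<lambda>y. f (cinv d y)) differentiable (at (cmap d p))"
  shows "((\<lambda>x. f (cinv c x)) has_derivative (\<lambda>h. fd (\<lambda>y. f (cinv d y)) (cmap d p) (J c d p h))) (at (cmap c p))"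
    and "fd (\<lambda>x. f (cinv c x)) (cmap c p) (w c) = fd (\<lambda>y. f (cinv d y)) (cmap d p) (w d)"
proof -
  have "((\<lambda>y. f (cinv d y)) \<circ> transition c d has_derivative fd (\<lambda>y. f (cinv d y)) (cmap d p) \<circ> J c d p) (at (cmap c p))"
    using fd_works[OF assms(6)] assms by (intro diff_chain_at J_has_derivative) simp_all
  then show *: "((\<lambda>x. f (cinv c x)) has_derivative (\<lambda>h. fd (\<lambda>y. f (cinv d y)) (cmap d p) (J c d p h))) (at (cmap c p))"
    unfolding o_def
    by (rule has_derivative_transform_within_open[OF _ open_overlap[OF assms(1,2)]]) (use assms in auto)
  show "fd (\<lambda>x. f (cinv c x)) (cmap c p) (w c) = fd (\<lambda>y. f (cinv d y)) (cmap d p) (w d)"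
    using fd_eqI[OF *] tangent_change[OF assms(5,1,2,3,4)] by simp
qed

lemma smooth_vf_coord_vec:
  assumes "c \<in> A"
  shows "smooth_vf_on A (cdom c) (\<lambda>q. coord_vec A c q u)"
proof (rule smooth_vf_onI_chart[OF assms is_open_cdom[OF assms] order_refl])
  show "smooth_on (cmap c ` cdom c) (\<lambda>x. coord_vec A c (cinv c x) u c)"
    by (rule smooth_on_cong[OF open_chart[OF assms] _ smooth_on_const[of _ u]])
      (use assms in \<open>auto simp: coord_vec_self\<close>)
qed (rule coord_vec_tangent[OF assms])

end

lemma sum_fun_apply: "(\<Sum>i\<in>I. F i) q = (\<Sum>i\<in>I. F i q)"
  by (induction I rule: infinite_finite_induct) auto

section \<open>Cutoff functions and locality of linear connections\<close>

locale hausdorff_atlas = atlas A for A :: "('a, 'e::euclidean_space) chart set" +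
  assumes hausdorff: "Hausdorff_space (atlas_topology A)"
begin

text \<open>Compact sets are closed in a Hausdorff space. This guarantees that a function with compact support in a
  chart remains smooth when it is continued by 0 to the whole manifold.\<close>

lemma closedin_compact_coord:
  assumes "c \<in> A" "compact S" "S \<subseteq> cmap c ` cdom c"
  shows "closedin (atlas_topology A) {p \<in> cdom c. cmap c p \<in> S}"
proof -
  have "continuous_map (top_of_set S) (atlas_topology A) (cinv c)"
    unfolding continuous_map_def
  proof (intro conjI allI impI)
    show "cinv c \<in> topspace (top_of_set S) \<rightarrow> topspace (atlas_topology A)"
      using assms by (auto simp: topspace_atlas points_def dest!: subsetD)
  next
    fix W assume "is_open W"
    then have "open (cmap c ` (W \<inter> cdom c))" using assms(1) open_image by blast
    moreover have "{x \<in> topspace (top_of_set S). cinv c x \<in> W} = S \<inter> cmap c ` (W \<inter> cdom c)"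
    proof (intro equalityI subsetI)
      fix x assume x: "x \<in> {x \<in> topspace (top_of_set S). cinv c x \<in> W}"
      then obtain p where "p \<in> cdom c" "x = cmap c p" using assms(3) by auto
      then show "x \<in> S \<inter> cmap c ` (W \<inter> cdom c)" using x assms(1) by auto
    qed (use assms in auto)
    ultimately show "openin (top_of_set S) {x \<in> topspace (top_of_set S). cinv c x \<in> W}"
      by (metis openin_open)
  qed
  moreover have "compactin (top_of_set S) S" using assms(2) by (simp add: compactin_subtopology)
  ultimately have "compactin (atlas_topology A) (cinv c ` S)" by (rule image_compactin[rotated])
  moreover have "cinv c ` S = {p \<in> cdom c. cmap c p \<in> S}"
  proof (intro equalityI subsetI)
    fix p assume "p \<in> {p \<in> cdom c. cmap c p \<in> S}"
    then show "p \<in> cinv c ` S" using assms(1) by (intro image_eqI[of _ _ "cmap c p"]) auto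
  next
    fix p assume "p \<in> cinv c ` S"
    then obtain x where x: "x \<in> S" "p = cinv c x" by blast
    then obtain q where "q \<in> cdom c" "x = cmap c q" using assms(3) by blast
    then show "p \<in> {p \<in> cdom c. cmap c p \<in> S}" using assms(1) x by simp
  qed
  ultimately show ?thesis using compactin_imp_closedin[OF hausdorff] by simp
qed

text \<open>A Euclidean bump function in a chart around \<open>p\<close>, continued by 0. The plateau \<open>V\<close> is needed to
  extend germs without changing them, the closed set \<open>K\<close> to continue products with \<open>\<phi>\<close> by 0.\<close>

lemma bump_function:
  assumes "is_open U" "p \<in> U"
  obtains \<phi> V K where "\<phi> \<in> smooth_funs A" "is_open V" "p \<in> V" "V \<subseteq> K" "\<And>q. q \<in> V \<Longrightarrow> \<phi> q = 1"
    "closedin (atlas_topology A) K" "K \<subseteq> U" "\<And>q. q \<notin> K \<Longrightarrow> \<phi> q = 0"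
proof -
  have "p \<in> points A" using assms is_open_iff by blast
  then obtain c where c: "c \<in> A" "p \<in> cdom c" by (auto simp: points_def)
  have "open (cmap c ` (U \<inter> cdom c))" "cmap c p \<in> cmap c ` (U \<inter> cdom c)"
    using open_image[OF c(1) assms(1)] c assms by auto
  then obtain r where r: "r > 0" "cball (cmap c p) r \<subseteq> cmap c ` (U \<inter> cdom c)"
    using open_contains_cball by blast
  obtain \<beta> :: "'e \<Rightarrow> real" where \<beta>: "smooth_on UNIV \<beta>" "\<And>x. x \<in> ball (cmap c p) (r/2) \<Longrightarrow> \<beta> x = 1"
    "\<And>x. x \<notin> ball (cmap c p) r \<Longrightarrow> \<beta> x = 0"
    by (rule euclidean_bump[OF r(1), of "cmap c p"]) (rule that)
  define \<phi> where "\<phi> q = (if q \<in> cdom c then \<beta> (cmap c q) else 0)" for q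
  define K where "K = {q \<in> cdom c. cmap c q \<in> cball (cmap c p) r}"
  define V where "V = {q \<in> cdom c. cmap c q \<in> ball (cmap c p) (r/2)}"
  have K: "closedin (atlas_topology A) K"
    unfolding K_def using r c by (intro closedin_compact_coord) auto
  have off_K: "\<phi> q = 0" if "q \<notin> K" for q
    using that \<beta>(3)[of "cmap c q"] by (auto simp: \<phi>_def K_def)
  have "smooth_fun_on (points A) \<phi>"
  proof (rule smooth_fun_on_local[OF is_open_points])
    fix q assume q: "q \<in> points A"
    show "\<exists>W. is_open W \<and> q \<in> W \<and> smooth_fun_on W \<phi>"
    proof (cases "q \<in> cdom c")
      case True
      have "smooth_on (cmap c ` cdom c) (\<lambda>x. \<phi> (cinv c x))"
        by (rule smooth_on_cong[OF open_chart[OF c(1)] _ smooth_on_subset[OF \<beta>(1)]])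
          (use c in \<open>auto simp: \<phi>_def\<close>)
      then have "smooth_fun_on (cdom c) \<phi>" by (intro smooth_fun_onI_chart[OF c(1)] is_open_cdom c) auto
      then show ?thesis using True is_open_cdom c by blast
    next
      case False
      have o: "is_open (points A - K)" using K topspace_atlas by (metis closedin_def)
      have "smooth_fun_on (points A - K) \<phi>"
        by (rule smooth_fun_on_cong[OF o _ smooth_fun_on_const[of _ 0]]) (simp add: off_K)
      then show ?thesis using o q False K_def by blast
    qed
  qed
  moreover have "is_open V" unfolding V_def using c by (intro is_open_coord) auto
  moreover have "p \<in> V" using c r by (simp add: V_def)
  moreover have "V \<subseteq> K" using r by (auto simp: V_def K_def)
  moreover have "\<phi> q = 1" if "q \<in> V" for q using that \<beta>(2) by (auto simp: V_def \<phi>_def)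
  moreover have "K \<subseteq> U"
  proof
    fix q assume "q \<in> K"
    then have q: "q \<in> cdom c" "cmap c q \<in> cmap c ` (U \<inter> cdom c)" using r(2) by (auto simp: K_def)
    then show "q \<in> U" using inj_cmap[OF c(1)] by (auto dest: inj_onD)
  qed
  ultimately show ?thesis using K off_K that smooth_funs_iff by blast
qed

text \<open>Multiplication by a cutoff function followed by continuation by 0; used both for real functions and
  for vector fields.\<close>

definition cutoff :: "('a \<Rightarrow> real) \<Rightarrow> 'a set \<Rightarrow> ('a \<Rightarrow> 'c::real_vector) \<Rightarrow> 'a \<Rightarrow> 'c"
  where "cutoff \<phi> U X q = (if q \<in> U then \<phi> q *\<^sub>R X q else 0)"

lemma cutoff_vector_field:
  assumes "\<phi> \<in> smooth_funs A" "is_open U" "closedin (atlas_topology A) K" "K \<subseteq> U"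
    "\<And>q. q \<notin> K \<Longrightarrow> \<phi> q = 0" "smooth_vf_on A U X"
  shows "cutoff \<phi> U X \<in> vector_fields A"
  unfolding vector_fields_iff
proof (intro conjI allI impI)
  show "cutoff \<phi> U X q = 0" if "q \<notin> points A" for q
    using that assms(2) is_open_iff by (auto simp: cutoff_def)
  show "smooth_vf_on A (points A) (cutoff \<phi> U X)"
  proof (rule smooth_vf_on_local[OF is_open_points])
    fix q assume q: "q \<in> points A"
    have \<phi>: "smooth_fun_on U \<phi>"
      using assms(1,2) smooth_fun_on_subset is_open_iff smooth_funs_iff by blast
    have 1: "smooth_vf_on A U (cutoff \<phi> U X)"
      by (rule smooth_vf_on_cong[OF assms(2) _ smooth_vf_on_scale[OF assms(2) \<phi> assms(6)]])
        (simp add: cutoff_def)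
    have o: "is_open (points A - K)" using assms(3) topspace_atlas by (metis closedin_def)
    have 2: "smooth_vf_on A (points A - K) (cutoff \<phi> U X)"
      by (rule smooth_vf_on_cong[OF o _ smooth_vf_on_zero]) (simp add: cutoff_def assms(5))
    show "\<exists>W. is_open W \<and> q \<in> W \<and> smooth_vf_on A W (cutoff \<phi> U X)"
      using 1 2 o assms(2,4) q by blast
  qed
qed

lemma cutoff_smooth_fun:
  assumes "\<phi> \<in> smooth_funs A" "is_open U" "closedin (atlas_topology A) K" "K \<subseteq> U"
    "\<And>q. q \<notin> K \<Longrightarrow> \<phi> q = 0" "smooth_fun_on U f"
  shows "cutoff \<phi> U f \<in> smooth_funs A"
  unfolding smooth_funs_iff
proof (rule smooth_fun_on_local[OF is_open_points])
  fix q assume q: "q \<in> points A"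
  have \<phi>: "smooth_fun_on U \<phi>"
    using assms(1,2) smooth_fun_on_subset is_open_iff smooth_funs_iff by blast
  have "smooth_fun_on U (\<lambda>q. \<phi> q * f q)"
    unfolding smooth_fun_on_def
    by (intro ballI smooth_on_mult open_image smooth_fun_onD[OF \<phi>] smooth_fun_onD[OF assms(6)] assms(2))
  then have 1: "smooth_fun_on U (cutoff \<phi> U f)"
    by (rule smooth_fun_on_cong[OF assms(2), rotated]) (simp add: cutoff_def)
  have o: "is_open (points A - K)" using assms(3) topspace_atlas by (metis closedin_def)
  have 2: "smooth_fun_on (points A - K) (cutoff \<phi> U f)"
    by (rule smooth_fun_on_cong[OF o _ smooth_fun_on_const[of _ 0]]) (simp add: cutoff_def assms(5))
  show "\<exists>W. is_open W \<and> q \<in> W \<and> smooth_fun_on W (cutoff \<phi> U f)"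
    using 1 2 o assms(2,4) q by blast
qed

lemma local_extension:
  assumes "is_open U" "p \<in> U" "smooth_vf_on A U X"
  obtains X' V where "X' \<in> vector_fields A" "is_open V" "p \<in> V" "V \<subseteq> U" "\<And>q. q \<in> V \<Longrightarrow> X' q = X q"
proof -
  obtain \<phi> V K where *: "\<phi> \<in> smooth_funs A" "is_open V" "p \<in> V" "V \<subseteq> K" "\<And>q. q \<in> V \<Longrightarrow> \<phi> q = 1"
    "closedin (atlas_topology A) K" "K \<subseteq> U" "\<And>q. q \<notin> K \<Longrightarrow> \<phi> q = 0"
    by (rule bump_function[OF assms(1,2)]) (rule that)
  show ?thesis
  proof (rule that)
    show "cutoff \<phi> U X \<in> vector_fields A" by (rule cutoff_vector_field[OF *(1) assms(1) *(6-8) assms(3)])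
    show "V \<subseteq> U" using * by blast
    then show "cutoff \<phi> U X q = X q" if "q \<in> V" for q using that *(5) by (auto simp: cutoff_def)
  qed (use * in auto)
qed

context
  fixes D assumes D: "linear_connection A D"
begin

lemma connection_closed: "X \<in> vector_fields A \<Longrightarrow> Y \<in> vector_fields A \<Longrightarrow> D X Y \<in> vector_fields A"
  using D unfolding linear_connection_def by blast

lemma connection_add_left:
  "X \<in> vector_fields A \<Longrightarrow> X' \<in> vector_fields A \<Longrightarrow> Y \<in> vector_fields A \<Longrightarrow> D (X + X') Y = D X Y + D X' Y"
  using D unfolding linear_connection_def by blast

lemma connection_add_right:
  "X \<in> vector_fields A \<Longrightarrow> Y \<in> vector_fields A \<Longrightarrow> Y' \<in> vector_fields A \<Longrightarrow> D X (Y + Y') = D X Y + D X Y'"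
  using D unfolding linear_connection_def by blast

lemma connection_scale_left:
  "f \<in> smooth_funs A \<Longrightarrow> X \<in> vector_fields A \<Longrightarrow> Y \<in> vector_fields A \<Longrightarrow>
    D (\<lambda>p. f p *\<^sub>R X p) Y = (\<lambda>p. f p *\<^sub>R D X Y p)"
  using D unfolding linear_connection_def by blast

lemma connection_Leibniz:
  "f \<in> smooth_funs A \<Longrightarrow> X \<in> vector_fields A \<Longrightarrow> Y \<in> vector_fields A \<Longrightarrow>
    D X (\<lambda>p. f p *\<^sub>R Y p) = (\<lambda>p. dderiv A f p (X p) *\<^sub>R Y p + f p *\<^sub>R D X Y p)"
  using D unfolding linear_connection_def by blast

lemma connection_zero_left: "Y \<in> vector_fields A \<Longrightarrow> D 0 Y = 0"
  using connection_add_left[OF vector_fields_zero vector_fields_zero, of Y] by (metis add.right_neutral add_left_cancel)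

lemma connection_zero_right: "X \<in> vector_fields A \<Longrightarrow> D X 0 = 0"
  using connection_add_right[OF _ vector_fields_zero vector_fields_zero, of X] by (metis add.right_neutral add_left_cancel)

text \<open>If \<open>\<phi>\<close> is supported where the fields agree then \<open>\<phi>X = \<phi>X'\<close> globally; comparing the two sides of the
  product rules at \<open>p\<close>, where \<open>\<phi>\<close> is 1, gives the claim. In the second argument the additional term of
  the Leibniz rule only involves the value of the field at \<open>p\<close>.\<close>

lemma connection_local:
  assumes "X \<in> vector_fields A" "Y \<in> vector_fields A" "X' \<in> vector_fields A" "Y' \<in> vector_fields A"
    and "is_open U" "p \<in> U" "\<And>q. q \<in> U \<Longrightarrow> X q = X' q" "\<And>q. q \<in> U \<Longrightarrow> Y q = Y' q"
  shows "D X Y p = D X' Y' p"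
proof -
  obtain \<phi> V K where *: "\<phi> \<in> smooth_funs A" "is_open V" "p \<in> V" "V \<subseteq> K" "\<And>q. q \<in> V \<Longrightarrow> \<phi> q = 1"
    "closedin (atlas_topology A) K" "K \<subseteq> U" "\<And>q. q \<notin> K \<Longrightarrow> \<phi> q = 0"
    by (rule bump_function[OF assms(5,6)]) (rule that)
  have \<phi>p: "\<phi> p = 1" using * by blast
  have eq: "(\<lambda>q. \<phi> q *\<^sub>R X q) = (\<lambda>q. \<phi> q *\<^sub>R X' q)"
  proof
    fix q show "\<phi> q *\<^sub>R X q = \<phi> q *\<^sub>R X' q" using *(7,8) assms(7) by (cases "q \<in> K") auto
  qed
  have "\<phi> p *\<^sub>R D X Y p = \<phi> p *\<^sub>R D X' Y p"
    by (rule trans[OF fun_cong[OF connection_scale_left[OF *(1) assms(1,2), unfolded eq], of p, symmetric]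
          fun_cong[OF connection_scale_left[OF *(1) assms(3,2)], of p]])
  then have "D X Y p = D X' Y p" using \<phi>p by simp
  moreover have "D X' Y p = D X' Y' p"
  proof -
    have eq: "(\<lambda>q. \<phi> q *\<^sub>R Y q) = (\<lambda>q. \<phi> q *\<^sub>R Y' q)"
    proof
      fix q show "\<phi> q *\<^sub>R Y q = \<phi> q *\<^sub>R Y' q" using *(7,8) assms(8) by (cases "q \<in> K") auto
    qed
    have "dderiv A \<phi> p (X' p) *\<^sub>R Y p + \<phi> p *\<^sub>R D X' Y p = dderiv A \<phi> p (X' p) *\<^sub>R Y' p + \<phi> p *\<^sub>R D X' Y' p"
      using fun_cong[OF connection_Leibniz[OF *(1) assms(3,2)], of p]
        fun_cong[OF connection_Leibniz[OF *(1) assms(3,4)], of p] eq by simp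
    then show ?thesis using \<phi>p assms(6,8) by simp
  qed
  ultimately show ?thesis by simp
qed

text \<open>By locality the description in \<open>local_conn_def\<close> does determine a value, and any global
  extensions compute it.\<close>

lemma local_conn_eq:
  assumes "X' \<in> vector_fields A" "Y' \<in> vector_fields A" "is_open U" "p \<in> U"
    "\<And>q. q \<in> U \<Longrightarrow> X' q = X q" "\<And>q. q \<in> U \<Longrightarrow> Y' q = Y q"
  shows "local_conn A D X Y p = D X' Y' p"
  unfolding local_conn_def
proof (rule the_equality)
  show "\<exists>X''\<in>vector_fields A. \<exists>Y''\<in>vector_fields A. \<exists>U. is_open U \<and> p \<in> U \<and>
      (\<forall>q\<in>U. X'' q = X q \<and> Y'' q = Y q) \<and> D X' Y' p = D X'' Y'' p"
    using assms by blast
next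
  fix w
  assume "\<exists>X''\<in>vector_fields A. \<exists>Y''\<in>vector_fields A. \<exists>U. is_open U \<and> p \<in> U \<and>
      (\<forall>q\<in>U. X'' q = X q \<and> Y'' q = Y q) \<and> w = D X'' Y'' p"
  then obtain X'' Y'' W where *: "X'' \<in> vector_fields A" "Y'' \<in> vector_fields A" "is_open W" "p \<in> W"
    "\<And>q. q \<in> W \<Longrightarrow> X'' q = X q \<and> Y'' q = Y q" "w = D X'' Y'' p" by blast
  have "D X'' Y'' p = D X' Y' p"
    by (rule connection_local[OF *(1,2) assms(1,2) openin_Int[OF *(3) assms(3)]]) (use * assms in auto)
  then show "w = D X' Y' p" using * by simp
qed

lemma connection_lincomb_left:
  assumes "finite I" "\<And>a. a \<in> I \<Longrightarrow> E a \<in> vector_fields A" "\<And>a. a \<in> I \<Longrightarrow> f a \<in> smooth_funs A"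
    "Y \<in> vector_fields A"
  shows "D (\<Sum>a\<in>I. (\<lambda>q. f a q *\<^sub>R E a q)) Y p = (\<Sum>a\<in>I. f a p *\<^sub>R D (E a) Y p)"
  using assms(1-3)
proof (induction I)
  case empty
  show ?case
    using fun_cong[OF connection_zero_left[OF assms(4)], of p]
    by (simp only: sum.empty zero_fun_def)
next
  case (insert a I)
  have 1: "(\<lambda>q. f a q *\<^sub>R E a q) \<in> vector_fields A" using insert by (intro vector_fields_scale) auto
  have 2: "(\<Sum>a\<in>I. (\<lambda>q. f a q *\<^sub>R E a q)) \<in> vector_fields A"
    using insert by (intro vector_fields_sum vector_fields_scale) auto
  have a: "f a \<in> smooth_funs A" "E a \<in> vector_fields A" using insert by auto
  have IH: "D (\<Sum>a\<in>I. (\<lambda>q. f a q *\<^sub>R E a q)) Y p = (\<Sum>a\<in>I. f a p *\<^sub>R D (E a) Y p)"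
    using insert by auto
  show ?case
    unfolding sum.insert[OF insert(1,2)] connection_add_left[OF 1 2 assms(4)]
      connection_scale_left[OF a assms(4)] plus_fun_apply[of "\<lambda>p. f a p *\<^sub>R D (E a) Y p" _ p] IH by (rule refl)
qed

lemma connection_lincomb_right:
  assumes "finite I" "\<And>a. a \<in> I \<Longrightarrow> E a \<in> vector_fields A" "\<And>a. a \<in> I \<Longrightarrow> f a \<in> smooth_funs A"
    "X \<in> vector_fields A"
  shows "D X (\<Sum>a\<in>I. (\<lambda>q. f a q *\<^sub>R E a q)) p
    = (\<Sum>a\<in>I. dderiv A (f a) p (X p) *\<^sub>R E a p + f a p *\<^sub>R D X (E a) p)"
  using assms(1-3)
proof (induction I)
  case empty
  show ?case
    using fun_cong[OF connection_zero_right[OF assms(4)], of p]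
    by (simp only: sum.empty zero_fun_def)
next
  case (insert a I)
  have 1: "(\<lambda>q. f a q *\<^sub>R E a q) \<in> vector_fields A" using insert by (intro vector_fields_scale) auto
  have 2: "(\<Sum>a\<in>I. (\<lambda>q. f a q *\<^sub>R E a q)) \<in> vector_fields A"
    using insert by (intro vector_fields_sum vector_fields_scale) auto
  have a: "f a \<in> smooth_funs A" "E a \<in> vector_fields A" using insert by auto
  have IH: "D X (\<Sum>a\<in>I. (\<lambda>q. f a q *\<^sub>R E a q)) p
    = (\<Sum>a\<in>I. dderiv A (f a) p (X p) *\<^sub>R E a p + f a p *\<^sub>R D X (E a) p)"
    by (rule insert.IH) (use insert.prems in auto)
  show ?case
    unfolding sum.insert[OF insert(1,2)] connection_add_right[OF assms(4) 1 2]
      connection_Leibniz[OF a(1) assms(4) a(2)] plus_fun_apply[of "\<lambda>p. dderiv A (f a) p (X p) *\<^sub>R E a p + f a p *\<^sub>R D X (E a) p" _ p] IH by (rule refl)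
qed

end

text \<open>After cutting off the frame and the components, \<open>X\<close> and \<open>Y\<close> are near \<open>p\<close> finite combinations of
  global vector fields, and the Leibniz rule reduces \<open>D X Y p\<close> to the values on the frame.\<close>

lemma connection_determined_by_frame:
  assumes D: "linear_connection A D" and D': "linear_connection A D'" and "finite I" "is_open U" "p \<in> U"
    and E: "\<And>a. a \<in> I \<Longrightarrow> smooth_vf_on A U (E a)"
    and same: "\<And>a b. a \<in> I \<Longrightarrow> b \<in> I \<Longrightarrow> local_conn A D (E a) (E b) p = local_conn A D' (E a) (E b) p"
    and XY: "X \<in> vector_fields A" "Y \<in> vector_fields A"
    and x: "\<And>a. a \<in> I \<Longrightarrow> smooth_fun_on U (x a)" "\<And>q. q \<in> U \<Longrightarrow> X q = (\<Sum>a\<in>I. x a q *\<^sub>R E a q)"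
    and y: "\<And>a. a \<in> I \<Longrightarrow> smooth_fun_on U (y a)" "\<And>q. q \<in> U \<Longrightarrow> Y q = (\<Sum>a\<in>I. y a q *\<^sub>R E a q)"
  shows "D X Y p = D' X Y p"
proof -
  obtain \<phi> V K where *: "\<phi> \<in> smooth_funs A" "is_open V" "p \<in> V" "V \<subseteq> K" "\<And>q. q \<in> V \<Longrightarrow> \<phi> q = 1"
    "closedin (atlas_topology A) K" "K \<subseteq> U" "\<And>q. q \<notin> K \<Longrightarrow> \<phi> q = 0"
    by (rule bump_function[OF assms(4,5)]) (rule that)
  let ?E = "\<lambda>a. cutoff \<phi> U (E a)" and ?x = "\<lambda>a. cutoff \<phi> U (x a)" and ?y = "\<lambda>a. cutoff \<phi> U (y a)"
  note cutoff = cutoff_vector_field[OF *(1) assms(4) *(6-8)] cutoff_smooth_fun[OF *(1) assms(4) *(6-8)]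
  have E': "\<And>a. a \<in> I \<Longrightarrow> ?E a \<in> vector_fields A" and x': "\<And>a. a \<in> I \<Longrightarrow> ?x a \<in> smooth_funs A"
    and y': "\<And>a. a \<in> I \<Longrightarrow> ?y a \<in> smooth_funs A"
    using E x y by (auto intro!: cutoff)
  have VU: "V \<subseteq> U" using * by blast
  have inV: "?E a q = E a q" "?x a q = x a q" "?y a q = y a q" if "q \<in> V" for a q
    using that VU *(5) by (auto simp: cutoff_def)
  let ?X = "\<Sum>a\<in>I. (\<lambda>q. ?x a q *\<^sub>R ?E a q)" and ?Y = "\<Sum>a\<in>I. (\<lambda>q. ?y a q *\<^sub>R ?E a q)"
  have VF: "?X \<in> vector_fields A" "?Y \<in> vector_fields A"
    using E' x' y' by (auto intro!: vector_fields_sum vector_fields_scale)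
  have eq: "X q = ?X q" "Y q = ?Y q" if "q \<in> V" for q
    using x(2)[of q] y(2)[of q] that VU inV by (auto simp: sum_fun_apply intro!: sum.cong)
  have "D1 X Y p = (\<Sum>a\<in>I. ?x a p *\<^sub>R (\<Sum>b\<in>I. dderiv A (?y b) p (?E a p) *\<^sub>R ?E b p
      + ?y b p *\<^sub>R local_conn A D1 (E a) (E b) p))" if D1: "linear_connection A D1" for D1
  proof -
    have "D1 X Y p = D1 ?X ?Y p" by (rule connection_local[OF D1 XY VF *(2,3) eq])
    also have "\<dots> = (\<Sum>a\<in>I. ?x a p *\<^sub>R (\<Sum>b\<in>I. dderiv A (?y b) p (?E a p) *\<^sub>R ?E b p
      + ?y b p *\<^sub>R D1 (?E a) (?E b) p))"
    proof -
      have "D1 ?X ?Y p = (\<Sum>a\<in>I. ?x a p *\<^sub>R D1 (?E a) ?Y p)"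
        by (rule connection_lincomb_left[OF D1 \<open>finite I\<close> E' x' VF(2)])
      also have "\<dots> = (\<Sum>a\<in>I. ?x a p *\<^sub>R (\<Sum>b\<in>I. dderiv A (?y b) p (?E a p) *\<^sub>R ?E b p
          + ?y b p *\<^sub>R D1 (?E a) (?E b) p))"
        by (intro sum.cong refl arg_cong2[where f="(*\<^sub>R)"] connection_lincomb_right[OF D1 \<open>finite I\<close> E' y' E'])
      finally show ?thesis .
    qed
    also have "\<dots> = (\<Sum>a\<in>I. ?x a p *\<^sub>R (\<Sum>b\<in>I. dderiv A (?y b) p (?E a p) *\<^sub>R ?E b p
      + ?y b p *\<^sub>R local_conn A D1 (E a) (E b) p))"
      by (intro sum.cong refl arg_cong2[where f="(*\<^sub>R)"] arg_cong2[where f="(+)"]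
          local_conn_eq[OF D1, symmetric] E' inV) (use * in auto)
    finally show ?thesis .
  qed
  from this[OF D] this[OF D'] show ?thesis using same by simp
qed

end

section \<open>The tangent bundle as a manifold\<close>

context atlas
begin

abbreviation ic :: "('a, 'e) chart \<Rightarrow> (('a, 'e) tpoint, 'e \<times> 'e) chart"
  where "ic \<equiv> induced_chart A"

lemma ic_mem [simp]: "z \<in> cdom (ic c) \<longleftrightarrow> fst z \<in> cdom c \<and> snd z \<in> T (fst z)"
  by (cases z) (simp add: induced_chart_def)

lemma cmap_ic [simp]: "cmap (ic c) z = (cmap c (fst z), snd z c)"
  by (cases z) (simp add: induced_chart_def)

lemma ic_TM: "c \<in> A \<Longrightarrow> ic c \<in> TM A"
  by (simp add: TM_def)

lemma TM_points: "z \<in> points (TM A) \<longleftrightarrow> fst z \<in> points A \<and> snd z \<in> T (fst z)"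
  by (auto simp: points_def TM_def)

lemma ic_inj: "c \<in> A \<Longrightarrow> inj_on (cmap (ic c)) (cdom (ic c))"
proof (rule inj_onI)
  fix z z' assume c: "c \<in> A" and z: "z \<in> cdom (ic c)" "z' \<in> cdom (ic c)" "cmap (ic c) z = cmap (ic c) z'"
  then have "fst z = fst z'" using inj_cmap[OF c] by (auto dest: inj_onD)
  then show "z = z'" using z c tangent_eqI[of "snd z" "fst z" "snd z'" c] by (auto intro: prod_eqI)
qed

lemma ic_image:
  assumes "c \<in> A" "W \<subseteq> cdom c"
  shows "cmap (ic c) ` {z. fst z \<in> W \<and> snd z \<in> T (fst z)} = (cmap c ` W) \<times> UNIV"
proof (intro equalityI subsetI)
  fix a assume "a \<in> (cmap c ` W) \<times> (UNIV :: 'e set)"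
  then obtain p y where p: "p \<in> W" "a = (cmap c p, y)" by auto
  then have "p \<in> cdom c" using assms by blast
  then show "a \<in> cmap (ic c) ` {z. fst z \<in> W \<and> snd z \<in> T (fst z)}"
    using p assms(1) by (intro image_eqI[of _ _ "(p, coord_vec A c p y)"]) (auto simp: coord_vec_self coord_vec_tangent)
qed auto

lemma ic_overlap: "cdom (ic c) \<inter> cdom (ic d) = {z. fst z \<in> cdom c \<inter> cdom d \<and> snd z \<in> T (fst z)}"
  by auto

lemma ic_image_overlap:
  "c \<in> A \<Longrightarrow> cmap (ic c) ` (cdom (ic c) \<inter> cdom (ic d)) = (cmap c ` (cdom c \<inter> cdom d)) \<times> UNIV"
  unfolding ic_overlap by (rule ic_image) auto

lemma transition_ic:
  assumes "c \<in> A" "d \<in> A" "x \<in> cmap c ` (cdom c \<inter> cdom d)"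
  shows "transition (ic c) (ic d) (x, y) = (transition c d x, fd (transition c d) x y)"
proof -
  obtain p where p: "p \<in> cdom c" "p \<in> cdom d" "x = cmap c p" using assms by auto
  have "cinv (ic c) (cmap (ic c) (p, coord_vec A c p y)) = (p, coord_vec A c p y)"
    unfolding cinv_def using assms p by (intro inv_into_f_f ic_inj) (auto simp: coord_vec_tangent)
  then have "cinv (ic c) (x, y) = (p, coord_vec A c p y)"
    using p assms by (simp add: coord_vec_self)
  then show ?thesis using p assms by (simp add: transition_def[of "ic c"] coord_vec_apply)
qed

lemma TM_smooth_atlas: "smooth_atlas (TM A)"
  unfolding smooth_atlas_def
proof (intro conjI ballI)
  fix C assume "C \<in> TM A"
  then obtain c where c: "c \<in> A" "C = ic c" by (auto simp: TM_def)
  show "inj_on (cmap C) (cdom C)" using c ic_inj by simp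
  show "open (cmap C ` cdom C)" using ic_image_overlap[of c c] open_chart c by (simp add: open_Times)
  fix D assume "D \<in> TM A"
  then obtain d where d: "d \<in> A" "D = ic d" by (auto simp: TM_def)
  have o: "open (cmap c ` (cdom c \<inter> cdom d))" using open_overlap c d by simp
  show oD: "open (cmap C ` (cdom C \<inter> cdom D))"
    unfolding c(2) d(2) ic_image_overlap[OF c(1)] using o by (simp add: open_Times)
  have s: "smooth_on (cmap c ` (cdom c \<inter> cdom d)) (transition c d)" using smooth_transition c d by simp
  have "smooth_on (cmap C ` (cdom C \<inter> cdom D))
      (\<lambda>z. (transition c d (fst z), fd (transition c d) (fst z) (snd z)))"
    unfolding c(2) d(2) ic_image_overlap[OF c(1)]
    by (intro smooth_on_Pair smooth_on_fst_compose smooth_on_fd_joint s o open_Times open_UNIV)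
  then show "smooth_on (cmap C ` (cdom C \<inter> cdom D)) (transition C D)"
  proof (rule smooth_on_cong[OF oD, rotated])
    fix z assume "z \<in> cmap C ` (cdom C \<inter> cdom D)"
    then show "(transition c d (fst z), fd (transition c d) (fst z) (snd z)) = transition C D z"
      unfolding c(2) d(2) ic_image_overlap[OF c(1)]
      using transition_ic[OF c(1) d(1), of "fst z" "snd z"] by auto
  qed
qed

text \<open>The second derivative of a coordinate change; the last argument is the inner direction of
  differentiation.\<close>

definition J2 :: "('a, 'e) chart \<Rightarrow> ('a, 'e) chart \<Rightarrow> 'a \<Rightarrow> 'e \<Rightarrow> 'e \<Rightarrow> 'e"
  where "J2 c d p u v = fd (\<lambda>x. fd (transition c d) x v) (cmap c p) u"

lemma J2_sym:
  assumes "c \<in> A" "d \<in> A" "p \<in> cdom c" "p \<in> cdom d"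
  shows "J2 c d p u v = J2 c d p v u"
  unfolding J2_def
  by (rule symmetric_second_derivative[OF open_overlap[OF assms(1,2)] smooth_transition[OF assms(1,2)]])
    (use assms in auto)

lemma J2_linear:
  assumes "c \<in> A" "d \<in> A" "p \<in> cdom c" "p \<in> cdom d"
  shows "linear (\<lambda>u. J2 c d p u v)"
  unfolding J2_def
  by (rule linear_frechet_derivative, rule smooth_on_differentiable[OF smooth_on_fd[OF smooth_transition[OF assms(1,2)]]
        open_overlap[OF assms(1,2)]]) (use assms in auto)

text \<open>The induced coordinate change is \<open>(x, y) \<mapsto> (\<phi> x, D\<phi>(x) y)\<close>. Its second component depends on \<open>x\<close>
  through \<open>D\<phi>(x)\<close>, whence the second derivative.\<close>

lemma J_ic_has_derivative:
  assumes "c \<in> A" "d \<in> A" "fst z \<in> cdom c" "fst z \<in> cdom d"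
  shows "(transition (ic c) (ic d) has_derivative
    (\<lambda>h. (J c d (fst z) (fst h), J2 c d (fst z) (fst h) (snd z c) + J c d (fst z) (snd h)))) (at (cmap (ic c) z))"
proof -
  let ?S = "cmap c ` (cdom c \<inter> cdom d)"
  have o: "open ?S" and s: "smooth_on ?S (transition c d)" and x: "cmap c (fst z) \<in> ?S"
    using open_overlap smooth_transition assms by auto
  have 1: "((\<lambda>a. transition c d (fst a)) has_derivative (\<lambda>h. J c d (fst z) (fst h))) (at (cmap (ic c) z))"
    using diff_chain_at[OF has_derivative_fst[OF has_derivative_ident, of "at (cmap (ic c) z)"], of "transition c d"]
      J_has_derivative[OF assms] by (simp add: o_def)
  have "((\<lambda>a. (transition c d (fst a), fd (transition c d) (fst a) (snd a))) has_derivative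
     (\<lambda>h. (J c d (fst z) (fst h), J2 c d (fst z) (fst h) (snd z c) + J c d (fst z) (snd h)))) (at (cmap (ic c) z))"
    unfolding J2_def using fd_joint_has_derivative[OF o s x, of "snd z c"]
    by (intro has_derivative_Pair 1) simp
  then show ?thesis
    by (rule has_derivative_transform_within_open[OF _ open_Times[OF o open_UNIV]])
      (use x transition_ic[OF assms(1,2)] in auto)
qed

end

text \<open>Vectors at different points are separated by preimages of open sets of the base, different vectors at
  the same point by their fibre coordinates.\<close>

lemma (in hausdorff_atlas) TM_Hausdorff: "Hausdorff_space (atlas_topology (TM A))"
proof -
  interpret TM: atlas "TM A" by unfold_locales (rule TM_smooth_atlas)
  have preimage_open: "TM.is_open {z. fst z \<in> U \<and> snd z \<in> T (fst z)}" if U: "is_open U" for U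
    unfolding TM.is_open_iff
  proof (intro conjI ballI)
    show "{z. fst z \<in> U \<and> snd z \<in> T (fst z)} \<subseteq> points (TM A)"
      using U is_open_iff by (auto simp: TM_points)
    fix C assume "C \<in> TM A"
    then obtain c where c: "c \<in> A" "C = ic c" by (auto simp: TM_def)
    have "{z. fst z \<in> U \<and> snd z \<in> T (fst z)} \<inter> cdom C = {z. fst z \<in> U \<inter> cdom c \<and> snd z \<in> T (fst z)}"
      using c by auto
    then show "open (cmap C ` ({z. fst z \<in> U \<and> snd z \<in> T (fst z)} \<inter> cdom C))"
      using ic_image[OF c(1), of "U \<inter> cdom c"] open_image[OF c(1) U] c by (simp add: open_Times)
  qed
  show ?thesis
    unfolding Hausdorff_space_def TM.topspace_atlas
  proof (intro allI impI, elim conjE)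
    fix z z' assume z: "z \<in> points (TM A)" "z' \<in> points (TM A)" "z \<noteq> z'"
    show "\<exists>U V. TM.is_open U \<and> TM.is_open V \<and> z \<in> U \<and> z' \<in> V \<and> disjnt U V"
    proof (cases "fst z = fst z'")
      case False
      then obtain U V where "is_open U" "is_open V" "fst z \<in> U" "fst z' \<in> V" "disjnt U V"
        using hausdorff z unfolding Hausdorff_space_def topspace_atlas TM_points by blast
      then show ?thesis
        using z by (intro exI[of _ "{z. fst z \<in> U \<and> snd z \<in> T (fst z)}"] exI[of _ "{z. fst z \<in> V \<and> snd z \<in> T (fst z)}"])
          (auto simp: TM_points disjnt_iff intro: preimage_open)
    next
      case True
      have "fst z \<in> points A" using z TM_points by blast
      then obtain c where c: "c \<in> A" "fst z \<in> cdom c" unfolding points_def by blast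
      have t: "snd z \<in> T (fst z)" "snd z' \<in> T (fst z)" "snd z \<noteq> snd z'"
        using z True by (auto simp: TM_points prod_eq_iff)
      then have "snd z c \<noteq> snd z' c" using tangent_eqI c by blast
      then obtain S S' where S: "open S" "open S'" "snd z c \<in> S" "snd z' c \<in> S'" "S \<inter> S' = {}"
        using separation_t2[of "snd z c" "snd z' c"] by blast
      have "TM.is_open {z \<in> cdom (ic c). cmap (ic c) z \<in> UNIV \<times> S}"
        "TM.is_open {z \<in> cdom (ic c). cmap (ic c) z \<in> UNIV \<times> S'}"
        using S c by (auto intro!: TM.is_open_coord ic_TM open_Times simp del: cmap_ic ic_mem)
      then show ?thesis
        using S c t True by (intro exI[of _ "{z \<in> cdom (ic c). cmap (ic c) z \<in> UNIV \<times> S}"]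
            exI[of _ "{z \<in> cdom (ic c). cmap (ic c) z \<in> UNIV \<times> S'}"]) (auto simp: disjnt_iff)
    qed
  qed
qed

section \<open>Linear algebra in coordinates\<close>

lemma matrix_inv_right:
  fixes m :: "real^'n^'n"
  assumes "invertible m"
  shows "m ** matrix_inv m = mat 1"
  using someI_ex[OF assms[unfolded invertible_def]] by (simp add: matrix_inv_def)

lemma vec_expansion: "(\<Sum>i\<in>UNIV. r i *\<^sub>R axis i (1::real)) = (\<chi> i. r i)"
  using basis_expansion[of "\<chi> i. r i"] by (simp add: scalar_mult_eq_scaleR)

lemma vec_expansion': "(\<Sum>i\<in>UNIV. v $ i *\<^sub>R axis i (1::real)) = v"
  using vec_expansion[of "\<lambda>i. v $ i"] by simp

lemma linear_eq_axis:
  fixes f h :: "real^'n \<Rightarrow> 'b::real_vector"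
  assumes "linear f" "linear h" "\<And>i. f (axis i 1) = h (axis i 1)"
  shows "f v = h v"
proof -
  have "f (\<Sum>i\<in>UNIV. v $ i *\<^sub>R axis i 1) = h (\<Sum>i\<in>UNIV. v $ i *\<^sub>R axis i 1)"
    by (simp add: linear_sum[OF assms(1)] linear_sum[OF assms(2)] linear_scale[OF assms(1)] linear_scale[OF assms(2)] assms(3))
  then show ?thesis by (simp only: vec_expansion')
qed

lemma bilinear_eq_axis:
  fixes f h :: "real^'n \<Rightarrow> real^'m \<Rightarrow> 'b::real_vector"
  assumes "\<And>u. linear (f u)" "\<And>v. linear (\<lambda>u. f u v)" "\<And>u. linear (h u)" "\<And>v. linear (\<lambda>u. h u v)"
    and "\<And>i j. f (axis i 1) (axis j 1) = h (axis i 1) (axis j 1)"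
  shows "f u v = h u v"
  by (rule linear_eq_axis[OF assms(2,4)], rule linear_eq_axis[OF assms(1,3,5)])

section \<open>The splitting defined by a nonlinear connection\<close>

locale nonlinear_connection_space = hausdorff_atlas A
  for A :: "('a, real^'n) chart set" +
  fixes H :: "('a, 'n) tm_distribution"
  assumes nlc: "nonlinear_connection A H"
begin

sublocale TM: hausdorff_atlas "TM A"
  by unfold_locales (rule TM_smooth_atlas, rule TM_Hausdorff)

lemma TM_pointsI: "c \<in> A \<Longrightarrow> z \<in> cdom (ic c) \<Longrightarrow> z \<in> points (TM A)"
  using ic_TM unfolding points_def by blast

lemma TM_J:
  assumes "c \<in> A" "d \<in> A" "z \<in> cdom (ic c)" "z \<in> cdom (ic d)"
  shows "TM.J (ic c) (ic d) z h =
    (J c d (fst z) (fst h), J2 c d (fst z) (fst h) (snd z c) + J c d (fst z) (snd h))"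
  using fd_eqI[OF J_ic_has_derivative[of c d z]] assms by simp

lemma TM_tangent_change:
  assumes "c \<in> A" "d \<in> A" "z \<in> cdom (ic c)" "z \<in> cdom (ic d)" "w \<in> TM.T z"
  shows "fst (w (ic d)) = J c d (fst z) (fst (w (ic c)))"
    and "snd (w (ic d)) = J2 c d (fst z) (fst (w (ic c))) (snd z c) + J c d (fst z) (snd (w (ic c)))"
  using TM.tangent_change[OF assms(5) ic_TM[OF assms(1)] ic_TM[OF assms(2)] assms(3,4)] TM_J[OF assms(1-4)]
  by simp_all

text \<open>In induced coordinates the bundle projection is \<open>(x, y) \<mapsto> x\<close>.\<close>

lemma vertical_iff:
  assumes "c \<in> A" "z \<in> cdom (ic c)" "w \<in> TM.T z"
  shows "w \<in> vertical A z \<longleftrightarrow> fst (w (ic c)) = 0"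
proof -
  obtain e where e: "e \<in> A" "chart_at (TM A) z = ic e" "z \<in> cdom (ic e)"
    using TM.chart_at[OF TM_pointsI[OF assms(1,2)]] unfolding TM_def by (metis imageE)
  have tm: "tangent_map (TM A) A fst z w d = fst (w (ic d))" if d: "d \<in> A" "fst z \<in> cdom d" for d
  proof -
    let ?S = "cmap e ` (cdom e \<inter> cdom d)"
    have zd: "z \<in> cdom (ic d)" using d e by simp
    have o: "open (?S \<times> (UNIV :: (real^'n) set))" using open_overlap e d by (simp add: open_Times)
    have "((\<lambda>a. transition e d (fst a)) has_derivative (\<lambda>h. J e d (fst z) (fst h))) (at (cmap (ic e) z))"
      using diff_chain_at[OF has_derivative_fst[OF has_derivative_ident, of "at (cmap (ic e) z)"], of "transition e d"]
        J_has_derivative[of e d "fst z"] e d by (simp add: o_def)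
    then have "(cmap d \<circ> fst \<circ> cinv (ic e) has_derivative (\<lambda>h. J e d (fst z) (fst h))) (at (cmap (ic e) z))"
    proof (rule has_derivative_transform_within_open[OF _ o])
      show "cmap (ic e) z \<in> ?S \<times> UNIV" using e d by auto
      fix a assume "a \<in> ?S \<times> (UNIV :: (real^'n) set)"
      then have "a \<in> cmap (ic e) ` (cdom (ic e) \<inter> cdom (ic d))" using ic_image_overlap[OF e(1)] by simp
      then obtain z' where z': "z' \<in> cdom (ic e)" "z' \<in> cdom (ic d)" "a = cmap (ic e) z'" by blast
      then have "cinv (ic e) a = z'" using TM.cinv_cmap[OF ic_TM[OF e(1)]] by blast
      then show "transition e d (fst a) = (cmap d \<circ> fst \<circ> cinv (ic e)) a" using z' e by simp
    qed
    from fd_eqI[OF this] have "tangent_map (TM A) A fst z w d = J e d (fst z) (fst (w (ic e)))"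
      using d e by (simp add: tangent_map_def Let_def)
    then show ?thesis using TM_tangent_change(1)[OF e(1) d(1) e(3) zd assms(3)] by simp
  qed
  have out: "tangent_map (TM A) A fst z w d = 0" if "\<not> (d \<in> A \<and> fst z \<in> cdom d)" for d
    using that by (auto simp: tangent_map_def Let_def)
  show ?thesis
  proof
    assume "w \<in> vertical A z"
    then have "tangent_map (TM A) A fst z w = 0" by (simp add: vertical_def)
    then show "fst (w (ic c)) = 0" using tm[OF assms(1)] assms(2) by simp
  next
    assume 0: "fst (w (ic c)) = 0"
    have "tangent_map (TM A) A fst z w d = 0" for d
    proof (cases "d \<in> A \<and> fst z \<in> cdom d")
      case True
      then have d: "d \<in> A" "fst z \<in> cdom d" "z \<in> cdom (ic d)" using assms by auto
      then show ?thesis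
        using tm[OF d(1,2)] TM_tangent_change(1)[OF assms(1) d(1) assms(2) d(3) assms(3)] 0
          linear_0[OF J_linear[of c d "fst z"]] assms by simp
    qed (rule out)
    then show "w \<in> vertical A z" using assms by (simp add: vertical_def fun_eq_iff)
  qed
qed

context
  fixes z assumes z: "z \<in> points (TM A)"
begin

lemma subspace_H: "subspace (H z)"
proof -
  obtain k where "smooth_distribution (TM A) k H" using nlc unfolding nonlinear_connection_def by blast
  then obtain X where "H z = span ((\<lambda>i. X i z) ` {..<k})"
    using z unfolding smooth_distribution_def by meson
  then show ?thesis by simp
qed

lemma splitting: "H z \<inter> vertical A z = {0} \<and> {h + v |h v. h \<in> H z \<and> v \<in> vertical A z} = TM.T z"
  by (rule bspec[OF conjunct2[OF nlc[unfolded nonlinear_connection_def]] z])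

lemma H_Int_vertical: "H z \<inter> vertical A z = {0}"
  using splitting by (rule conjunct1)

lemma H_sum_vertical: "w \<in> TM.T z \<longleftrightarrow> (\<exists>h\<in>H z. \<exists>v\<in>vertical A z. w = h + v)"
proof -
  have "TM.T z = {h + v |h v. h \<in> H z \<and> v \<in> vertical A z}"
    using splitting by (rule conjunct2[THEN sym])
  then show ?thesis by auto
qed

lemma H_tangent: "h \<in> H z \<Longrightarrow> h \<in> TM.T z"
proof -
  assume h: "h \<in> H z"
  have "0 \<in> vertical A z" using H_Int_vertical by blast
  moreover have "h = h + 0" by simp
  ultimately show "h \<in> TM.T z" using H_sum_vertical h by blast
qed

end

context
  fixes c z assumes c: "c \<in> A" and z: "z \<in> cdom (ic c)"
begin

lemma H_eq_0: "h \<in> H z \<Longrightarrow> fst (h (ic c)) = 0 \<Longrightarrow> h = 0"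
  using H_Int_vertical[OF TM_pointsI[OF c z]] H_tangent[OF TM_pointsI[OF c z]] vertical_iff[OF c z] by blast

lemma H_lift: obtains h where "h \<in> H z" "fst (h (ic c)) = u"
proof -
  let ?w = "coord_vec (TM A) (ic c) z (u, 0)"
  have "?w \<in> TM.T z" by (rule TM.coord_vec_tangent[OF ic_TM[OF c] z])
  then obtain h v where hv: "h \<in> H z" "v \<in> vertical A z" "?w = h + v"
    using H_sum_vertical[OF TM_pointsI[OF c z]] by blast
  have "v \<in> TM.T z" using hv(2) by (simp add: vertical_def)
  then have "fst (v (ic c)) = 0" using vertical_iff[OF c z] hv(2) by blast
  moreover have "?w (ic c) = (u, 0)" by (rule TM.coord_vec_self[OF ic_TM[OF c] z])
  then have "h (ic c) + v (ic c) = (u, 0)" using hv(3) by (simp add: fun_eq_iff)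
  ultimately have "fst (h (ic c)) = u" by (metis add.right_neutral fst_add fst_conv)
  then show ?thesis using hv(1) that by blast
qed

lemma dx_self: "dx A c i z (ic c) = (axis i 1, 0)"
  unfolding dx_def by (rule TM.coord_vec_self[OF ic_TM[OF c] z])

lemma dy_self: "dy A c i z (ic c) = (0, axis i 1)"
  unfolding dy_def by (rule TM.coord_vec_self[OF ic_TM[OF c] z])

lemma dx_tangent: "dx A c i z \<in> TM.T z"
  unfolding dx_def by (rule TM.coord_vec_tangent[OF ic_TM[OF c] z])

lemma dy_tangent: "dy A c i z \<in> TM.T z"
  unfolding dy_def by (rule TM.coord_vec_tangent[OF ic_TM[OF c] z])

lemma adapted_tangent: "dx A c i z - (\<Sum>j\<in>UNIV. r j *\<^sub>R dy A c j z) \<in> TM.T z"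
  by (intro TM.tangent_diff TM.tangent_sum TM.tangent_scale dx_tangent dy_tangent)

lemma adapted_self: "(dx A c i z - (\<Sum>j\<in>UNIV. r $ j *\<^sub>R dy A c j z)) (ic c) = (axis i 1, - r)"
proof -
  have "(\<Sum>j\<in>UNIV. r $ j *\<^sub>R axis j 1) = r" using basis_expansion[of r] by (simp add: scalar_mult_eq_scaleR)
  then have "(\<Sum>j\<in>UNIV. r $ j *\<^sub>R dy A c j z) (ic c) = (0, r)"
    unfolding sum_fun_apply by (simp add: scaleR_fun_def dy_self prod_eq_iff fst_sum snd_sum)
  then show ?thesis by (simp add: dx_self)
qed

text \<open>Over every coordinate vector of the base there is exactly one vector of \<open>H\<close>: there is one because
  vertical vectors do not contribute to the projection, and two of them differ by a vertical vector of
  \<open>H\<close>. The rows of the coefficient matrix are the fibre components of these vectors, up to sign.\<close>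

lemma nlc_coeff_adapted: "dx A c i z - (\<Sum>j\<in>UNIV. nlc_coeff A H c z $ i $ j *\<^sub>R dy A c j z) \<in> H z"
proof -
  have "\<exists>h. h \<in> H z \<and> fst (h (ic c)) = axis i 1" for i by (rule H_lift[of "axis i 1"]) blast
  then obtain h where h: "\<And>i. h i \<in> H z" "\<And>i. fst (h i (ic c)) = axis i 1" by metis
  define M where "M = (\<chi> i. - snd (h i (ic c)))"
  have hM: "dx A c i z - (\<Sum>j\<in>UNIV. M $ i $ j *\<^sub>R dy A c j z) = h i" for i
    by (rule TM.tangent_eqI[OF adapted_tangent H_tangent[OF TM_pointsI[OF c z] h(1)] ic_TM[OF c] z])
      (unfold adapted_self[of i "M $ i"], simp add: h(2) M_def prod_eq_iff)
  have "M' = M" if "\<forall>i. dx A c i z - (\<Sum>j\<in>UNIV. M' $ i $ j *\<^sub>R dy A c j z) \<in> H z" for M'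
  proof -
    have "M' $ i = M $ i" for i
    proof -
      let ?d = "(dx A c i z - (\<Sum>j\<in>UNIV. M' $ i $ j *\<^sub>R dy A c j z)) - h i"
      have "?d \<in> H z" using that h(1) subspace_diff[OF subspace_H[OF TM_pointsI[OF c z]]] by blast
      moreover have "?d (ic c) = (axis i 1, - (M' $ i)) - h i (ic c)"
        using adapted_self[of i "M' $ i"] by simp
      ultimately have "?d = 0" by (intro H_eq_0) (simp_all only: h(2) fst_diff fst_conv diff_self)
      then have "?d (ic c) = 0" by (simp only: zero_fun_apply)
      then have "(axis i 1, - (M' $ i)) - h i (ic c) = 0"
        using adapted_self[of i "M' $ i"] by simp
      then have "(axis i 1, - (M' $ i)) = h i (ic c)" by simp
      from arg_cong[OF this, of snd] have "- (M' $ i) = snd (h i (ic c))" by simp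
      from iffD1[OF minus_equation_iff this] show ?thesis by (simp add: M_def)
    qed
    then show ?thesis by (simp add: vec_eq_iff)
  qed
  then have "nlc_coeff A H c z = M"
    unfolding nlc_coeff_def using hM h(1) by (intro the_equality) auto
  then show ?thesis using hM h(1) by simp
qed

lemma delta_H: "delta A H c i z \<in> H z"
  unfolding delta_def by (rule nlc_coeff_adapted)

lemma delta_self: "delta A H c i z (ic c) = (axis i 1, - (nlc_coeff A H c z $ i))"
  unfolding delta_def by (rule adapted_self)

lemma delta_tangent: "delta A H c i z \<in> TM.T z"
  by (rule H_tangent[OF TM_pointsI[OF c z] delta_H])

end

text \<open>The coefficients as a linear map, acting on the lower index. Below, \<open>hor\<close> and \<open>ver\<close> are the
  components of a vector with respect to the adapted frame.\<close>

definition Nmap :: "('a, real^'n) chart \<Rightarrow> ('a, real^'n) tpoint \<Rightarrow> real^'n \<Rightarrow> real^'n"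
  where "Nmap c z u = (\<Sum>i\<in>UNIV. u $ i *\<^sub>R nlc_coeff A H c z $ i)"

definition hor :: "('a, real^'n) chart \<Rightarrow> (('a, real^'n) tpoint, (real^'n) \<times> (real^'n)) tvec \<Rightarrow> real^'n"
  where "hor c w = fst (w (ic c))"

definition ver :: "('a, real^'n) chart \<Rightarrow> ('a, real^'n) tpoint \<Rightarrow>
    (('a, real^'n) tpoint, (real^'n) \<times> (real^'n)) tvec \<Rightarrow> real^'n"
  where "ver c z w = snd (w (ic c)) + Nmap c z (hor c w)"

lemma Nmap_linear: "linear (Nmap c z)"
  by (intro linearI) (simp_all add: Nmap_def scaleR_left_distrib sum.distrib scaleR_sum_right)

lemma Nmap_axis: "Nmap c z (axis i 1) = nlc_coeff A H c z $ i"
  by (simp add: Nmap_def axis_def if_distrib[of "\<lambda>r. r *\<^sub>R _"] cong: if_cong)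

lemma hor_add [simp]: "hor c (v + w) = hor c v + hor c w"
  by (simp add: hor_def)

lemma hor_scale [simp]: "hor c (r *\<^sub>R w) = r *\<^sub>R hor c w"
  by (simp add: hor_def scaleR_fun_def)

lemma ver_add [simp]: "ver c z (v + w) = ver c z v + ver c z w"
  by (simp add: ver_def linear_add[OF Nmap_linear])

lemma ver_scale [simp]: "ver c z (r *\<^sub>R w) = r *\<^sub>R ver c z w"
  by (simp add: ver_def linear_scale[OF Nmap_linear]) (simp add: scaleR_fun_def scaleR_add_right)

lemma hor_linear: "linear (hor c)"
  by (intro linearI) simp_all

lemma ver_linear: "linear (ver c z)"
  by (intro linearI) simp_all

lemma hor_ver_eqI:
  assumes "c \<in> A" "z \<in> cdom (ic c)" "v \<in> TM.T z" "w \<in> TM.T z" "hor c v = hor c w" "ver c z v = ver c z w"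
  shows "v = w"
proof (rule TM.tangent_eqI[OF assms(3,4) ic_TM[OF assms(1)] assms(2)])
  have "fst (v (ic c)) = fst (w (ic c))" using assms(5) by (simp only: hor_def)
  moreover have "snd (v (ic c)) = snd (w (ic c))" using assms(6) unfolding ver_def assms(5) by simp
  ultimately show "v (ic c) = w (ic c)" by (rule prod_eqI)
qed

context
  fixes c z assumes c: "c \<in> A" and z: "z \<in> cdom (ic c)"
begin

lemma hor_delta: "hor c (delta A H c i z) = axis i 1"
  by (simp add: hor_def delta_self[OF c z])

lemma ver_delta: "ver c z (delta A H c i z) = 0"
  by (simp add: ver_def hor_delta Nmap_axis delta_self[OF c z])

lemma hor_dy: "hor c (dy A c i z) = 0"
  by (simp add: hor_def dy_self[OF c z])

lemma ver_dy: "ver c z (dy A c i z) = axis i 1"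
  by (simp add: ver_def hor_dy linear_0[OF Nmap_linear] dy_self[OF c z])

lemma H_iff_ver:
  assumes "w \<in> TM.T z"
  shows "w \<in> H z \<longleftrightarrow> ver c z w = 0"
proof -
  define h where "h = (\<Sum>i\<in>UNIV. hor c w $ i *\<^sub>R delta A H c i z)"
  have hH: "h \<in> H z"
    unfolding h_def using subspace_H[OF TM_pointsI[OF c z]] delta_H[OF c z]
    by (intro subspace_sum subspace_scale)
  have hT: "h \<in> TM.T z" by (rule H_tangent[OF TM_pointsI[OF c z] hH])
  have hor_h: "hor c h = hor c w"
    using basis_expansion[of "hor c w"]
    by (simp add: h_def linear_sum[OF hor_linear] hor_delta scalar_mult_eq_scaleR)
  have ver_h: "ver c z h = 0"
    by (simp add: h_def linear_sum[OF ver_linear] ver_delta)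
  show ?thesis
  proof
    assume "w \<in> H z"
    then have "w - h \<in> H z" using hH subspace_diff[OF subspace_H[OF TM_pointsI[OF c z]]] by blast
    moreover have "fst ((w - h) (ic c)) = 0" using hor_h by (simp add: hor_def)
    ultimately have "w - h = 0" by (rule H_eq_0[OF c z])
    then show "ver c z w = 0" using ver_h by simp
  next
    assume "ver c z w = 0"
    then have "w = h" using hor_h ver_h by (intro hor_ver_eqI[OF c z assms hT]) simp_all
    then show "w \<in> H z" using hH by simp
  qed
qed

end

lemma hor_change:
  assumes "c \<in> A" "d \<in> A" "z \<in> cdom (ic c)" "z \<in> cdom (ic d)" "w \<in> TM.T z"
  shows "hor d w = J c d (fst z) (hor c w)"
  unfolding hor_def by (rule TM_tangent_change(1)[OF assms])

text \<open>Split \<open>w\<close> into the vector of \<open>H\<close> with the same projection and a vertical rest. The former has no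
  vertical component in any chart, and the latter is transformed by the Jacobian alone.\<close>

lemma ver_change:
  assumes "c \<in> A" "d \<in> A" "z \<in> cdom (ic c)" "z \<in> cdom (ic d)" "w \<in> TM.T z"
  shows "ver d z w = J c d (fst z) (ver c z w)"
proof -
  \<comment> \<open>The vector of \<open>H\<close> with the same projection as \<open>w\<close>.\<close>
  let ?w = "coord_vec (TM A) (ic c) z (hor c w, - Nmap c z (hor c w))"
  have T': "?w \<in> TM.T z" by (rule TM.coord_vec_tangent[OF ic_TM[OF assms(1)] assms(3)])
  have self: "?w (ic c) = (hor c w, - Nmap c z (hor c w))"
    by (rule TM.coord_vec_self[OF ic_TM[OF assms(1)] assms(3)])
  have v0: "ver c z ?w = 0" using self by (simp add: ver_def hor_def)
  then have "?w \<in> H z" using H_iff_ver[OF assms(1,3) T'] by blast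
  then have v0': "ver d z ?w = 0" using H_iff_ver[OF assms(2,4) T'] by blast
  have T'': "w - ?w \<in> TM.T z" by (rule TM.tangent_diff[OF assms(5) T'])
  have p: "fst z \<in> cdom c" "fst z \<in> cdom d" using assms by simp_all
  have Jl: "linear (J c d (fst z))" by (rule J_linear[OF assms(1,2) p])
  have 0: "hor c (w - ?w) = 0" using self by (simp add: hor_def)
  have J20: "J2 c d (fst z) 0 y = 0" for y
    by (rule linear_0[OF J2_linear[OF assms(1,2) p]])
  have "hor d (w - ?w) = 0" using hor_change[OF assms(1-4) T''] 0 linear_0[OF Jl] by simp
  then have "ver d z (w - ?w) = snd ((w - ?w) (ic d))" by (simp add: ver_def linear_0[OF Nmap_linear])
  also have "\<dots> = J c d (fst z) (snd ((w - ?w) (ic c)))"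
    using TM_tangent_change(2)[OF assms(1-4) T''] 0 J20 by (simp add: hor_def)
  also have "snd ((w - ?w) (ic c)) = ver c z (w - ?w)" using 0 by (simp add: ver_def linear_0[OF Nmap_linear])
  finally show ?thesis
    unfolding linear_diff[OF ver_linear] v0 v0' by simp
qed

text \<open>Horizontal and vertical components of a vector obey the same laws; the first argument selects one of
  them so that both cases can be treated at once.\<close>

definition adp :: "bool \<Rightarrow> ('a, real^'n) chart \<Rightarrow> ('a, real^'n) tpoint \<Rightarrow>
    (('a, real^'n) tpoint, (real^'n) \<times> (real^'n)) tvec \<Rightarrow> real^'n"
  where "adp h c z w = (if h then hor c w else ver c z w)"

lemma adp_linear: "linear (adp h c z)"
  by (cases h) (simp_all add: adp_def[abs_def] hor_linear ver_linear)

lemma adp_eqI: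
  assumes "c \<in> A" "z \<in> cdom (ic c)" "v \<in> TM.T z" "w \<in> TM.T z" "\<And>h. adp h c z v = adp h c z w"
  shows "v = w"
  using hor_ver_eqI[OF assms(1-4)] assms(5)[of True] assms(5)[of False] by (simp add: adp_def)

lemma adp_change:
  assumes "c \<in> A" "d \<in> A" "z \<in> cdom (ic c)" "z \<in> cdom (ic d)" "w \<in> TM.T z"
  shows "adp h d z w = J c d (fst z) (adp h c z w)"
  unfolding adp_def using hor_change[OF assms] ver_change[OF assms] by simp

lemma adp_frame:
  assumes "c \<in> A" "z \<in> cdom (ic c)"
  shows "adp h c z (delta A H c i z) = (if h then axis i 1 else 0)"
    and "adp h c z (dy A c i z) = (if h then 0 else axis i 1)"
  by (simp_all add: adp_def hor_delta[OF assms] ver_delta[OF assms] hor_dy[OF assms] ver_dy[OF assms])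

text \<open>Let \<open>a\<close> and \<open>b\<close> be the two components of a local frame \<open>X\<close> of \<open>H\<close>. The vectors \<open>a l\<close> span
  \<open>\<real>\<^sup>n\<close>, so their Gram type matrix \<open>P = \<Sum>l. a l (a l)\<^sup>T\<close> is regular. If \<open>P s = e\<^sub>i\<close> then
  \<open>\<Sum>l. (a l \<bullet> s) X l\<close> is the vector of \<open>H\<close> above \<open>e\<^sub>i\<close>, and its fibre component is smooth together with
  \<open>s\<close>. The matrix \<open>P\<close> is square whatever the number of the frame fields.\<close>

lemma smooth_on_nlc_coeff:
  assumes c: "c \<in> A"
  shows "smooth_on (cmap (ic c) ` cdom (ic c)) (\<lambda>x. nlc_coeff A H c (cinv (ic c) x) $ i)"
proof (rule smooth_on_local)
  show "open (cmap (ic c) ` cdom (ic c))" by (rule TM.open_chart[OF ic_TM[OF c]])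
  fix x assume "x \<in> cmap (ic c) ` cdom (ic c)"
  then obtain z0 where z0: "z0 \<in> cdom (ic c)" "x = cmap (ic c) z0" by blast
  obtain k where "smooth_distribution (TM A) k H" using nlc unfolding nonlinear_connection_def by blast
  from bspec[OF this[unfolded smooth_distribution_def] TM_pointsI[OF c z0(1)]]
  obtain U X where UX: "TM.is_open U \<and> z0 \<in> U \<and> (\<forall>l<k. smooth_vf_on (TM A) U (X l)) \<and>
    (\<forall>q\<in>U. H q = span ((\<lambda>l. X l q) ` {..<k}) \<and> dim (H q) = k)" by (elim exE) (rule that)
  have U: "TM.is_open U" "z0 \<in> U" "\<And>l. l < k \<Longrightarrow> smooth_vf_on (TM A) U (X l)"
    "\<And>q. q \<in> U \<Longrightarrow> H q = span ((\<lambda>l. X l q) ` {..<k})"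
    using UX by simp_all
  define W where "W = U \<inter> cdom (ic c)"
  have W: "open (cmap (ic c) ` W)" unfolding W_def by (rule TM.open_image[OF ic_TM[OF c] U(1)])
  define a where "a l x = fst (X l (cinv (ic c) x) (ic c))" for l x
  define b where "b l x = snd (X l (cinv (ic c) x) (ic c))" for l x
  have sX: "smooth_on (cmap (ic c) ` W) (\<lambda>x. X l (cinv (ic c) x) (ic c))" if "l < k" for l
    unfolding W_def by (rule TM.smooth_vf_onD[OF U(3)[OF that] ic_TM[OF c]])
  have sa: "smooth_on (cmap (ic c) ` W) (a l)" if "l < k" for l
    using smooth_on_fst[OF W sX[OF that]] unfolding a_def .
  have sb: "smooth_on (cmap (ic c) ` W) (b l)" if "l < k" for l
    using smooth_on_snd[OF W sX[OF that]] unfolding b_def .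
  define P where "P x = (\<chi> i j. \<Sum>l<k. a l x $ i * a l x $ j)" for x
  define s where "s x = matrix_inv (P x) *v axis i 1" for x
  have P_mult: "P x *v w = (\<Sum>l<k. (a l x \<bullet> w) *\<^sub>R a l x)" for x w
    by (simp add: P_def vec_eq_iff matrix_vector_mult_def inner_vec_def sum_distrib_left sum_distrib_right
        sum.swap[of _ "{..<k}"] algebra_simps)
  have regular: "invertible (P x)" and horizontal: "nlc_coeff A H c (cinv (ic c) x) $ i = - (\<Sum>l<k. (a l x \<bullet> s x) *\<^sub>R b l x)"
    if x: "x \<in> cmap (ic c) ` W" for x
  proof -
    obtain z where z: "z \<in> U" "z \<in> cdom (ic c)" "x = cmap (ic c) z" using x unfolding W_def by blast
    then have xz: "cinv (ic c) x = z" using TM.cinv_cmap[OF ic_TM[OF c]] by blast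
    have Xz: "X l z (ic c) = (a l x, b l x)" for l by (simp add: a_def b_def xz)
    have ker: "w = 0" if "P x *v w = 0" for w
    proof -
      have "0 = w \<bullet> (P x *v w)" using that by simp
      also have "\<dots> = (\<Sum>l<k. (a l x \<bullet> w)\<^sup>2)"
        unfolding P_mult by (simp add: inner_sum_right power2_eq_square inner_commute)
      finally have 0: "\<forall>l<k. a l x \<bullet> w = 0" by (simp add: sum_nonneg_eq_0_iff eq_commute[of 0])
      have perp: "fst (h (ic c)) \<bullet> w = 0" if "h \<in> H z" for h
      proof -
        have "subspace {h. fst (h (ic c)) \<bullet> w = 0}"
          by (auto simp: subspace_def inner_add_left scaleR_fun_def)
        moreover have "(\<lambda>l. X l z) ` {..<k} \<subseteq> {h. fst (h (ic c)) \<bullet> w = 0}" using 0 Xz by auto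
        ultimately have "span ((\<lambda>l. X l z) ` {..<k}) \<subseteq> {h. fst (h (ic c)) \<bullet> w = 0}"
          by (rule span_minimal[rotated])
        then show ?thesis using that U(4)[OF z(1)] by blast
      qed
      obtain h where "h \<in> H z" "fst (h (ic c)) = w" by (rule H_lift[OF c z(2)])
      then show "w = 0" using perp[of h] by simp
    qed
    then obtain B where "B ** P x = mat 1" using matrix_left_invertible_ker by blast
    then show inv: "invertible (P x)" using invertible_left_inverse by blast
    have Ps: "P x *v s x = axis i 1"
      unfolding s_def by (simp add: matrix_vector_mul_assoc matrix_inv_right[OF inv])
    let ?h = "\<Sum>l<k. (a l x \<bullet> s x) *\<^sub>R X l z"
    have hH: "?h \<in> H z" unfolding U(4)[OF z(1)] by (intro span_sum span_scale span_base) auto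
    have h: "?h (ic c) = (axis i 1, \<Sum>l<k. (a l x \<bullet> s x) *\<^sub>R b l x)"
      unfolding sum_fun_apply using Ps unfolding P_mult
      by (simp add: scaleR_fun_def Xz prod_eq_iff fst_sum snd_sum)
    have "ver c z ?h = 0" using H_iff_ver[OF c z(2) H_tangent[OF TM_pointsI[OF c z(2)] hH]] hH by blast
    then show "nlc_coeff A H c (cinv (ic c) x) $ i = - (\<Sum>l<k. (a l x \<bullet> s x) *\<^sub>R b l x)"
      unfolding ver_def hor_def h by (simp add: Nmap_axis xz add_eq_0_iff)
  qed
  have "smooth_on (cmap (ic c) ` W) s"
  proof (rule smooth_on_solution[OF W])
    show "smooth_on (cmap (ic c) ` W) (\<lambda>x. P x $ i $ j)" for i j
      unfolding P_def vec_lambda_beta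
      by (intro smooth_on_sum smooth_on_mult smooth_on_nth W sa) (simp_all only: lessThan_iff)
    show "smooth_on (cmap (ic c) ` W) (\<lambda>x. axis i 1 $ j)" for j by (rule smooth_on_const)
    show "det (P x) \<noteq> 0" if "x \<in> cmap (ic c) ` W" for x
      using regular[OF that] invertible_det_nz by blast
    show "P x *v s x = axis i 1" if "x \<in> cmap (ic c) ` W" for x
      unfolding s_def by (simp add: matrix_vector_mul_assoc matrix_inv_right[OF regular[OF that]])
  qed
  then have "smooth_on (cmap (ic c) ` W) (\<lambda>x. - (\<Sum>l<k. (a l x \<bullet> s x) *\<^sub>R b l x))"
    by (intro smooth_on_minus smooth_on_sum smooth_on_scaleR smooth_on_inner W sa sb) (simp_all only: lessThan_iff)
  then have "smooth_on (cmap (ic c) ` W) (\<lambda>x. nlc_coeff A H c (cinv (ic c) x) $ i)"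
    by (rule smooth_on_cong[OF W, rotated]) (simp add: horizontal)
  then show "\<exists>S. open S \<and> x \<in> S \<and> smooth_on S (\<lambda>x. nlc_coeff A H c (cinv (ic c) x) $ i)"
    using W z0 U by (intro exI[of _ "cmap (ic c) ` W"]) (auto simp: W_def simp del: cmap_ic)
qed

lemma smooth_vf_delta:
  assumes c: "c \<in> A"
  shows "smooth_vf_on (TM A) (cdom (ic c)) (delta A H c i)"
proof (rule TM.smooth_vf_onI_chart[OF ic_TM[OF c] TM.is_open_cdom[OF ic_TM[OF c]] order_refl])
  let ?S = "cmap (ic c) ` cdom (ic c)"
  have o: "open ?S" by (rule TM.open_chart[OF ic_TM[OF c]])
  have "smooth_on ?S (\<lambda>x. (axis i 1, - (nlc_coeff A H c (cinv (ic c) x) $ i)))"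
    by (intro smooth_on_Pair o smooth_on_const smooth_on_minus smooth_on_nlc_coeff c)
  then show "smooth_on ?S (\<lambda>x. delta A H c i (cinv (ic c) x) (ic c))"
  proof (rule smooth_on_cong[OF o, rotated])
    fix x assume "x \<in> ?S"
    then obtain z where z: "z \<in> cdom (ic c)" "x = cmap (ic c) z" by blast
    then have "cinv (ic c) x = z" using TM.cinv_cmap[OF ic_TM[OF c]] by blast
    then show "(axis i 1, - (nlc_coeff A H c (cinv (ic c) x) $ i)) = delta A H c i (cinv (ic c) x) (ic c)"
      using delta_self[OF c z(1)] by simp
  qed
qed (rule delta_tangent[OF c])

lemma smooth_vf_dy:
  assumes c: "c \<in> A"
  shows "smooth_vf_on (TM A) (cdom (ic c)) (dy A c i)"
proof (rule TM.smooth_vf_onI_chart[OF ic_TM[OF c] TM.is_open_cdom[OF ic_TM[OF c]] order_refl])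
  let ?S = "cmap (ic c) ` cdom (ic c)"
  have o: "open ?S" by (rule TM.open_chart[OF ic_TM[OF c]])
  show "smooth_on ?S (\<lambda>x. dy A c i (cinv (ic c) x) (ic c))"
  proof (rule smooth_on_cong[OF o _ smooth_on_const])
    fix x assume "x \<in> ?S"
    then obtain z where z: "z \<in> cdom (ic c)" "x = cmap (ic c) z" by blast
    then have "cinv (ic c) x = z" using TM.cinv_cmap[OF ic_TM[OF c]] by blast
    then show "(0, axis i 1) = dy A c i (cinv (ic c) x) (ic c)" using dy_self[OF c z(1)] by simp
  qed
qed (rule dy_tangent[OF c])

end

section \<open>Christoffel's construction\<close>

text \<open>The bilinear form of a matrix; equations between components become equations between forms.\<close>

definition mform :: "real^'n^'n \<Rightarrow> real^'n \<Rightarrow> real^'n \<Rightarrow> real"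
  where "mform m v w = v \<bullet> (m *v w)"

lemma mform_sum: "mform m v w = (\<Sum>i\<in>UNIV. \<Sum>j\<in>UNIV. v $ i * m $ i $ j * w $ j)"
  by (simp add: mform_def inner_vec_def matrix_vector_mult_def sum_distrib_left mult.assoc)

lemma mform_add_left: "mform m (u + v) w = mform m u w + mform m v w"
  by (simp add: mform_def inner_add_left)

lemma mform_add_right: "mform m u (v + w) = mform m u v + mform m u w"
  by (simp add: mform_def inner_add_right matrix_vector_right_distrib)

lemma mform_scale_left: "mform m (r *\<^sub>R v) w = r * mform m v w"
  by (simp add: mform_def)

lemma mform_scale_right: "mform m v (r *\<^sub>R w) = r * mform m v w"
  by (simp add: mform_def matrix_vector_mult_scaleR)

lemma mform_sum_left: "mform m (\<Sum>i\<in>I. f i) w = (\<Sum>i\<in>I. mform m (f i) w)"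
  by (simp add: mform_def inner_sum_left)

lemma mform_sum_right: "mform m v (\<Sum>i\<in>I. f i) = (\<Sum>i\<in>I. mform m v (f i))"
  by (simp add: mform_def linear_sum[OF matrix_vector_mul_linear] inner_sum_right)

lemma mform_axis: "mform m (axis i 1) (axis j 1) = m $ i $ j"
  by (simp add: mform_def inner_axis' matrix_vector_mult_basis column_def)

lemma mform_linear_left: "linear (\<lambda>v. mform m v w)"
  by (intro linearI) (simp_all add: mform_add_left mform_scale_left)

lemma mform_linear_right: "linear (mform m v)"
  by (intro linearI) (simp_all add: mform_add_right mform_scale_right)

lemma mform_axis_left: "mform m (axis j 1) x = (\<Sum>a\<in>UNIV. m $ j $ a * x $ a)"
  by (simp add: mform_def inner_axis' matrix_vector_mult_def)

lemma mform_axis_right: "mform m x (axis k 1) = (\<Sum>a\<in>UNIV. m $ a $ k * x $ a)"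
  by (simp add: mform_def inner_vec_def matrix_vector_mult_basis column_def mult.commute)

lemma mform_sym:
  assumes "transpose m = m"
  shows "mform m v w = mform m w v"
proof -
  have "m $ i $ j = m $ j $ i" for i j using assms by (metis transpose_def vec_lambda_beta)
  then show ?thesis unfolding mform_sum by (subst sum.swap) (simp add: mult.commute mult.left_commute)
qed

lemma mform_scaleR_matrix: "mform (r *\<^sub>R m) v w = r * mform m v w"
  by (simp add: mform_sum sum_distrib_left algebra_simps)

lemma mform_nondegenerate:
  assumes "transpose m = m" "det m \<noteq> 0" "\<And>w. mform m u w = mform m v w"
  shows "u = v"
proof -
  have "w \<bullet> (m *v u) = w \<bullet> (m *v v)" for w
    using assms(3)[of w] mform_sym[OF assms(1)] unfolding mform_def[symmetric] by metis
  then have "m *v u = m *v v" by (metis vector_eq_rdot inner_commute)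
  then show ?thesis
    using assms(2) inj_matrix_vector_mult[of m] invertible_det_nz[of m] by (metis injD)
qed

definition koszul :: "('v \<Rightarrow> 'v \<Rightarrow> 'v \<Rightarrow> real) \<Rightarrow> 'v \<Rightarrow> 'v \<Rightarrow> 'v \<Rightarrow> real"
  where "koszul t u v w = (t u v w + t v u w - t w u v) / 2"

definition christoffel :: "real^'n^'n \<Rightarrow> (real^'n \<Rightarrow> real^'n \<Rightarrow> real^'n \<Rightarrow> real) \<Rightarrow> real^'n \<Rightarrow> real^'n \<Rightarrow> real^'n"
  where "christoffel m t u v = matrix_inv m *v (\<chi> a. koszul t u v (axis a 1))"

text \<open>Here \<open>m\<close> is the metric at one point, and \<open>t u v w\<close> is what the two terms with the connection
  coefficients in its covariant derivative have to add up to. For the Levi-Civita connection this would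
  be the derivative of the coefficient functions of the metric in direction \<open>u\<close>.\<close>

locale christoffel_data =
  fixes m :: "real^'n^'n" and t :: "real^'n \<Rightarrow> real^'n \<Rightarrow> real^'n \<Rightarrow> real"
  assumes sym: "transpose m = m" and nondeg: "det m \<noteq> 0"
    and lin1: "\<And>v w. linear (\<lambda>u. t u v w)" and lin2: "\<And>u w. linear (\<lambda>v. t u v w)"
    and t_sym: "\<And>u v w. t u v w = t u w v"
begin

lemma lin3: "linear (\<lambda>w. t u v w)"
  using lin2[of u v] t_sym by simp

lemma koszul_lin3: "linear (koszul t u v)"
proof -
  have "linear (\<lambda>w. (1/2) *\<^sub>R (t u v w + t v u w - t w u v))"
    by (intro linear_compose_scale_right linear_compose_sub linear_compose_add lin1 lin3)
  moreover have "koszul t u v = (\<lambda>w. (1/2) *\<^sub>R (t u v w + t v u w - t w u v))"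
    by (rule ext) (simp add: koszul_def)
  ultimately show ?thesis by simp
qed

lemma christoffel_system: "m *v christoffel m t u v = (\<chi> a. koszul t u v (axis a 1))"
  using nondeg by (simp add: christoffel_def matrix_vector_mul_assoc matrix_inv_right invertible_det_nz)

lemma mform_christoffel: "mform m (christoffel m t u v) w = koszul t u v w"
proof -
  have "mform m (christoffel m t u v) w = w \<bullet> (\<chi> a. koszul t u v (axis a 1))"
    using mform_sym[OF sym] christoffel_system by (simp add: mform_def)
  also have "\<dots> = (\<Sum>a\<in>UNIV. w $ a *\<^sub>R koszul t u v (axis a 1))"
    by (simp add: inner_vec_def)
  also have "\<dots> = koszul t u v (\<Sum>a\<in>UNIV. w $ a *\<^sub>R axis a 1)"
    by (simp add: linear_sum[OF koszul_lin3] linear_scale[OF koszul_lin3])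
  also have "(\<Sum>a\<in>UNIV. w $ a *\<^sub>R axis a 1) = w"
    using basis_expansion[of w] by (simp add: scalar_mult_eq_scaleR)
  finally show ?thesis .
qed

lemma christoffel_sym: "christoffel m t u v = christoffel m t v u"
proof -
  have "koszul t u v = koszul t v u"
    by (rule ext) (simp add: koszul_def t_sym[of _ u v])
  then show ?thesis by (simp add: christoffel_def)
qed

lemma christoffel_compatible:
  "mform m (christoffel m t u v) w + mform m v (christoffel m t u w) = t u v w"
  unfolding mform_sym[OF sym, of v] mform_christoffel
  using t_sym[of u w v] t_sym[of w u v] t_sym[of v u w] by (simp add: koszul_def field_simps)

text \<open>In \<open>t u v w + t v u w - t w u v\<close> the symmetry of \<open>B\<close> cancels everything but \<open>2 m(B(u,v),w)\<close>.\<close>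

lemma christoffel_unique:
  assumes "\<And>u v. B u v = B v u"
    and "\<And>u v w. mform m (B u v) w + mform m v (B u w) = t u v w"
  shows "B u v = christoffel m t u v"
proof (rule mform_nondegenerate[OF sym nondeg])
  fix w
  have "t u v w + t v u w - t w u v = 2 * mform m (B u v) w"
    unfolding assms(2)[symmetric] assms(1)[of v u] assms(1)[of w u] assms(1)[of w v]
      mform_sym[OF sym, of u] mform_sym[OF sym, of v] by simp
  then show "mform m (B u v) w = mform m (christoffel m t u v) w"
    unfolding mform_christoffel koszul_def by simp
qed

lemma christoffel_linear_right: "linear (christoffel m t u)"
proof -
  have k: "linear (\<lambda>v. koszul t u v w)" for w
  proof -
    have "linear (\<lambda>v. (1/2) *\<^sub>R (t u v w + t v u w - t w u v))"
      by (intro linear_compose_scale_right linear_compose_sub linear_compose_add lin1 lin2 lin3)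
    then show ?thesis by (simp add: koszul_def)
  qed
  show ?thesis
    by (intro linearI mform_nondegenerate[OF sym nondeg])
      (simp_all add: mform_add_left mform_scale_left mform_christoffel linear_add[OF k] linear_scale[OF k])
qed

lemma christoffel_linear_left: "linear (\<lambda>u. christoffel m t u v)"
proof -
  have "(\<lambda>u. christoffel m t u v) = christoffel m t v" by (rule ext) (rule christoffel_sym)
  then show ?thesis using christoffel_linear_right[of v] by simp
qed

end

section \<open>Horizontal Christoffel symbols of a metric and a 1-form\<close>

text \<open>In the application \<open>g\<close> is a member of the conformal class and \<open>\<omega> = W(g)\<close>; by \<open>F_conformal\<close> the
  choice of the member is immaterial.\<close>

locale weyl_metric = nonlinear_connection_space A H
  for A :: "('a, real^'n) chart set" and H :: "('a, 'n) tm_distribution" +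
  fixes g :: "('a, 'n) dtensor" and \<omega> :: "'a \<Rightarrow> ('a, real^'n) tvec \<Rightarrow> real"
  assumes g: "g \<in> GL_metrics A" and \<omega>: "\<omega> \<in> one_forms A"
begin

lemma g_sym: "c \<in> A \<Longrightarrow> z \<in> cdom (ic c) \<Longrightarrow> transpose (g c z) = g c z"
  using g unfolding GL_metrics_def by blast

lemma g_nondeg: "c \<in> A \<Longrightarrow> z \<in> cdom (ic c) \<Longrightarrow> det (g c z) \<noteq> 0"
  using g unfolding GL_metrics_def by blast

lemma g_d_tensor: "d_tensor A g"
  using g unfolding GL_metrics_def by blast

lemma g_smooth: "c \<in> A \<Longrightarrow> smooth_on (cmap (ic c) ` cdom (ic c)) (\<lambda>x. g c (cinv (ic c) x))"
  using g_d_tensor unfolding d_tensor_def by (simp only: o_def)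

lemma g_differentiable:
  "c \<in> A \<Longrightarrow> z \<in> cdom (ic c) \<Longrightarrow> (\<lambda>x. g c (cinv (ic c) x)) differentiable (at (cmap (ic c) z))"
  by (rule smooth_on_differentiable[OF g_smooth TM.open_chart[OF ic_TM]]) (auto simp del: cmap_ic ic_mem)

lemma g_change:
  assumes "c \<in> A" "d \<in> A" "z \<in> cdom (ic c)" "z \<in> cdom (ic d)"
  shows "mform (g c z) v w = mform (g d z) (J c d (fst z) v) (J c d (fst z) w)"
proof -
  let ?J = "jacobian (transition c d) (at (cmap c (fst z)))"
  have J: "J c d (fst z) u = ?J *v u" for u
    unfolding jacobian_def using J_linear[of c d "fst z"] assms by (simp add: matrix_works)
  have comp: "g c z $ i $ j = (\<Sum>a\<in>UNIV. \<Sum>b\<in>UNIV. g d z $ a $ b * ?J $ a $ i * ?J $ b $ j)" for i j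
    using g_d_tensor assms unfolding d_tensor_def Let_def by blast
  have col: "?J *v axis i 1 = (\<chi> a. ?J $ a $ i)" for i
    by (simp add: matrix_vector_mult_basis column_def)
  have "g c z $ i $ j = mform (g d z) (?J *v axis i 1) (?J *v axis j 1)" for i j
    unfolding comp mform_sum col by (simp add: mult.commute mult.left_commute)
  then have "mform (g c z) v w = (\<Sum>i\<in>UNIV. \<Sum>j\<in>UNIV. v $ i * mform (g d z) (?J *v axis i 1) (?J *v axis j 1) * w $ j)"
    unfolding mform_sum[of "g c z"] by simp
  also have "\<dots> = mform (g d z) (?J *v (\<Sum>i\<in>UNIV. v $ i *\<^sub>R axis i 1)) (?J *v (\<Sum>j\<in>UNIV. w $ j *\<^sub>R axis j 1))"
    by (simp add: linear_sum[OF matrix_vector_mul_linear] linear_scale[OF matrix_vector_mul_linear]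
        mform_sum_left mform_sum_right mform_scale_left mform_scale_right sum_distrib_left mult.assoc mult.left_commute mult.commute,
        subst sum.swap, rule refl)
  also have "\<dots> = mform (g d z) (?J *v v) (?J *v w)"
    using basis_expansion[of v] basis_expansion[of w] by (simp add: scalar_mult_eq_scaleR)
  finally show ?thesis by (simp add: J)
qed

text \<open>The horizontal lift of the vector with components \<open>u\<close>.\<close>

definition lift :: "('a, real^'n) chart \<Rightarrow> ('a, real^'n) tpoint \<Rightarrow> real^'n \<Rightarrow> (('a, real^'n) tpoint, (real^'n) \<times> (real^'n)) tvec"
  where "lift c z u = coord_vec (TM A) (ic c) z (u, - Nmap c z u)"

text \<open>The derivative of the coefficient matrix of \<open>g\<close> along the horizontal lift of \<open>u\<close>.\<close>

definition dg :: "('a, real^'n) chart \<Rightarrow> ('a, real^'n) tpoint \<Rightarrow> real^'n \<Rightarrow> real^'n^'n"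
  where "dg c z u = fd (\<lambda>x. g c (cinv (ic c) x)) (cmap (ic c) z) (u, - Nmap c z u)"

definition om :: "('a, real^'n) chart \<Rightarrow> 'a \<Rightarrow> real^'n \<Rightarrow> real"
  where "om c p u = \<omega> p (coord_vec A c p u)"

text \<open>The compatibility condition \<open>\<nabla>\<^sub>u g = \<omega>(u) g\<close> says that the two terms with the connection coefficients
  on its left-hand side add up to this form.\<close>

definition tg :: "('a, real^'n) chart \<Rightarrow> ('a, real^'n) tpoint \<Rightarrow> real^'n \<Rightarrow> real^'n \<Rightarrow> real^'n \<Rightarrow> real"
  where "tg c z u v w = mform (dg c z u) v w - om c (fst z) u * mform (g c z) v w"

definition F :: "('a, real^'n) chart \<Rightarrow> ('a, real^'n) tpoint \<Rightarrow> real^'n \<Rightarrow> real^'n \<Rightarrow> real^'n"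
  where "F c z = christoffel (g c z) (tg c z)"

context
  fixes c z assumes c: "c \<in> A" and z: "z \<in> cdom (ic c)"
begin

lemma lift_tangent: "lift c z u \<in> TM.T z"
  unfolding lift_def by (rule TM.coord_vec_tangent[OF ic_TM[OF c] z])

lemma lift_self: "lift c z u (ic c) = (u, - Nmap c z u)"
  unfolding lift_def by (rule TM.coord_vec_self[OF ic_TM[OF c] z])

lemma hor_lift: "hor c (lift c z u) = u"
  by (simp add: hor_def lift_self)

lemma ver_lift: "ver c z (lift c z u) = 0"
  by (simp add: ver_def hor_lift lift_self)

lemma dg_linear: "linear (dg c z)"
proof -
  have l: "linear (fd (\<lambda>x. g c (cinv (ic c) x)) (cmap (ic c) z))"
    by (rule linear_frechet_derivative[OF g_differentiable[OF c z]])
  have "linear (\<lambda>u. (u, - Nmap c z u))"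
    by (intro linearI) (simp_all add: linear_add[OF Nmap_linear] linear_scale[OF Nmap_linear])
  from linear_compose[OF this l] show ?thesis by (simp add: dg_def[abs_def] o_def)
qed

lemma dg_sym: "transpose (dg c z u) = dg c z u"
proof -
  let ?g = "\<lambda>x. g c (cinv (ic c) x)"
  have bl: "bounded_linear (transpose :: real^'n^'n \<Rightarrow> real^'n^'n)"
    by (simp add: linear_conv_bounded_linear[symmetric] linear_iff transpose_def vec_eq_iff)
  have "((\<lambda>x. transpose (?g x)) has_derivative (\<lambda>h. transpose (fd ?g (cmap (ic c) z) h))) (at (cmap (ic c) z))"
    by (rule bounded_linear.has_derivative[OF bl fd_works[OF g_differentiable[OF c z]]])
  then have "(?g has_derivative (\<lambda>h. transpose (fd ?g (cmap (ic c) z) h))) (at (cmap (ic c) z))"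
  proof (rule has_derivative_transform_within_open[OF _ TM.open_chart[OF ic_TM[OF c]]])
    show "cmap (ic c) z \<in> cmap (ic c) ` cdom (ic c)" using z by blast
    fix x assume "x \<in> cmap (ic c) ` cdom (ic c)"
    then obtain q where q: "q \<in> cdom (ic c)" "x = cmap (ic c) q" by blast
    then have "cinv (ic c) x = q" using TM.cinv_cmap[OF ic_TM[OF c]] by blast
    then show "transpose (?g x) = ?g x" using g_sym[OF c q(1)] by simp
  qed
  from fd_eqI[OF this] show ?thesis by (metis dg_def)
qed

lemma om_linear: "linear (om c (fst z))"
proof -
  have p: "fst z \<in> cdom c" "fst z \<in> points A" using z c by (auto simp: points_def)
  have \<omega>_lin: "\<omega> (fst z) (r *\<^sub>R v + s *\<^sub>R w) = r * \<omega> (fst z) v + s * \<omega> (fst z) w"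
    if "v \<in> T (fst z)" "w \<in> T (fst z)" for r s v w
    using \<omega> p(2) that unfolding one_forms_def by blast
  have "om c (fst z) (r *\<^sub>R u + s *\<^sub>R v) = r * om c (fst z) u + s * om c (fst z) v" for r s u v
    unfolding om_def coord_vec_lincomb[OF c p(1)]
    by (intro \<omega>_lin coord_vec_tangent[OF c p(1)])
  from this[of 1 _ 1] this[of _ _ 0 0] show ?thesis by (intro linearI) simp_all
qed

lemma christoffel_data: "christoffel_data (g c z) (tg c z)"
  unfolding christoffel_data_def
proof (intro conjI allI)
  show "transpose (g c z) = g c z" by (rule g_sym[OF c z])
  show "det (g c z) \<noteq> 0" by (rule g_nondeg[OF c z])
  show "linear (\<lambda>u. tg c z u v w)" for v w
    by (intro linearI) (simp_all add: tg_def linear_add[OF dg_linear] linear_scale[OF dg_linear]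
        linear_add[OF om_linear] linear_scale[OF om_linear] mform_def matrix_vector_mult_add_rdistrib
        scaleR_matrix_vector_assoc[symmetric] inner_add_right algebra_simps)
  show "linear (\<lambda>v. tg c z u v w)" for u w
    by (intro linearI) (simp_all add: tg_def mform_add_left mform_scale_left algebra_simps)
  show "tg c z u v w = tg c z u w v" for u v w
    using mform_sym[OF dg_sym, of u v w] mform_sym[OF g_sym[OF c z], of v w] by (simp add: tg_def)
qed

end

lemma lift_change:
  assumes "c \<in> A" "d \<in> A" "z \<in> cdom (ic c)" "z \<in> cdom (ic d)"
  shows "lift d z (J c d (fst z) u) = lift c z u"
  using assms lift_tangent[OF assms(1,3)] lift_tangent[OF assms(2,4)]
    hor_change[OF assms lift_tangent[OF assms(1,3)], of u] ver_change[OF assms lift_tangent[OF assms(1,3)], of u]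
    linear_0[OF J_linear[of c d "fst z"]]
  by (intro hor_ver_eqI[OF assms(2,4)]) (simp_all add: hor_lift ver_lift)

lemma om_change:
  assumes "c \<in> A" "d \<in> A" "p \<in> cdom c" "p \<in> cdom d"
  shows "om d p (J c d p u) = om c p u"
  unfolding om_def using coord_vec_component[OF coord_vec_tangent[OF assms(1,3)] assms(2,4), of u]
  by (simp add: coord_vec_apply[OF assms(2,4)])

text \<open>The derivative of \<open>g\<close> is not tensorial; the defect is given by the second derivatives of the
  coordinate change.\<close>

lemma dg_change:
  assumes "c \<in> A" "d \<in> A" "z \<in> cdom (ic c)" "z \<in> cdom (ic d)"
  shows "mform (dg c z u) v w = mform (dg d z (J c d (fst z) u)) (J c d (fst z) v) (J c d (fst z) w)
    + mform (g d z) (J2 c d (fst z) u v) (J c d (fst z) w)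
    + mform (g d z) (J c d (fst z) v) (J2 c d (fst z) u w)"
proof -
  have p: "fst z \<in> cdom c" "fst z \<in> cdom d" using assms by simp_all
  let ?x = "cmap (ic c) z" and ?\<phi> = "transition c d"
  let ?S = "cmap (ic c) ` (cdom (ic c) \<inter> cdom (ic d))"
  have o: "open ?S" by (rule TM.open_overlap[OF ic_TM[OF assms(1)] ic_TM[OF assms(2)]])
  have xS: "?x \<in> ?S" using assms by blast
  have xi_c: "lift c z u (ic c) = (u, - Nmap c z u)" by (rule lift_self[OF assms(1,3)])
  have xi_d: "lift c z u (ic d) = (J c d (fst z) u, - Nmap d z (J c d (fst z) u))"
    using lift_self[OF assms(2,4), of "J c d (fst z) u"] lift_change[OF assms] by simp
  have gd: "((\<lambda>x. g d (cinv (ic c) x)) has_derivative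
      (\<lambda>h. fd (\<lambda>y. g d (cinv (ic d) y)) (cmap (ic d) z) (TM.J (ic c) (ic d) z h))) (at ?x)"
    by (rule TM.directional_derivative_change(1)[OF ic_TM[OF assms(1)] ic_TM[OF assms(2)] assms(3,4)
          lift_tangent[OF assms(1,3)] g_differentiable[OF assms(2,4)]])
  have J': "((\<lambda>x. fd ?\<phi> (fst x) v) has_derivative (\<lambda>h. J2 c d (fst z) (fst h) v)) (at ?x)" for v
  proof -
    have "((\<lambda>x. fd ?\<phi> x v) has_derivative fd (\<lambda>x. fd ?\<phi> x v) (cmap c (fst z))) (at (cmap c (fst z)))"
      using assms p by (intro fd_works smooth_on_differentiable[OF smooth_on_fd[OF smooth_transition] open_overlap]) auto
    then show ?thesis
      using diff_chain_at[OF has_derivative_fst[OF has_derivative_ident, of "at ?x"], of "\<lambda>x. fd ?\<phi> x v"]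
      by (simp add: o_def J2_def)
  qed
  let ?M = "\<lambda>x. fd ?\<phi> (fst x) v \<bullet> (g d (cinv (ic c) x) *v fd ?\<phi> (fst x) w)"
  note prod = bounded_bilinear.FDERIV[OF bounded_bilinear_inner J'[of v]
      bounded_bilinear.FDERIV[OF bounded_bilinear_matrix_vector_mult gd J'[of w]]]
  have cz: "cinv (ic c) ?x = z" by (rule TM.cinv_cmap[OF ic_TM[OF assms(1)] assms(3)])
  have "((\<lambda>x. mform (g c (cinv (ic c) x)) v w) has_derivative
      (\<lambda>h. v \<bullet> (fd (\<lambda>x. g c (cinv (ic c) x)) ?x h *v w))) (at ?x)"
    unfolding mform_def
    by (intro bounded_linear.has_derivative[OF bounded_linear_inner_right]
        bounded_linear.has_derivative[OF bounded_bilinear.bounded_linear_left[OF bounded_bilinear_matrix_vector_mult]]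
        fd_works g_differentiable assms)
  then have "(?M has_derivative (\<lambda>h. v \<bullet> (fd (\<lambda>x. g c (cinv (ic c) x)) ?x h *v w))) (at ?x)"
  proof (rule has_derivative_transform_within_open[OF _ o xS])
    fix x assume "x \<in> ?S"
    then obtain q where q: "q \<in> cdom (ic c)" "q \<in> cdom (ic d)" "x = cmap (ic c) q" by blast
    then have "cinv (ic c) x = q" using TM.cinv_cmap[OF ic_TM[OF assms(1)]] by blast
    then show "mform (g c (cinv (ic c) x)) v w = ?M x"
      using g_change[OF assms(1,2) q(1,2), of v w] q by (simp add: mform_def)
  qed
  from fun_cong[OF has_derivative_unique[OF this prod], of "(u, - Nmap c z u)"]
  have "mform (dg c z u) v w = J c d (fst z) v \<bullet>
      (g d z *v J2 c d (fst z) u w + fd (\<lambda>y. g d (cinv (ic d) y)) (cmap (ic d) z)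
          (TM.J (ic c) (ic d) z (u, - Nmap c z u)) *v J c d (fst z) w)
      + J2 c d (fst z) u v \<bullet> (g d z *v J c d (fst z) w)"
    unfolding cz by (simp add: mform_def dg_def)
  also have "TM.J (ic c) (ic d) z (u, - Nmap c z u) = (J c d (fst z) u, - Nmap d z (J c d (fst z) u))"
    using TM.tangent_change[OF lift_tangent[OF assms(1,3)] ic_TM[OF assms(1)] ic_TM[OF assms(2)] assms(3,4), of u]
    unfolding xi_c xi_d by simp
  finally show ?thesis
    by (simp add: mform_def dg_def inner_add_right)
qed

lemma tg_change:
  assumes "c \<in> A" "d \<in> A" "z \<in> cdom (ic c)" "z \<in> cdom (ic d)"
  shows "tg c z u v w = tg d z (J c d (fst z) u) (J c d (fst z) v) (J c d (fst z) w)
    + mform (g d z) (J2 c d (fst z) u v) (J c d (fst z) w)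
    + mform (g d z) (J c d (fst z) v) (J2 c d (fst z) u w)"
  unfolding tg_def dg_change[OF assms, of u v w] g_change[OF assms, of v w]
  using om_change[OF assms(1,2), of "fst z" u] assms by simp

text \<open>Both sides are compared through the equations that characterize \<open>F c\<close>: transporting \<open>F d\<close> to the
  chart \<open>c\<close>, with the second derivative as correction, gives a symmetric bilinear map that solves them
  because the correction accounts precisely for the defect in \<open>tg_change\<close>.\<close>

lemma F_change:
  assumes "c \<in> A" "d \<in> A" "z \<in> cdom (ic c)" "z \<in> cdom (ic d)"
  shows "J c d (fst z) (F c z u v) = J2 c d (fst z) u v + F d z (J c d (fst z) u) (J c d (fst z) v)"
proof -
  have p: "fst z \<in> cdom c" "fst z \<in> cdom d" using assms by simp_all
  interpret C: christoffel_data "g c z" "tg c z" by (rule christoffel_data[OF assms(1,3)])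
  interpret D: christoffel_data "g d z" "tg d z" by (rule christoffel_data[OF assms(2,4)])
  let ?J = "J c d (fst z)" and ?J2 = "J2 c d (fst z)"
  define B where "B u v = J d c (fst z) (?J2 u v + F d z (?J u) (?J v))" for u v
  have JB: "?J (B u v) = ?J2 u v + F d z (?J u) (?J v)" for u v
    unfolding B_def by (rule J_inverse[OF assms(2,1) p(2,1)])
  have "B u v = christoffel (g c z) (tg c z) u v"
  proof (rule C.christoffel_unique)
    fix u v
    show "B u v = B v u"
      unfolding B_def F_def J2_sym[OF assms(1,2) p, of u v] D.christoffel_sym[of "?J u" "?J v"] by (rule refl)
  next
    fix u v w
    show "mform (g c z) (B u v) w + mform (g c z) v (B u w) = tg c z u v w"
      unfolding g_change[OF assms] JB tg_change[OF assms] mform_add_left mform_add_right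
      using D.christoffel_compatible[of "?J u" "?J v" "?J w"] by (simp add: F_def)
  qed
  then show ?thesis using JB[of u v] by (simp add: F_def)
qed

lemma smooth_on_Nmap:
  assumes "c \<in> A" "open S" "S \<subseteq> cmap (ic c) ` cdom (ic c)" "smooth_on S u"
  shows "smooth_on S (\<lambda>x. Nmap c (cinv (ic c) x) (u x))"
  unfolding Nmap_def
  by (intro smooth_on_sum smooth_on_scaleR smooth_on_nth assms smooth_on_subset[OF smooth_on_nlc_coeff])

lemma smooth_on_om:
  assumes "c \<in> A" "open S" "S \<subseteq> cmap (ic c) ` cdom (ic c)" "smooth_on S u"
  shows "smooth_on S (\<lambda>x. om c (fst (cinv (ic c) x)) (u x))"
proof -
  have "smooth_on (cmap c ` cdom c) (\<lambda>x. om c (cinv c x) a)" for a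
    using \<omega> assms(1) unfolding one_forms_def om_def by blast
  then have 0: "smooth_on ((cmap c ` cdom c) \<times> (UNIV :: (real^'n) set)) (\<lambda>x. om c (cinv c (fst x)) a)" for a
    by (rule smooth_on_fst_compose[OF open_chart[OF assms(1)]])
  have "cmap (ic c) ` cdom (ic c) = (cmap c ` cdom c) \<times> UNIV"
    using ic_image_overlap[OF assms(1), of c] by (simp only: Int_absorb)
  then have 1: "smooth_on S (\<lambda>x. om c (cinv c (fst x)) a)" for a
    by (intro smooth_on_subset[OF 0]) (use assms(3) in \<open>simp only:\<close>)
  have "smooth_on S (\<lambda>x. \<Sum>i\<in>UNIV. u x $ i * om c (cinv c (fst x)) (axis i 1))"
    by (intro smooth_on_sum smooth_on_mult smooth_on_nth assms 1)
  then show ?thesis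
  proof (rule smooth_on_cong[OF assms(2), rotated])
    fix x assume "x \<in> S"
    then obtain z where z: "z \<in> cdom (ic c)" "x = cmap (ic c) z" using assms(3) by blast
    then have e: "cinv (ic c) x = z" "cinv c (fst x) = fst z"
      using TM.cinv_cmap[OF ic_TM[OF assms(1)]] assms(1) by auto
    have "om c (fst z) (\<Sum>i\<in>UNIV. u x $ i *\<^sub>R axis i 1) = (\<Sum>i\<in>UNIV. u x $ i * om c (fst z) (axis i 1))"
      using om_linear[OF assms(1) z(1)] by (simp add: linear_sum linear_scale)
    then show "(\<Sum>i\<in>UNIV. u x $ i * om c (cinv c (fst x)) (axis i 1)) = om c (fst (cinv (ic c) x)) (u x)"
      unfolding e using basis_expansion[of "u x"] by (simp add: scalar_mult_eq_scaleR)
  qed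
qed

lemma smooth_on_tg:
  assumes "c \<in> A" "open S" "S \<subseteq> cmap (ic c) ` cdom (ic c)" "smooth_on S u" "smooth_on S v" "smooth_on S w"
  shows "smooth_on S (\<lambda>x. tg c (cinv (ic c) x) (u x) (v x) (w x))"
proof -
  let ?g = "\<lambda>x. g c (cinv (ic c) x)"
  have g: "smooth_on S ?g" by (rule smooth_on_subset[OF g_smooth[OF assms(1)] assms(3)])
  have "smooth_on S (\<lambda>x. fd ?g x (u x, - Nmap c (cinv (ic c) x) (u x)))"
    by (intro smooth_on_fd_field g smooth_on_Pair smooth_on_minus smooth_on_Nmap assms)
  then have "smooth_on S (\<lambda>x. v x \<bullet> (fd ?g x (u x, - Nmap c (cinv (ic c) x) (u x)) *v w x)
      - om c (fst (cinv (ic c) x)) (u x) * (v x \<bullet> (?g x *v w x)))"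
    by (intro smooth_on_diff smooth_on_inner smooth_on_matrix_vector_mult smooth_on_mult smooth_on_om g assms)
  then show ?thesis
  proof (rule smooth_on_cong[OF assms(2), rotated])
    fix x assume "x \<in> S"
    then obtain z where z: "z \<in> cdom (ic c)" "x = cmap (ic c) z" using assms(3) by blast
    then have e: "cinv (ic c) x = z" using TM.cinv_cmap[OF ic_TM[OF assms(1)]] by blast
    show "v x \<bullet> (fd ?g x (u x, - Nmap c (cinv (ic c) x) (u x)) *v w x)
      - om c (fst (cinv (ic c) x)) (u x) * (v x \<bullet> (?g x *v w x)) = tg c (cinv (ic c) x) (u x) (v x) (w x)"
      unfolding e tg_def mform_def dg_def z(2)[symmetric] by (rule refl)
  qed
qed

lemma smooth_on_F:
  assumes "c \<in> A" "open S" "S \<subseteq> cmap (ic c) ` cdom (ic c)" "smooth_on S u" "smooth_on S v"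
  shows "smooth_on S (\<lambda>x. F c (cinv (ic c) x) (u x) (v x))"
proof (rule smooth_on_solution[OF assms(2)])
  let ?g = "\<lambda>x. g c (cinv (ic c) x)"
  have zS: "cinv (ic c) x \<in> cdom (ic c)" if "x \<in> S" for x
    using that assms(3) TM.cinv_cmap[OF ic_TM[OF assms(1)]] by (auto simp del: cmap_ic ic_mem)
  show "smooth_on S (\<lambda>x. ?g x $ i $ j)" for i j
    by (intro smooth_on_nth assms smooth_on_subset[OF g_smooth])
  show "det (?g x) \<noteq> 0" if "x \<in> S" for x by (rule g_nondeg[OF assms(1) zS[OF that]])
  show "?g x *v F c (cinv (ic c) x) (u x) (v x)
      = (\<chi> a. koszul (tg c (cinv (ic c) x)) (u x) (v x) (axis a 1))" if "x \<in> S" for x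
    unfolding F_def by (rule christoffel_data.christoffel_system[OF christoffel_data[OF assms(1) zS[OF that]]])
  have "smooth_on S (\<lambda>x. (tg c (cinv (ic c) x) (u x) (v x) (axis i 1) + tg c (cinv (ic c) x) (v x) (u x) (axis i 1)
     - tg c (cinv (ic c) x) (axis i 1) (u x) (v x)) / 2)" for i
    by (intro smooth_on_divide smooth_on_add smooth_on_diff smooth_on_tg smooth_on_const assms) simp
  then show "smooth_on S (\<lambda>x. (\<chi> a. koszul (tg c (cinv (ic c) x)) (u x) (v x) (axis a 1)) $ i)" for i
    by (simp add: koszul_def)
qed

end

section \<open>d-connections and their coefficients\<close>

context nonlinear_connection_space
begin

context
  fixes c z assumes c: "c \<in> A" and z: "z \<in> cdom (ic c)"
begin

lemma adp_frame_sum: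
  "adp h c z (\<Sum>i\<in>UNIV. r i *\<^sub>R delta A H c i z) = (if h then \<chi> i. r i else 0)"
  "adp h c z (\<Sum>i\<in>UNIV. r i *\<^sub>R dy A c i z) = (if h then 0 else \<chi> i. r i)"
  by (cases h; simp add: linear_sum[OF adp_linear] linear_scale[OF adp_linear] adp_frame[OF c z] vec_expansion)+

lemma frame_sum_tangent:
  "(\<Sum>i\<in>UNIV. r i *\<^sub>R delta A H c i z) \<in> TM.T z" "(\<Sum>i\<in>UNIV. r i *\<^sub>R dy A c i z) \<in> TM.T z"
  by (intro TM.tangent_sum TM.tangent_scale delta_tangent dy_tangent c z)+

lemma adapted_expansion:
  assumes "w \<in> TM.T z"
  shows "w = (\<Sum>i\<in>UNIV. adp True c z w $ i *\<^sub>R delta A H c i z) + (\<Sum>i\<in>UNIV. adp False c z w $ i *\<^sub>R dy A c i z)"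
proof (rule adp_eqI[OF c z assms TM.tangent_add[OF frame_sum_tangent]])
  show "adp h c z w = adp h c z ((\<Sum>i\<in>UNIV. adp True c z w $ i *\<^sub>R delta A H c i z)
      + (\<Sum>i\<in>UNIV. adp False c z w $ i *\<^sub>R dy A c i z))" for h
    unfolding linear_add[OF adp_linear] adp_frame_sum by (cases h) simp_all
qed

lemma d_coeffs_unique:
  assumes "d_coeffs A H D c z F C" "d_coeffs A H D c z F' C'"
  shows "F = F'" "C = C'"
proof -
  have "(\<Sum>i\<in>UNIV. F i j k *\<^sub>R delta A H c i z) = (\<Sum>i\<in>UNIV. F' i j k *\<^sub>R delta A H c i z)" for j k
    using assms unfolding d_coeffs_def by metis
  from arg_cong[OF this, of "adp True c z"] have "(\<chi> i. F i j k) = (\<chi> i. F' i j k)" for j k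
    unfolding adp_frame_sum by simp
  then show "F = F'" by (simp add: vec_eq_iff fun_eq_iff)
  have "(\<Sum>i\<in>UNIV. C i j k *\<^sub>R delta A H c i z) = (\<Sum>i\<in>UNIV. C' i j k *\<^sub>R delta A H c i z)" for j k
    using assms unfolding d_coeffs_def by metis
  from arg_cong[OF this, of "adp True c z"] have "(\<chi> i. C i j k) = (\<chi> i. C' i j k)" for j k
    unfolding adp_frame_sum by simp
  then show "C = C'" by (simp add: vec_eq_iff fun_eq_iff)
qed

lemma coeff_eqI:
  assumes "d_coeffs A H D c z F C"
  shows "F_coeff A H D c z = F" "C_coeff A H D c z = C"
proof -
  show "F_coeff A H D c z = F"
    unfolding F_coeff_def
  proof (rule the_equality)
    show "\<exists>C. d_coeffs A H D c z F C" by (rule exI[of _ C]) (rule assms)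
    show "F' = F" if "\<exists>C. d_coeffs A H D c z F' C" for F'
      using that by (elim exE) (rule d_coeffs_unique(1)[OF _ assms])
  qed
  show "C_coeff A H D c z = C"
    unfolding C_coeff_def
  proof (rule the_equality)
    show "\<exists>F. d_coeffs A H D c z F C" by (rule exI[of _ F]) (rule assms)
    show "C' = C" if "\<exists>F. d_coeffs A H D c z F C'" for C'
      using that by (elim exE) (rule d_coeffs_unique(2)[OF _ assms])
  qed
qed

end

lemma smooth_on_hor:
  assumes "c \<in> A" "TM.is_open U" "U \<subseteq> cdom (ic c)" "smooth_vf_on (TM A) U Y"
  shows "smooth_on (cmap (ic c) ` U) (\<lambda>x. hor c (Y (cinv (ic c) x)))"
  unfolding hor_def
  using smooth_on_fst[OF TM.open_image'[OF ic_TM[OF assms(1)] assms(2,3)]]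
    TM.smooth_vf_onD[OF assms(4) ic_TM[OF assms(1)]] assms(3) by (simp only: Int_absorb2)

lemma smooth_on_ver:
  assumes "c \<in> A" "TM.is_open U" "U \<subseteq> cdom (ic c)" "smooth_vf_on (TM A) U Y"
  shows "smooth_on (cmap (ic c) ` U) (\<lambda>x. ver c (cinv (ic c) x) (Y (cinv (ic c) x)))"
proof -
  have o: "open (cmap (ic c) ` U)" by (rule TM.open_image'[OF ic_TM[OF assms(1)] assms(2,3)])
  have "smooth_on (cmap (ic c) ` U) (\<lambda>x. Y (cinv (ic c) x) (ic c))"
    using TM.smooth_vf_onD[OF assms(4) ic_TM[OF assms(1)]] assms(3) by (simp only: Int_absorb2)
  moreover have "smooth_on (cmap (ic c) ` U) (\<lambda>x. Nmap c (cinv (ic c) x) (hor c (Y (cinv (ic c) x))))"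
    unfolding Nmap_def
    by (intro smooth_on_sum smooth_on_scaleR smooth_on_nth o smooth_on_hor assms
        smooth_on_subset[OF smooth_on_nlc_coeff[OF assms(1)]] image_mono)
  ultimately show ?thesis unfolding ver_def by (intro smooth_on_add smooth_on_snd o)
qed

lemma smooth_on_adp:
  assumes "c \<in> A" "TM.is_open U" "U \<subseteq> cdom (ic c)" "smooth_vf_on (TM A) U Y"
  shows "smooth_on (cmap (ic c) ` U) (\<lambda>x. adp h c (cinv (ic c) x) (Y (cinv (ic c) x)))"
  using smooth_on_hor[OF assms] smooth_on_ver[OF assms] by (cases h) (simp_all only: adp_def if_True if_False)

lemma smooth_fun_adp:
  assumes "c \<in> A" "smooth_vf_on (TM A) (cdom (ic c)) Y"
  shows "TM.smooth_fun_on (cdom (ic c)) (\<lambda>q. adp h c q (Y q) $ i)"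
  by (rule TM.smooth_fun_onI_chart[OF ic_TM[OF assms(1)] TM.is_open_cdom[OF ic_TM[OF assms(1)]] order_refl])
    (intro smooth_on_nth smooth_on_adp TM.open_chart ic_TM TM.is_open_cdom assms order_refl)

text \<open>The adapted fields form a local frame; it is indexed here by pairs of a boolean, which distinguishes
  horizontal from vertical fields, and a coordinate.\<close>

lemma connection_determined_by_coeffs:
  assumes D: "linear_connection (TM A) D" and D': "linear_connection (TM A) D'"
    and coeffs: "\<And>c z. c \<in> A \<Longrightarrow> z \<in> cdom (ic c) \<Longrightarrow> \<exists>F C. d_coeffs A H D c z F C \<and> d_coeffs A H D' c z F C"
  shows "D = D'"
proof -
  have eq: "D X Y = D' X Y" if X: "X \<in> vector_fields (TM A)" and Y: "Y \<in> vector_fields (TM A)" for X Y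
  proof
    fix z
    show "D X Y z = D' X Y z"
    proof (cases "z \<in> points (TM A)")
      case False
      then show ?thesis
        using TM.connection_closed[OF D X Y] TM.connection_closed[OF D' X Y] unfolding TM.vector_fields_iff by simp
    next
      case True
      then obtain c where c: "c \<in> A" and z: "z \<in> cdom (ic c)" unfolding points_def TM_def by blast
      define E where "E = (\<lambda>(h, i). if h then delta A H c i else dy A c i)"
      define comp where "comp Z = (\<lambda>(h, i) q. adp h c q (Z q) $ i)" for Z
      have o: "TM.is_open (cdom (ic c))" by (rule TM.is_open_cdom[OF ic_TM[OF c]])
      have sE: "smooth_vf_on (TM A) (cdom (ic c)) (E a)" for a
        using smooth_vf_delta[OF c] smooth_vf_dy[OF c] by (cases a) (simp add: E_def del: ic_mem)
      have sc: "TM.smooth_fun_on (cdom (ic c)) (comp Z a)" if "Z \<in> vector_fields (TM A)" for Z a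
        using smooth_fun_adp[OF c TM.vector_fields_smooth[OF that o]] by (cases a) (simp only: comp_def prod.case)
      have expand: "Z q = (\<Sum>a\<in>UNIV. comp Z a q *\<^sub>R E a q)"
        if Z: "Z \<in> vector_fields (TM A)" and q: "q \<in> cdom (ic c)" for Z q
      proof -
        have "Z q = (\<Sum>i\<in>UNIV. comp Z (True, i) q *\<^sub>R E (True, i) q) + (\<Sum>i\<in>UNIV. comp Z (False, i) q *\<^sub>R E (False, i) q)"
          using adapted_expansion[OF c q TM.vector_fields_tangent[OF Z TM_pointsI[OF c q]]]
          unfolding comp_def E_def prod.case if_True if_False .
        also have "\<dots> = (\<Sum>h\<in>UNIV. \<Sum>i\<in>UNIV. comp Z (h, i) q *\<^sub>R E (h, i) q)"
          unfolding UNIV_bool by (simp add: add.commute del: plus_fun_apply)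
        also have "\<dots> = (\<Sum>a\<in>UNIV. comp Z a q *\<^sub>R E a q)"
          unfolding sum.cartesian_product UNIV_Times_UNIV by (rule sum.cong[OF refl]) (simp only: split_beta prod.collapse)
        finally show ?thesis .
      qed
      have same: "local_conn (TM A) D (E a) (E b) z = local_conn (TM A) D' (E a) (E b) z" for a b
      proof -
        obtain F C where FC: "d_coeffs A H D c z F C" "d_coeffs A H D' c z F C" using coeffs[OF c z] by blast
        show ?thesis
          using FC unfolding d_coeffs_def by (cases a; cases b) (simp only: E_def prod.case split: if_split, simp)
      qed
      show ?thesis
        by (rule TM.connection_determined_by_frame[OF D D' finite_class.finite_UNIV o z sE same X Y
              sc[OF X] expand[OF X] sc[OF Y] expand[OF Y]])
    qed
  qed
  have ext: "D1 \<in> vector_fields (TM A) \<rightarrow>\<^sub>E (vector_fields (TM A) \<rightarrow>\<^sub>E vector_fields (TM A))"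
    if "linear_connection (TM A) D1" for D1
    using that unfolding linear_connection_def by blast
  show ?thesis
  proof (rule PiE_ext[OF ext[OF D] ext[OF D']])
    fix X assume X: "X \<in> vector_fields (TM A)"
    show "D X = D' X"
      by (rule PiE_ext[OF PiE_mem[OF ext[OF D] X] PiE_mem[OF ext[OF D'] X]]) (rule eq[OF X])
  qed
qed

end

section \<open>The connection\<close>

context weyl_metric
begin

text \<open>A d-vector field is given in each chart by a function \<open>s\<close> with values in \<open>\<real>\<^sup>n\<close>; this is its
  covariant derivative along \<open>w\<close>.\<close>

definition nab :: "('a, real^'n) chart \<Rightarrow> ('a, real^'n) tpoint \<Rightarrow>
    (('a, real^'n) tpoint, (real^'n) \<times> (real^'n)) tvec \<Rightarrow> (('a, real^'n) tpoint \<Rightarrow> real^'n) \<Rightarrow> real^'n"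
  where "nab c z w s = fd (\<lambda>x. s (cinv (ic c) x)) (cmap (ic c) z) (w (ic c)) + F c z (hor c w) (s z)"

text \<open>Differentiating \<open>s' = J s\<close> produces a second derivative of the coordinate change, which cancels the one
  in the transformation law of \<open>F\<close>.\<close>

lemma nab_change:
  assumes "c \<in> A" "d \<in> A" "z \<in> cdom (ic c)" "z \<in> cdom (ic d)" "w \<in> TM.T z"
    and s: "(\<lambda>x. s (cinv (ic c) x)) differentiable (at (cmap (ic c) z))"
      "(\<lambda>x. s' (cinv (ic d) x)) differentiable (at (cmap (ic d) z))"
    and ss': "\<And>q. q \<in> cdom (ic c) \<Longrightarrow> q \<in> cdom (ic d) \<Longrightarrow> s' q = J c d (fst q) (s q)"
  shows "nab d z w s' = J c d (fst z) (nab c z w s)"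
proof -
  let ?x = "cmap (ic c) z" and ?\<phi> = "transition c d" and ?p = "fst z"
  let ?S = "cmap (ic c) ` (cdom (ic c) \<inter> cdom (ic d))"
  have p: "?p \<in> cdom c" "?p \<in> cdom d" using assms by simp_all
  have o: "open ?S" by (rule TM.open_overlap[OF ic_TM[OF assms(1)] ic_TM[OF assms(2)]])
  have xS: "?x \<in> ?S" using assms(3,4) by blast
  have cz: "cinv (ic c) ?x = z" by (rule TM.cinv_cmap[OF ic_TM[OF assms(1)] assms(3)])
  let ?ds = "fd (\<lambda>x. s (cinv (ic c) x)) ?x"
  have 1: "((\<lambda>x. (fst x, s (cinv (ic c) x))) has_derivative (\<lambda>h. (fst h, ?ds h))) (at ?x)"
    by (intro has_derivative_Pair has_derivative_fst has_derivative_ident fd_works s)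
  have pS: "cmap c ?p \<in> cmap c ` (cdom c \<inter> cdom d)" using p by blast
  have 2: "((\<lambda>y. fd ?\<phi> (fst y) (snd y)) has_derivative (\<lambda>h. J2 c d ?p (fst h) (s z) + J c d ?p (snd h)))
      (at ((\<lambda>x. (fst x, s (cinv (ic c) x))) ?x))"
    using fd_joint_has_derivative[OF open_overlap[OF assms(1,2)] smooth_transition[OF assms(1,2)] pS, of "s z"]
    unfolding J2_def cz by simp
  have "((\<lambda>x. fd ?\<phi> (fst x) (s (cinv (ic c) x))) has_derivative (\<lambda>h. J2 c d ?p (fst h) (s z) + J c d ?p (?ds h))) (at ?x)"
    using diff_chain_at[OF 1 2] by (simp add: o_def)
  then have "((\<lambda>x. s' (cinv (ic c) x)) has_derivative (\<lambda>h. J2 c d ?p (fst h) (s z) + J c d ?p (?ds h))) (at ?x)"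
  proof (rule has_derivative_transform_within_open[OF _ o xS])
    fix x assume "x \<in> ?S"
    then obtain q where q: "q \<in> cdom (ic c)" "q \<in> cdom (ic d)" "x = cmap (ic c) q" by blast
    then have "cinv (ic c) x = q" using TM.cinv_cmap[OF ic_TM[OF assms(1)]] by blast
    then show "fd ?\<phi> (fst x) (s (cinv (ic c) x)) = s' (cinv (ic c) x)"
      using ss'[OF q(1,2)] q by simp
  qed
  from fd_eqI[OF this] have "fd (\<lambda>x. s' (cinv (ic d) x)) (cmap (ic d) z) (w (ic d))
      = J2 c d ?p (hor c w) (s z) + J c d ?p (?ds (w (ic c)))"
    using TM.directional_derivative_change(2)[OF ic_TM[OF assms(1)] ic_TM[OF assms(2)] assms(3-5) s(2)]
    by (simp add: hor_def)
  then show ?thesis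
    unfolding nab_def linear_add[OF J_linear[OF assms(1,2) p]] F_change[OF assms(1-4)]
      hor_change[OF assms(1-5)] ss'[OF assms(3,4)] by simp
qed

context
  fixes c z assumes c: "c \<in> A" and z: "z \<in> cdom (ic c)"
begin

lemma F_linear_left: "linear (\<lambda>u. F c z u v)"
  unfolding F_def by (rule christoffel_data.christoffel_linear_left[OF christoffel_data[OF c z]])

lemma F_linear_right: "linear (F c z u)"
  unfolding F_def by (rule christoffel_data.christoffel_linear_right[OF christoffel_data[OF c z]])

lemma nab_add_left:
  assumes "(\<lambda>x. s (cinv (ic c) x)) differentiable (at (cmap (ic c) z))"
  shows "nab c z (w + w') s = nab c z w s + nab c z w' s"
  using linear_add[OF linear_frechet_derivative[OF assms]] linear_add[OF F_linear_left]
  by (simp add: nab_def)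

lemma nab_scale_left:
  assumes "(\<lambda>x. s (cinv (ic c) x)) differentiable (at (cmap (ic c) z))"
  shows "nab c z (r *\<^sub>R w) s = r *\<^sub>R nab c z w s"
proof -
  have "(r *\<^sub>R w) (ic c) = r *\<^sub>R w (ic c)" by (simp add: scaleR_fun_def)
  then show ?thesis
    using linear_scale[OF linear_frechet_derivative[OF assms]] linear_scale[OF F_linear_left]
    by (simp add: nab_def scaleR_add_right)
qed

lemma nab_add_right:
  assumes "(\<lambda>x. s (cinv (ic c) x)) differentiable (at (cmap (ic c) z))"
    "(\<lambda>x. s' (cinv (ic c) x)) differentiable (at (cmap (ic c) z))"
  shows "nab c z w (\<lambda>q. s q + s' q) = nab c z w s + nab c z w s'"
  using fd_eqI[OF has_derivative_add[OF fd_works[OF assms(1)] fd_works[OF assms(2)]]] linear_add[OF F_linear_right]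
  by (simp add: nab_def)

lemma nab_Leibniz:
  assumes "(\<lambda>x. f (cinv (ic c) x)) differentiable (at (cmap (ic c) z))"
    "(\<lambda>x. s (cinv (ic c) x)) differentiable (at (cmap (ic c) z))"
  shows "nab c z w (\<lambda>q. f q *\<^sub>R s q)
    = fd (\<lambda>x. f (cinv (ic c) x)) (cmap (ic c) z) (w (ic c)) *\<^sub>R s z + f z *\<^sub>R nab c z w s"
  using fd_eqI[OF has_derivative_scaleR[OF fd_works[OF assms(1)] fd_works[OF assms(2)]]]
    linear_scale[OF F_linear_right] TM.cinv_cmap[OF ic_TM[OF c] z]
  by (simp add: nab_def scaleR_add_right)

lemma nab_cong:
  assumes "TM.is_open U" "z \<in> U" "\<And>q. q \<in> U \<Longrightarrow> q \<in> cdom (ic c) \<Longrightarrow> s q = s' q"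
  shows "nab c z w s = nab c z w s'"
proof -
  have "fd (\<lambda>x. s (cinv (ic c) x)) (cmap (ic c) z) = fd (\<lambda>x. s' (cinv (ic c) x)) (cmap (ic c) z)"
  proof (rule fd_cong_open[OF TM.open_image[OF ic_TM[OF c] assms(1)]])
    show "cmap (ic c) z \<in> cmap (ic c) ` (U \<inter> cdom (ic c))" using assms(2) z by blast
    fix x assume "x \<in> cmap (ic c) ` (U \<inter> cdom (ic c))"
    then obtain q where q: "q \<in> U" "q \<in> cdom (ic c)" "x = cmap (ic c) q" by blast
    then have "cinv (ic c) x = q" using TM.cinv_cmap[OF ic_TM[OF c]] by blast
    then show "s (cinv (ic c) x) = s' (cinv (ic c) x)" using assms(3) q by simp
  qed
  then show ?thesis using assms(3)[OF assms(2) z] by (simp add: nab_def)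
qed

lemma nab_const: "nab c z w (\<lambda>q. v) = F c z (hor c w) v"
  by (simp add: nab_def)

lemma adp_differentiable:
  assumes "Y \<in> vector_fields (TM A)"
  shows "(\<lambda>x. adp h c (cinv (ic c) x) (Y (cinv (ic c) x))) differentiable (at (cmap (ic c) z))"
  by (rule smooth_on_differentiable[OF smooth_on_adp[OF c TM.is_open_cdom[OF ic_TM[OF c]] order_refl
        TM.vector_fields_smooth[OF assms TM.is_open_cdom[OF ic_TM[OF c]]]] TM.open_chart[OF ic_TM[OF c]] imageI[OF z]])

end

text \<open>Both components of \<open>Y\<close> are d-vector fields and are differentiated separately. The vertical component of
  a vector is its second coordinate plus \<open>Nmap\<close> of the first one, which has to be undone here.\<close>

definition nabla_at :: "('a, real^'n) chart \<Rightarrow> ('a, 'n) tm_operator"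
  where "nabla_at c X Y z = (let s = \<lambda>h. nab c z (X z) (\<lambda>q. adp h c q (Y q)) in
    coord_vec (TM A) (ic c) z (s True, s False - Nmap c z (s True)))"

text \<open>The choice of the chart is immaterial by \<open>nabla_components\<close>.\<close>

definition nabla :: "('a, 'n) tm_operator"
  where "nabla X Y z = (if z \<in> points (TM A) then nabla_at (chart_at A (fst z)) X Y z else 0)"

definition conn :: "('a, 'n) tm_operator"
  where "conn = (\<lambda>X\<in>vector_fields (TM A). \<lambda>Y\<in>vector_fields (TM A). nabla X Y)"

lemma nabla_at_components:
  assumes "c \<in> A" "z \<in> cdom (ic c)"
  shows "nabla_at c X Y z \<in> TM.T z"
    and "adp h c z (nabla_at c X Y z) = nab c z (X z) (\<lambda>q. adp h c q (Y q))"
proof -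
  show "nabla_at c X Y z \<in> TM.T z"
    unfolding nabla_at_def Let_def by (rule TM.coord_vec_tangent[OF ic_TM[OF assms(1)] assms(2)])
  have "nabla_at c X Y z (ic c) = (nab c z (X z) (\<lambda>q. adp True c q (Y q)),
      nab c z (X z) (\<lambda>q. adp False c q (Y q)) - Nmap c z (nab c z (X z) (\<lambda>q. adp True c q (Y q))))"
    unfolding nabla_at_def Let_def by (rule TM.coord_vec_self[OF ic_TM[OF assms(1)] assms(2)])
  then show "adp h c z (nabla_at c X Y z) = nab c z (X z) (\<lambda>q. adp h c q (Y q))"
    unfolding adp_def[of h c z] ver_def hor_def by (cases h) simp_all
qed

lemma nabla_components:
  assumes "c \<in> A" "z \<in> cdom (ic c)" "X \<in> vector_fields (TM A)" "Y \<in> vector_fields (TM A)"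
  shows "nabla X Y z \<in> TM.T z"
    and "adp h c z (nabla X Y z) = nab c z (X z) (\<lambda>q. adp h c q (Y q))"
proof -
  define e where "e = chart_at A (fst z)"
  have zp: "z \<in> points (TM A)" by (rule TM_pointsI[OF assms(1,2)])
  then have e: "e \<in> A" "z \<in> cdom (ic e)"
    using chart_at[of "fst z"] unfolding e_def TM_points by auto
  have eq: "nabla X Y z = nabla_at e X Y z" using zp by (simp add: nabla_def e_def)
  note comps = nabla_at_components[OF e, where X = X and Y = Y]
  have XT: "X z \<in> TM.T z" by (rule TM.vector_fields_tangent[OF assms(3) zp])
  have YT: "Y q \<in> TM.T q" if "q \<in> cdom (ic c)" for q
    by (rule TM.vector_fields_tangent[OF assms(4) TM_pointsI[OF assms(1) that]])
  show "nabla X Y z \<in> TM.T z" unfolding eq by (rule comps(1))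
  have "adp h c z (nabla X Y z) = J e c (fst z) (nab e z (X z) (\<lambda>q. adp h e q (Y q)))"
    unfolding eq adp_change[OF e(1) assms(1) e(2) assms(2) comps(1)] comps(2) by (rule refl)
  also have "\<dots> = nab c z (X z) (\<lambda>q. adp h c q (Y q))"
    by (rule nab_change[OF e(1) assms(1) e(2) assms(2) XT adp_differentiable[OF e assms(4)]
          adp_differentiable[OF assms(1,2,4)], symmetric])
      (rule adp_change[OF e(1) assms(1) _ _ YT])
  finally show "adp h c z (nabla X Y z) = nab c z (X z) (\<lambda>q. adp h c q (Y q))" .
qed

lemma smooth_on_nab:
  assumes "c \<in> A" "smooth_vf_on (TM A) (cdom (ic c)) X"
    and "smooth_on (cmap (ic c) ` cdom (ic c)) (\<lambda>x. s (cinv (ic c) x))"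
  shows "smooth_on (cmap (ic c) ` cdom (ic c)) (\<lambda>x. nab c (cinv (ic c) x) (X (cinv (ic c) x)) s)"
proof -
  let ?S = "cmap (ic c) ` cdom (ic c)"
  have o: "open ?S" by (rule TM.open_chart[OF ic_TM[OF assms(1)]])
  have oc: "TM.is_open (cdom (ic c))" by (rule TM.is_open_cdom[OF ic_TM[OF assms(1)]])
  have sX: "smooth_on ?S (\<lambda>x. X (cinv (ic c) x) (ic c))"
    using TM.smooth_vf_onD[OF assms(2) ic_TM[OF assms(1)]] by (simp only: Int_absorb)
  have "smooth_on ?S (\<lambda>x. fd (\<lambda>x. s (cinv (ic c) x)) x (X (cinv (ic c) x) (ic c))
      + F c (cinv (ic c) x) (hor c (X (cinv (ic c) x))) (s (cinv (ic c) x)))"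
    by (intro smooth_on_add o smooth_on_fd_field assms(3) sX smooth_on_F[OF assms(1) o order_refl]
        smooth_on_hor[OF assms(1) oc order_refl assms(2)])
  then show ?thesis
  proof (rule smooth_on_cong[OF o, rotated])
    fix x assume "x \<in> ?S"
    then obtain q where q: "q \<in> cdom (ic c)" "x = cmap (ic c) q" by blast
    then have e: "cinv (ic c) x = q" using TM.cinv_cmap[OF ic_TM[OF assms(1)]] by blast
    show "fd (\<lambda>x. s (cinv (ic c) x)) x (X (cinv (ic c) x) (ic c))
      + F c (cinv (ic c) x) (hor c (X (cinv (ic c) x))) (s (cinv (ic c) x))
      = nab c (cinv (ic c) x) (X (cinv (ic c) x)) s"
      unfolding nab_def e q(2)[symmetric] by (rule refl)
  qed
qed

lemma nabla_closed:
  assumes X: "X \<in> vector_fields (TM A)" and Y: "Y \<in> vector_fields (TM A)"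
  shows "nabla X Y \<in> vector_fields (TM A)"
  unfolding TM.vector_fields_iff
proof (intro conjI allI impI)
  show "nabla X Y z = 0" if "z \<notin> points (TM A)" for z using that by (simp add: nabla_def)
  show "smooth_vf_on (TM A) (points (TM A)) (nabla X Y)"
  proof (rule TM.smooth_vf_on_local[OF TM.is_open_points])
    fix z assume "z \<in> points (TM A)"
    then obtain c where c: "c \<in> A" and z: "z \<in> cdom (ic c)" unfolding points_def TM_def by blast
    let ?U = "cdom (ic c)"
    let ?S = "cmap (ic c) ` ?U"
    have U: "TM.is_open ?U" by (rule TM.is_open_cdom[OF ic_TM[OF c]])
    have o: "open ?S" by (rule TM.open_chart[OF ic_TM[OF c]])
    note sX = TM.vector_fields_smooth[OF X U] and sY = TM.vector_fields_smooth[OF Y U]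
    let ?s = "\<lambda>h x. nab c (cinv (ic c) x) (X (cinv (ic c) x)) (\<lambda>q. adp h c q (Y q))"
    have s: "smooth_on ?S (?s h)" for h
      by (rule smooth_on_nab[OF c sX, of "\<lambda>q. adp h c q (Y q)", OF smooth_on_adp[OF c U order_refl sY]])
    have "smooth_on ?S (\<lambda>x. (?s True x, ?s False x - Nmap c (cinv (ic c) x) (?s True x)))"
      by (intro smooth_on_Pair smooth_on_diff o s smooth_on_Nmap[OF c o order_refl])
    then have "smooth_on ?S (\<lambda>x. nabla X Y (cinv (ic c) x) (ic c))"
    proof (rule smooth_on_cong[OF o, rotated])
      fix x assume "x \<in> ?S"
      then obtain q where q: "q \<in> cdom (ic c)" "x = cmap (ic c) q" by blast
      then have e: "cinv (ic c) x = q" using TM.cinv_cmap[OF ic_TM[OF c]] by blast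
      have "fst (nabla X Y q (ic c)) = ?s True x"
        using nabla_components(2)[OF c q(1) X Y, of True] unfolding e by (simp add: adp_def hor_def)
      moreover have "snd (nabla X Y q (ic c)) = ?s False x - Nmap c q (?s True x)"
        using nabla_components(2)[OF c q(1) X Y, of True] nabla_components(2)[OF c q(1) X Y, of False]
        unfolding e by (simp add: adp_def ver_def eq_diff_eq)
      ultimately show "(?s True x, ?s False x - Nmap c (cinv (ic c) x) (?s True x)) = nabla X Y (cinv (ic c) x) (ic c)"
        unfolding e by (intro prod_eqI) simp_all
    qed
    then have "smooth_vf_on (TM A) ?U (nabla X Y)"
      by (intro TM.smooth_vf_onI_chart[OF ic_TM[OF c] U order_refl] nabla_components(1)[OF c _ X Y])
    then show "\<exists>W. TM.is_open W \<and> z \<in> W \<and> smooth_vf_on (TM A) W (nabla X Y)" using U z by blast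
  qed
qed

lemma nabla_eqI:
  assumes "\<And>c z h. c \<in> A \<Longrightarrow> z \<in> cdom (ic c) \<Longrightarrow>
      Z z \<in> TM.T z \<and> Z' z \<in> TM.T z \<and> adp h c z (Z z) = adp h c z (Z' z)"
    and "\<And>z. z \<notin> points (TM A) \<Longrightarrow> Z z = 0 \<and> Z' z = 0"
  shows "Z = Z'"
proof
  fix z show "Z z = Z' z"
  proof (cases "z \<in> points (TM A)")
    case True
    then obtain c where c: "c \<in> A" "z \<in> cdom (ic c)" unfolding points_def TM_def by blast
    from assms(1)[OF c] show ?thesis by (intro adp_eqI[OF c]) simp_all
  qed (use assms(2) in simp)
qed

lemma nabla_linear_connection: "linear_connection (TM A) conn"
proof -
  let ?VF = "vector_fields (TM A)"
  have conn: "conn X Y = nabla X Y" if "X \<in> ?VF" "Y \<in> ?VF" for X Y using that by (simp add: conn_def)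
  have out: "nabla X Y z = 0" if "z \<notin> points (TM A)" for X Y z using that by (simp add: nabla_def)
  have ext: "conn \<in> ?VF \<rightarrow>\<^sub>E (?VF \<rightarrow>\<^sub>E ?VF)"
    unfolding conn_def by (intro restrict_PiE_iff[THEN iffD2] ballI nabla_closed)
  have add_left: "nabla (X + X') Y = (\<lambda>z. nabla X Y z + nabla X' Y z)" if X: "X \<in> ?VF" "X' \<in> ?VF" "Y \<in> ?VF" for X X' Y
  proof (rule nabla_eqI)
    fix c z h assume cz: "c \<in> A" "z \<in> cdom (ic c)"
    note n = nabla_components[OF cz TM.vector_fields_add[OF X(1,2)] X(3)] nabla_components[OF cz X(1,3)] nabla_components[OF cz X(2,3)]
    show "nabla (X + X') Y z \<in> TM.T z \<and> nabla X Y z + nabla X' Y z \<in> TM.T z \<and>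
        adp h c z (nabla (X + X') Y z) = adp h c z (nabla X Y z + nabla X' Y z)"
      unfolding linear_add[OF adp_linear] n(2,4,6) plus_fun_apply[of X X' z]
        nab_add_left[OF cz, of "\<lambda>q. adp h c q (Y q)", OF adp_differentiable[OF cz X(3)]]
      by (intro conjI refl n TM.tangent_add)
  qed (simp add: out del: plus_fun_apply)
  have add_right: "nabla X (Y + Y') = (\<lambda>z. nabla X Y z + nabla X Y' z)" if X: "X \<in> ?VF" "Y \<in> ?VF" "Y' \<in> ?VF" for X Y Y'
  proof (rule nabla_eqI)
    fix c z h assume cz: "c \<in> A" "z \<in> cdom (ic c)"
    note n = nabla_components[OF cz X(1) TM.vector_fields_add[OF X(2,3)]] nabla_components[OF cz X(1,2)] nabla_components[OF cz X(1,3)]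
    have "nab c z (X z) (\<lambda>q. adp h c q ((Y + Y') q))
        = nab c z (X z) (\<lambda>q. adp h c q (Y q)) + nab c z (X z) (\<lambda>q. adp h c q (Y' q))"
      unfolding plus_fun_apply linear_add[OF adp_linear]
      by (rule nab_add_right[OF cz adp_differentiable[OF cz X(2)] adp_differentiable[OF cz X(3)]])
    then show "nabla X (Y + Y') z \<in> TM.T z \<and> nabla X Y z + nabla X Y' z \<in> TM.T z \<and>
        adp h c z (nabla X (Y + Y') z) = adp h c z (nabla X Y z + nabla X Y' z)"
      unfolding linear_add[OF adp_linear] n(2,4,6) by (intro conjI n TM.tangent_add)
  qed (simp add: out del: plus_fun_apply)
  have scale_left: "nabla (\<lambda>p. f p *\<^sub>R X p) Y = (\<lambda>p. f p *\<^sub>R nabla X Y p)"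
    if X: "f \<in> smooth_funs (TM A)" "X \<in> ?VF" "Y \<in> ?VF" for f X Y
  proof (rule nabla_eqI)
    fix c z h assume cz: "c \<in> A" "z \<in> cdom (ic c)"
    note n = nabla_components[OF cz TM.vector_fields_scale[OF X(1,2)] X(3)] nabla_components[OF cz X(2,3)]
    show "nabla (\<lambda>p. f p *\<^sub>R X p) Y z \<in> TM.T z \<and> f z *\<^sub>R nabla X Y z \<in> TM.T z \<and>
        adp h c z (nabla (\<lambda>p. f p *\<^sub>R X p) Y z) = adp h c z (f z *\<^sub>R nabla X Y z)"
      unfolding linear_scale[OF adp_linear] n(2,4)
        nab_scale_left[OF cz, of "\<lambda>q. adp h c q (Y q)", OF adp_differentiable[OF cz X(3)]]
      by (intro conjI refl n TM.tangent_scale)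
  qed (simp add: out)
  have Leibniz: "nabla X (\<lambda>p. f p *\<^sub>R Y p) = (\<lambda>p. dderiv (TM A) f p (X p) *\<^sub>R Y p + f p *\<^sub>R nabla X Y p)"
    if X: "f \<in> smooth_funs (TM A)" "X \<in> ?VF" "Y \<in> ?VF" for f X Y
  proof (rule nabla_eqI)
    fix c z h assume cz: "c \<in> A" "z \<in> cdom (ic c)"
    have zp: "z \<in> points (TM A)" by (rule TM_pointsI[OF cz])
    note n = nabla_components[OF cz X(2) TM.vector_fields_scale[OF X(1,3)]] nabla_components[OF cz X(2,3)]
    have f: "TM.smooth_fun_on (points (TM A)) f" using X(1) TM.smooth_funs_iff by blast
    have fd: "(\<lambda>x. f (cinv (ic c) x)) differentiable (at (cmap (ic c) z))"
      by (rule TM.smooth_fun_on_differentiable[OF f TM.is_open_points ic_TM[OF cz(1)] zp cz(2)])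
    have df: "dderiv (TM A) f z (X z) = fd (\<lambda>x. f (cinv (ic c) x)) (cmap (ic c) z) (X z (ic c))"
      by (rule TM.dderiv_eq[OF f TM.is_open_points ic_TM[OF cz(1)] zp cz(2) TM.vector_fields_tangent[OF X(2) zp]])
    show "nabla X (\<lambda>p. f p *\<^sub>R Y p) z \<in> TM.T z \<and>
        dderiv (TM A) f z (X z) *\<^sub>R Y z + f z *\<^sub>R nabla X Y z \<in> TM.T z \<and>
        adp h c z (nabla X (\<lambda>p. f p *\<^sub>R Y p) z) = adp h c z (dderiv (TM A) f z (X z) *\<^sub>R Y z + f z *\<^sub>R nabla X Y z)"
      unfolding linear_add[OF adp_linear] linear_scale[OF adp_linear] n(2,4) df
        nab_Leibniz[OF cz fd, of "\<lambda>q. adp h c q (Y q)", OF adp_differentiable[OF cz X(3)]]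
      by (intro conjI refl n TM.tangent_add TM.tangent_scale TM.vector_fields_tangent[OF X(3) zp])
  next
    fix z assume z: "z \<notin> points (TM A)"
    then have "Y z = 0" using X(3) TM.vector_fields_iff by blast
    then show "nabla X (\<lambda>p. f p *\<^sub>R Y p) z = 0 \<and> dderiv (TM A) f z (X z) *\<^sub>R Y z + f z *\<^sub>R nabla X Y z = 0"
      by (simp only: out[OF z] scaleR_zero_right add.right_neutral simp_thms)
  qed
  show ?thesis
    unfolding linear_connection_def
  proof (intro conjI ballI)
    show "conn \<in> ?VF \<rightarrow>\<^sub>E ?VF \<rightarrow>\<^sub>E ?VF" by (rule ext)
  next
    fix X X' Y assume X: "X \<in> ?VF" "X' \<in> ?VF" "Y \<in> ?VF"
    show "conn (X + X') Y = conn X Y + conn X' Y"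
      unfolding conn[OF TM.vector_fields_add[OF X(1,2)] X(3)] conn[OF X(1,3)] conn[OF X(2,3)]
      by (rule trans[OF add_left[OF X] plus_fun_def[symmetric]])
  next
    fix X Y Y' assume X: "X \<in> ?VF" "Y \<in> ?VF" "Y' \<in> ?VF"
    show "conn X (Y + Y') = conn X Y + conn X Y'"
      unfolding conn[OF X(1) TM.vector_fields_add[OF X(2,3)]] conn[OF X(1,2)] conn[OF X(1,3)]
      by (rule trans[OF add_right[OF X] plus_fun_def[symmetric]])
  next
    fix f X Y assume X: "f \<in> smooth_funs (TM A)" "X \<in> ?VF" "Y \<in> ?VF"
    show "conn (\<lambda>p. f p *\<^sub>R X p) Y = (\<lambda>p. f p *\<^sub>R conn X Y p)"
      unfolding conn[OF TM.vector_fields_scale[OF X(1,2)] X(3)] conn[OF X(2,3)] by (rule scale_left[OF X])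
  next
    fix f X Y assume X: "f \<in> smooth_funs (TM A)" "X \<in> ?VF" "Y \<in> ?VF"
    show "conn X (\<lambda>p. f p *\<^sub>R Y p) = (\<lambda>p. dderiv (TM A) f p (X p) *\<^sub>R Y p + f p *\<^sub>R conn X Y p)"
      unfolding conn[OF X(2) TM.vector_fields_scale[OF X(1,3)]] conn[OF X(2,3)] by (rule Leibniz[OF X])
  qed
qed

lemma local_conn_components:
  assumes cz: "c \<in> A" "z \<in> cdom (ic c)"
    and X: "smooth_vf_on (TM A) (cdom (ic c)) X" and Y: "smooth_vf_on (TM A) (cdom (ic c)) Y"
  shows "local_conn (TM A) conn X Y z \<in> TM.T z"
    and "adp h c z (local_conn (TM A) conn X Y z) = nab c z (X z) (\<lambda>q. adp h c q (Y q))"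
proof -
  have U: "TM.is_open (cdom (ic c))" by (rule TM.is_open_cdom[OF ic_TM[OF cz(1)]])
  obtain X' V where X': "X' \<in> vector_fields (TM A)" "TM.is_open V" "z \<in> V" "V \<subseteq> cdom (ic c)" "\<And>q. q \<in> V \<Longrightarrow> X' q = X q"
    by (rule TM.local_extension[OF U cz(2) X]) (rule that)
  obtain Y' V' where Y': "Y' \<in> vector_fields (TM A)" "TM.is_open V'" "z \<in> V'" "V' \<subseteq> cdom (ic c)" "\<And>q. q \<in> V' \<Longrightarrow> Y' q = Y q"
    by (rule TM.local_extension[OF U cz(2) Y]) (rule that)
  have "local_conn (TM A) conn X Y z = conn X' Y' z"
    by (rule TM.local_conn_eq[OF nabla_linear_connection X'(1) Y'(1) openin_Int[OF X'(2) Y'(2)]])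
      (use X'(3,5) Y'(3,5) in auto)
  also have "conn X' Y' z = nabla X' Y' z" using X'(1) Y'(1) by (simp add: conn_def)
  finally have eq: "local_conn (TM A) conn X Y z = nabla X' Y' z" .
  have Xz: "X' z = X z" by (rule X'(5)[OF X'(3)])
  note n = nabla_components[OF cz X'(1) Y'(1)]
  show "local_conn (TM A) conn X Y z \<in> TM.T z" unfolding eq by (rule n)
  show "adp h c z (local_conn (TM A) conn X Y z) = nab c z (X z) (\<lambda>q. adp h c q (Y q))"
    unfolding eq n Xz by (rule nab_cong[OF cz Y'(2,3)]) (simp only: Y'(5))
qed

text \<open>The adapted fields have constant components, so that only the terms with \<open>F\<close> remain; these vanish
  for vertical directions since \<open>F\<close> is applied to the horizontal component of the direction.\<close>

lemma conn_d_coeffs: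
  assumes cz: "c \<in> A" "z \<in> cdom (ic c)"
  shows "d_coeffs A H conn c z (\<lambda>i j k. F c z (axis j 1) (axis k 1) $ i) (\<lambda>i j k. 0)"
proof -
  note sd = smooth_vf_delta[OF cz(1)] and sy = smooth_vf_dy[OF cz(1)]
  note lin0 = linear_0[OF F_linear_left[OF cz]] linear_0[OF F_linear_right[OF cz]]
  have U: "TM.is_open (cdom (ic c))" by (rule TM.is_open_cdom[OF ic_TM[OF cz(1)]])
  have nd: "nab c z w (\<lambda>q. adp h c q (delta A H c k q)) = F c z (hor c w) (if h then axis k 1 else 0)"
    "nab c z w (\<lambda>q. adp h c q (dy A c k q)) = F c z (hor c w) (if h then 0 else axis k 1)" for w k h
    by (rule trans[OF nab_cong[OF cz U cz(2)] nab_const[OF cz]], rule adp_frame[OF cz(1)], assumption)+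
  show ?thesis
    unfolding d_coeffs_def
  proof (intro allI conjI)
    fix j k
    note eqI = adp_eqI[OF cz local_conn_components(1)[OF cz]]
    show "local_conn (TM A) conn (delta A H c j) (delta A H c k) z
      = (\<Sum>i\<in>UNIV. F c z (axis j 1) (axis k 1) $ i *\<^sub>R delta A H c i z)"
      by (rule eqI[OF sd sd frame_sum_tangent(1)[OF cz]],
          unfold local_conn_components(2)[OF cz sd sd] nd adp_frame_sum[OF cz] hor_delta[OF cz])
        (simp add: lin0)
    show "local_conn (TM A) conn (delta A H c j) (dy A c k) z
      = (\<Sum>i\<in>UNIV. F c z (axis j 1) (axis k 1) $ i *\<^sub>R dy A c i z)"
      by (rule eqI[OF sd sy frame_sum_tangent(2)[OF cz]],
          unfold local_conn_components(2)[OF cz sd sy] nd adp_frame_sum[OF cz] hor_delta[OF cz])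
        (simp add: lin0)
    show "local_conn (TM A) conn (dy A c j) (delta A H c k) z = (\<Sum>i\<in>UNIV. 0 *\<^sub>R delta A H c i z)"
      by (rule eqI[OF sy sd frame_sum_tangent(1)[OF cz]],
          unfold local_conn_components(2)[OF cz sy sd] nd adp_frame_sum[OF cz] hor_dy[OF cz])
        (simp add: lin0 vec_eq_iff)
    show "local_conn (TM A) conn (dy A c j) (dy A c k) z = (\<Sum>i\<in>UNIV. 0 *\<^sub>R dy A c i z)"
      by (rule eqI[OF sy sy frame_sum_tangent(2)[OF cz]],
          unfold local_conn_components(2)[OF cz sy sy] nd adp_frame_sum[OF cz] hor_dy[OF cz])
        (simp add: lin0 vec_eq_iff)
  qed
qed

lemma conn_d_connection: "d_connection A H conn"
  unfolding d_connection_def using nabla_linear_connection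
proof (intro conjI ballI)
  fix c assume c: "c \<in> A"
  show "\<exists>F C. \<forall>z\<in>cdom (ic c). d_coeffs A H conn c z (F z) (C z)"
    by (intro exI[of _ "\<lambda>z i j k. F c z (axis j 1) (axis k 1) $ i"] exI[of _ "\<lambda>z i j k. 0"] ballI
        conn_d_coeffs[OF c])
qed

end

section \<open>Compatibility and uniqueness\<close>

text \<open>The bilinear map with coefficients \<open>K a i j\<close>, where \<open>a\<close> is the upper index.\<close>

definition coeff_map :: "('n \<Rightarrow> 'n \<Rightarrow> 'n \<Rightarrow> real) \<Rightarrow> real^'n \<Rightarrow> real^'n \<Rightarrow> real^'n"
  where "coeff_map K u v = (\<chi> a. \<Sum>i\<in>UNIV. \<Sum>j\<in>UNIV. K a i j * u $ i * v $ j)"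

lemma coeff_map_linear_left: "linear (\<lambda>u. coeff_map K u v)"
  by (intro linearI) (simp_all add: coeff_map_def vec_eq_iff sum.distrib sum_distrib_left algebra_simps)

lemma coeff_map_linear_right: "linear (coeff_map K u)"
  by (intro linearI) (simp_all add: coeff_map_def vec_eq_iff sum.distrib sum_distrib_left algebra_simps)

lemma coeff_map_axis: "coeff_map K (axis i 1) (axis j 1) = (\<chi> a. K a i j)"
  by (simp add: coeff_map_def axis_def vec_eq_iff if_distrib[of "\<lambda>r. _ * r"] if_distrib[of "\<lambda>r. r * _"] cong: if_cong)

lemma coeff_map_of_bilinear:
  assumes "\<And>u. linear (h u)" "\<And>v. linear (\<lambda>u. h u v)"
  shows "coeff_map (\<lambda>a i j. h (axis i 1) (axis j 1) $ a) u v = h u v"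
  by (rule bilinear_eq_axis[OF coeff_map_linear_right coeff_map_linear_left assms])
    (simp add: coeff_map_axis)

context weyl_metric
begin

lemma dderiv_metric:
  assumes cz: "c \<in> A" "z \<in> cdom (ic c)"
  shows "dderiv (TM A) (\<lambda>z'. g c z' $ j $ k) z (delta A H c i z) = dg c z (axis i 1) $ j $ k"
proof -
  let ?g = "\<lambda>x. g c (cinv (ic c) x)"
  have "((\<lambda>x. ?g x $ j $ k) has_derivative (\<lambda>h. fd ?g (cmap (ic c) z) h $ j $ k)) (at (cmap (ic c) z))"
    by (intro bounded_linear.has_derivative[OF bounded_linear_vec_nth] fd_works g_differentiable cz)
  then have d: "fd (\<lambda>x. ?g x $ j $ k) (cmap (ic c) z) = (\<lambda>h. fd ?g (cmap (ic c) z) h $ j $ k)"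
    and diff: "(\<lambda>x. ?g x $ j $ k) differentiable (at (cmap (ic c) z))"
    by (rule fd_eqI, rule differentiableI)
  show ?thesis
    unfolding TM.dderiv_chart[OF ic_TM[OF cz(1)] cz(2) delta_tangent[OF cz] diff] d delta_self[OF cz]
    by (simp only: dg_def Nmap_axis)
qed

lemma nabla_hlift_eq:
  assumes cz: "c \<in> A" "z \<in> cdom (ic c)" and K: "F_coeff A H D c z = K"
  shows "nabla_hlift A H D X g c z $ j $ k = mform (dg c z (X (fst z) c)) (axis j 1) (axis k 1)
    - mform (g c z) (coeff_map K (X (fst z) c) (axis j 1)) (axis k 1)
    - mform (g c z) (axis j 1) (coeff_map K (X (fst z) c) (axis k 1))" (is "_ = ?L (X (fst z) c)")
proof -
  have h: "h_cov A H D g c z i j k = ?L (axis i 1)" for i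
  proof -
    have 1: "mform (g c z) (coeff_map K (axis i 1) (axis j 1)) (axis k 1) = (\<Sum>a\<in>UNIV. g c z $ a $ k * K a i j)"
      by (simp only: coeff_map_axis mform_axis_right vec_lambda_beta)
    have 2: "mform (g c z) (axis j 1) (coeff_map K (axis i 1) (axis k 1)) = (\<Sum>a\<in>UNIV. g c z $ j $ a * K a i k)"
      by (simp only: coeff_map_axis mform_axis_left vec_lambda_beta)
    show ?thesis unfolding h_cov_def dderiv_metric[OF cz] K 1 2 mform_axis by (rule refl)
  qed
  have lin: "linear ?L"
    by (intro linear_compose_sub linear_compose[OF coeff_map_linear_left mform_linear_left, unfolded o_def]
        linear_compose[OF coeff_map_linear_left mform_linear_right, unfolded o_def])
      (intro linearI, simp_all add: mform_axis linear_add[OF dg_linear[OF cz]] linear_scale[OF dg_linear[OF cz]])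
  have "nabla_hlift A H D X g c z $ j $ k = (\<Sum>i\<in>UNIV. X (fst z) c $ i *\<^sub>R ?L (axis i 1))"
    unfolding nabla_hlift_def vec_lambda_beta h by simp
  also have "\<dots> = ?L (\<Sum>i\<in>UNIV. X (fst z) c $ i *\<^sub>R axis i 1)"
    unfolding linear_sum[OF lin] linear_scale[OF lin] by (rule refl)
  finally show ?thesis unfolding vec_expansion' .
qed

text \<open>Compatibility is a statement about global vector fields; cutting off a field with constant components
  gives one with an arbitrary value at the given point.\<close>

lemma compatible_imp_tg:
  assumes cz: "c \<in> A" "z \<in> cdom (ic c)" and K: "F_coeff A H D c z = K"
    and compat: "\<And>X. X \<in> vector_fields A \<Longrightarrow> nabla_hlift A H D X g c z = \<omega> (fst z) (X (fst z)) *\<^sub>R g c z"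
  shows "mform (g c z) (coeff_map K u v) w + mform (g c z) v (coeff_map K u w) = tg c z u v w"
proof -
  have p: "fst z \<in> cdom c" using cz by simp
  obtain X V where X: "X \<in> vector_fields A" "is_open V" "fst z \<in> V" "V \<subseteq> cdom c"
    "\<And>q. q \<in> V \<Longrightarrow> X q = coord_vec A c q u"
    by (rule local_extension[OF is_open_cdom[OF cz(1)] p smooth_vf_coord_vec[OF cz(1)]]) (rule that)
  have Xp: "X (fst z) = coord_vec A c (fst z) u" by (rule X(5)[OF X(3)])
  have Xc: "X (fst z) c = u" unfolding Xp by (rule coord_vec_self[OF cz(1) p])
  show ?thesis
  proof (rule bilinear_eq_axis[of "\<lambda>v w. mform (g c z) (coeff_map K u v) w + mform (g c z) v (coeff_map K u w)" "tg c z u"])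
    show "linear (\<lambda>w. mform (g c z) (coeff_map K u v) w + mform (g c z) v (coeff_map K u w))" for v
      by (intro linear_compose_add mform_linear_right linear_compose[OF coeff_map_linear_right mform_linear_right, unfolded o_def])
    show "linear (\<lambda>v. mform (g c z) (coeff_map K u v) w + mform (g c z) v (coeff_map K u w))" for w
      by (intro linear_compose_add mform_linear_left linear_compose[OF coeff_map_linear_right mform_linear_left, unfolded o_def])
    show "linear (tg c z u v)" for v by (rule christoffel_data.lin3[OF christoffel_data[OF cz]])
    show "linear (\<lambda>v. tg c z u v w)" for w by (rule christoffel_data.lin2[OF christoffel_data[OF cz]])
    fix j k
    have "nabla_hlift A H D X g c z $ j $ k = om c (fst z) u * mform (g c z) (axis j 1) (axis k 1)"
      unfolding compat[OF X(1)] Xp om_def mform_axis by simp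
    then show "mform (g c z) (coeff_map K u (axis j 1)) (axis k 1) + mform (g c z) (axis j 1) (coeff_map K u (axis k 1))
      = tg c z u (axis j 1) (axis k 1)"
      unfolding nabla_hlift_eq[OF cz K] Xc tg_def by simp
  qed
qed

lemma conn_coeffs:
  assumes cz: "c \<in> A" "z \<in> cdom (ic c)"
  shows "F_coeff A H conn c z = (\<lambda>i j k. F c z (axis j 1) (axis k 1) $ i)"
    and "C_coeff A H conn c z = (\<lambda>i j k. 0)"
  by (rule coeff_eqI[OF cz conn_d_coeffs[OF cz]])+

lemma conn_metric:
  assumes cz: "c \<in> A" "z \<in> cdom (ic c)" and X: "X \<in> vector_fields A"
  shows "nabla_hlift A H conn X g c z = \<omega> (fst z) (X (fst z)) *\<^sub>R g c z"
proof -
  have p: "fst z \<in> cdom c" using cz by simp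
  have XT: "X (fst z) \<in> T (fst z)" using vector_fields_tangent[OF X, of "fst z"] cz p unfolding points_def by blast
  have om: "om c (fst z) (X (fst z) c) = \<omega> (fst z) (X (fst z))"
    unfolding om_def coord_vec_component[OF XT cz(1) p] by (rule refl)
  note FC = coeff_map_of_bilinear[of "F c z", OF F_linear_right[OF cz] F_linear_left[OF cz]]
  have "nabla_hlift A H conn X g c z $ j $ k = \<omega> (fst z) (X (fst z)) * g c z $ j $ k" for j k
    unfolding nabla_hlift_eq[OF cz conn_coeffs(1)[OF cz]] FC om[symmetric]
    using christoffel_data.christoffel_compatible[OF christoffel_data[OF cz], of "X (fst z) c" "axis j 1" "axis k 1"]
    unfolding F_def[symmetric] tg_def[of c z "X (fst z) c"] mform_axis[of "g c z"] by simp
  then show ?thesis by (simp add: vec_eq_iff)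
qed

lemma conn_horizontal: "horizontal A H conn"
  unfolding horizontal_def by (simp add: conn_coeffs(2) del: ic_mem)

lemma conn_h_symmetric: "h_symmetric A H conn"
  unfolding h_symmetric_def
proof (intro ballI allI)
  fix c z i j k assume cz: "c \<in> A" "z \<in> cdom (ic c)"
  show "F_coeff A H conn c z i j k = F_coeff A H conn c z i k j"
    unfolding conn_coeffs(1)[OF cz] F_def
      christoffel_data.christoffel_sym[OF christoffel_data[OF cz], of "axis j 1" "axis k 1"] by (rule refl)
qed

lemma symmetric_metric_coeffs:
  assumes cz: "c \<in> A" "z \<in> cdom (ic c)" and K: "F_coeff A H D c z = K"
    and compat: "\<And>X. X \<in> vector_fields A \<Longrightarrow> nabla_hlift A H D X g c z = \<omega> (fst z) (X (fst z)) *\<^sub>R g c z"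
    and sym: "\<And>i j k. K i j k = K i k j"
  shows "K = (\<lambda>i j k. F c z (axis j 1) (axis k 1) $ i)"
proof -
  have "coeff_map K u v = F c z u v" for u v
    unfolding F_def
  proof (rule christoffel_data.christoffel_unique[OF christoffel_data[OF cz]])
    show "mform (g c z) (coeff_map K u v) w + mform (g c z) v (coeff_map K u w) = tg c z u v w" for u v w
      by (rule compatible_imp_tg[OF cz K compat])
    show "coeff_map K u v = coeff_map K v u" for u v
      by (rule bilinear_eq_axis[OF coeff_map_linear_right coeff_map_linear_left coeff_map_linear_left coeff_map_linear_right])
        (simp only: coeff_map_axis sym)
  qed
  then have "(\<chi> a. K a i j) = F c z (axis i 1) (axis j 1)" for i j unfolding coeff_map_axis[symmetric] .
  then show ?thesis by (auto simp: fun_eq_iff vec_eq_iff)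
qed

text \<open>Passing from \<open>g\<close> to \<open>e\<^sup>2\<^sup>f g\<close>, the derivative of the factor contributes \<open>2 df(u)\<close> times the new metric
  to its derivative, and the change of \<open>\<omega>\<close> takes the same amount away. Hence the metric and \<open>tg\<close> are
  multiplied by the same factor, which does not affect the solution.\<close>

lemma F_conformal:
  assumes W': "weyl_metric A H g' \<omega>'" and f: "f \<in> smooth_funs A" "conformal_by A f g g'"
    and \<omega>': "\<And>p v. p \<in> points A \<Longrightarrow> v \<in> T p \<Longrightarrow> \<omega>' p v = \<omega> p v + 2 * dderiv A f p v"
    and cz: "c \<in> A" "z \<in> cdom (ic c)"
  shows "weyl_metric.F A H g' \<omega>' c z = F c z"
proof -
  interpret W': weyl_metric A H g' \<omega>' by (rule W')
  interpret C: christoffel_data "g c z" "tg c z" by (rule christoffel_data[OF cz])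
  interpret C': christoffel_data "g' c z" "W'.tg c z" by (rule W'.christoffel_data[OF cz])
  define r where "r = exp (2 * f (fst z))"
  have g': "g' c q = exp (2 * f (fst q)) *\<^sub>R g c q" if "q \<in> cdom (ic c)" for q
    using f(2) cz(1) that unfolding conformal_by_def by blast
  have p: "fst z \<in> cdom c" "fst z \<in> points A" using cz by (auto simp: points_def)
  let ?x = "cmap (ic c) z"
  let ?df = "fd (\<lambda>y. f (cinv c y)) (cmap c (fst z))"
  have fs: "smooth_fun_on (points A) f" using f(1) smooth_funs_iff by blast
  have "((\<lambda>y. f (cinv c y)) has_derivative ?df) (at (cmap c (fst z)))"
    by (rule fd_works[OF smooth_fun_on_differentiable[OF fs is_open_points cz(1) p(2,1)]])
  then have 1: "((\<lambda>x. f (cinv c (fst x))) has_derivative (\<lambda>h. ?df (fst h))) (at ?x)"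
    using diff_chain_at[OF has_derivative_fst[OF has_derivative_ident, of "at ?x"], of "\<lambda>y. f (cinv c y)"]
    by (simp add: o_def)
  have 2: "((\<lambda>x. exp (2 * f (cinv c (fst x)))) has_derivative (\<lambda>h. r * (2 * ?df (fst h)))) (at ?x)"
    using 1 cz p by (auto intro!: derivative_eq_intros simp: r_def)
  have zc: "cinv (ic c) ?x = z" "cinv c (fst ?x) = fst z"
    using TM.cinv_cmap[OF ic_TM[OF cz(1)] cz(2)] cz(1) p by simp_all
  have "((\<lambda>x. exp (2 * f (cinv c (fst x))) *\<^sub>R g c (cinv (ic c) x)) has_derivative
      (\<lambda>h. r *\<^sub>R fd (\<lambda>x. g c (cinv (ic c) x)) ?x h + (r * (2 * ?df (fst h))) *\<^sub>R g c z)) (at ?x)"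
    using has_derivative_scaleR[OF 2 fd_works[OF g_differentiable[OF cz]]] unfolding zc r_def[symmetric] .
  then have "((\<lambda>x. g' c (cinv (ic c) x)) has_derivative
      (\<lambda>h. r *\<^sub>R fd (\<lambda>x. g c (cinv (ic c) x)) ?x h + (r * (2 * ?df (fst h))) *\<^sub>R g c z)) (at ?x)"
  proof (rule has_derivative_transform_within_open[OF _ TM.open_chart[OF ic_TM[OF cz(1)]] imageI[OF cz(2)]])
    fix x assume "x \<in> cmap (ic c) ` cdom (ic c)"
    then obtain q where q: "q \<in> cdom (ic c)" "x = cmap (ic c) q" by blast
    then have "cinv (ic c) x = q" using TM.cinv_cmap[OF ic_TM[OF cz(1)]] by blast
    then show "exp (2 * f (cinv c (fst x))) *\<^sub>R g c (cinv (ic c) x) = g' c (cinv (ic c) x)"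
      using g'[OF q(1)] q cz(1) by simp
  qed
  from fd_eqI[OF this] have dg': "W'.dg c z u = r *\<^sub>R dg c z u + (r * (2 * ?df u)) *\<^sub>R g c z" for u
    unfolding W'.dg_def dg_def by simp
  have om': "W'.om c (fst z) u = om c (fst z) u + 2 * ?df u" for u
    unfolding W'.om_def om_def \<omega>'[OF p(2) coord_vec_tangent[OF cz(1) p(1)]]
      dderiv_eq[OF fs is_open_points cz(1) p(2,1) coord_vec_tangent[OF cz(1) p(1)]]
      coord_vec_self[OF cz(1) p(1)] by (rule refl)
  have add: "mform (m + m') v w = mform m v w + mform m' v w" for m m' :: "real^'n^'n" and v w
    by (simp add: mform_def matrix_vector_mult_add_rdistrib inner_add_right)
  have tg': "W'.tg c z u v w = r * tg c z u v w" for u v w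
    unfolding W'.tg_def tg_def dg' om' g'[OF cz(2)] r_def[symmetric] add mform_scaleR_matrix
    by (simp add: algebra_simps)
  have "christoffel (g c z) (tg c z) u v = christoffel (g' c z) (W'.tg c z) u v" for u v
  proof (rule C'.christoffel_unique)
    show "christoffel (g c z) (tg c z) u v = christoffel (g c z) (tg c z) v u" for u v
      by (rule C.christoffel_sym)
    show "mform (g' c z) (christoffel (g c z) (tg c z) u v) w + mform (g' c z) v (christoffel (g c z) (tg c z) u w)
      = W'.tg c z u v w" for u v w
      unfolding tg' g'[OF cz(2)] r_def[symmetric] mform_scaleR_matrix distrib_left[symmetric] C.christoffel_compatible
      by (rule refl)
  qed
  then show ?thesis unfolding W'.F_def F_def by (intro ext) simp
qed

end

lemma conformal_class:
  assumes "smooth_atlas A" "conformal_structure A \<G>"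
  obtains g where "g \<in> \<G>" "g \<in> GL_metrics A"
    "\<And>g'. g' \<in> \<G> \<Longrightarrow> g' \<in> GL_metrics A \<and> (\<exists>f\<in>smooth_funs A. conformal_by A f g g')"
proof -
  interpret atlas A by unfold_locales (rule assms(1))
  obtain g where g: "g \<in> GL_metrics A" "\<G> = conformal_rel A `` {g}"
    using assms(2) unfolding conformal_structure_def by (rule quotientE)
  have "(\<lambda>p. 0) \<in> smooth_funs A" unfolding smooth_funs_iff by (rule smooth_fun_on_const)
  moreover have "conformal_by A (\<lambda>p. 0) g g" unfolding conformal_by_def by simp
  ultimately have "g \<in> \<G>" unfolding g(2) conformal_rel_def using g(1) by blast
  moreover have "g' \<in> GL_metrics A \<and> (\<exists>f\<in>smooth_funs A. conformal_by A f g g')" if "g' \<in> \<G>" for g'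
    using that unfolding g(2) conformal_rel_def by blast
  ultimately show ?thesis using that g(1) by blast
qed

theorem theorem2p6:
  fixes A :: "('a, real^'n) chart set"
    and \<G> :: "('a, 'n) dtensor set"
    and W :: "('a, 'n) dtensor \<Rightarrow> 'a \<Rightarrow> ('a, real^'n) tvec \<Rightarrow> real"
    and H :: "('a, 'n) tm_distribution"
  assumes "GLW_manifold A \<G> W"
    and "nonlinear_connection A H"
  shows "\<exists>!D. d_connection A H D \<and> compatible A H \<G> W D \<and> horizontal A H D \<and> h_symmetric A H D"
proof -
  have A: "smooth_atlas A" "Hausdorff_space (atlas_topology A)"
    and G: "conformal_structure A \<G>" and W: "\<And>g. g \<in> \<G> \<Longrightarrow> W g \<in> one_forms A"
    and W_change: "\<And>g g' f p v. g \<in> \<G> \<Longrightarrow> g' \<in> \<G> \<Longrightarrow> f \<in> smooth_funs A \<Longrightarrow> conformal_by A f g g' \<Longrightarrow>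
      p \<in> points A \<Longrightarrow> v \<in> tangent_space A p \<Longrightarrow> W g' p v = W g p v + 2 * dderiv A f p v"
    using assms(1) unfolding GLW_manifold_def smooth_manifold_def by (blast dest: funcset_mem)+
  obtain g where base: "g \<in> \<G>" "g \<in> GL_metrics A"
    "\<And>g'. g' \<in> \<G> \<Longrightarrow> g' \<in> GL_metrics A \<and> (\<exists>f\<in>smooth_funs A. conformal_by A f g g')"
    by (rule conformal_class[OF A(1) G]) (rule that)
  have weyl: "weyl_metric A H g' (W g')" if "g' \<in> \<G>" for g'
    by unfold_locales (use A assms(2) base(3)[OF that] W[OF that] in simp_all)
  interpret weyl_metric A H g "W g" by (rule weyl[OF base(1)])
  show ?thesis
  proof (rule ex1I[of _ conn])
    have "compatible A H \<G> W conn"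
      unfolding compatible_def by (rule bexI[OF _ base(1)]) (intro ballI conn_metric)
    then show "d_connection A H conn \<and> compatible A H \<G> W conn \<and> horizontal A H conn \<and> h_symmetric A H conn"
      by (intro conjI conn_d_connection conn_horizontal conn_h_symmetric)
  next
    fix D assume D: "d_connection A H D \<and> compatible A H \<G> W D \<and> horizontal A H D \<and> h_symmetric A H D"
    \<comment> \<open>The connection \<open>D\<close> may be compatible by way of a different member of the class.\<close>
    then obtain g' where g': "g' \<in> \<G>"
      and compat: "\<forall>X\<in>vector_fields A. \<forall>c\<in>A. \<forall>z\<in>cdom (ic c).
        nabla_hlift A H D X g' c z = W g' (fst z) (X (fst z)) *\<^sub>R g' c z"
      unfolding compatible_def by blast
    obtain f where f: "f \<in> smooth_funs A" "conformal_by A f g g'" using base(3)[OF g'] by blast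
    show "D = conn"
    proof (rule connection_determined_by_coeffs[OF _ nabla_linear_connection])
      show "linear_connection (TM A) D" using D unfolding d_connection_def by blast
      fix c z assume cz: "c \<in> A" "z \<in> cdom (ic c)"
      obtain K C where KC: "d_coeffs A H D c z K C"
        using D cz unfolding d_connection_def by blast
      note KC' = coeff_eqI[OF cz KC]
      have "C = (\<lambda>i j k. 0)"
        using D cz unfolding horizontal_def KC'(2)[symmetric] by blast
      moreover have "K = (\<lambda>i j k. weyl_metric.F A H g' (W g') c z (axis j 1) (axis k 1) $ i)"
      proof (rule weyl_metric.symmetric_metric_coeffs[OF weyl[OF g'] cz KC'(1)])
        show "nabla_hlift A H D X g' c z = W g' (fst z) (X (fst z)) *\<^sub>R g' c z" if "X \<in> vector_fields A" for X
          using compat cz that by blast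
        show "K i j k = K i k j" for i j k
          using D cz unfolding h_symmetric_def KC'(1)[symmetric] by blast
      qed
      moreover have "weyl_metric.F A H g' (W g') c z = F c z"
        by (rule F_conformal[OF weyl[OF g'] f W_change[OF base(1) g' f] cz])
      ultimately show "\<exists>F C. d_coeffs A H D c z F C \<and> d_coeffs A H conn c z F C"
        using KC conn_d_coeffs[OF cz] by auto
    qed
  qed
qed

end
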